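(* The quasi-interpolation operator $\mathcal J_h^p$, defined on $H^1_0(\Omega)$ by $\mathcal J_h^p u = \sum_{\boldsymbol a \in \mathcal V_h} s_h^{\boldsymbol a}((\pi_h^p u)|_{\omega_{\boldsymbol a}})$, is a projector, i.e., $$\mathcal J_h^p(u) = u \qquad \forall u \in \mathcal P_p(\mathcal T_h) \cap H^1_0(\Omega).$$
   Context: Setting. Let $d\ge 1$ and $p\ge 1$ be integers and let $\Omega\subset\mathbb R^d$ be an open, bounded, connected, Lipschitz polyhedral domain, partitioned into a (finite) mesh $\mathcal T_h$ of open simplices $K$. The mesh is matching: the intersection of the closures of two distinct elements is either empty or a single common $d'$-dimensional subsimplex of both, $0\le d'\le d-1$. $\mathcal V_h$ is the set of vertices of $\mathcal T_h$. $\|\cdot\|_\omega$ and $(\cdot,\cdot)_\omega$ are the $L^2(\omega)$ norm and inner product (scalar or vector). $\nabla_h$ is the elementwise (broken) gradient, $(\nabla_h v)|_K=\nabla(v|_K)$. Patches and hat functions. For $\boldsymbol a\in\mathcal V_h$, $\psi_{\boldsymbol a}$ is the continuous, piecewise (on $\mathcal T_h$) affine function with $\psi_{\boldsymbol a}(\boldsymbol b)=\delta_{\boldsymbol a,\boldsymbol b}$ for all $\boldsymbol b\in\mathcal V_h$; $\mathcal T_{\boldsymbol a}$ is the set of elements having $\boldsymbol a$ as a vertex, and $\omega_{\boldsymbol a}$ is the corresponding open domain (corresponding to the support of $\psi_{\boldsymbol a}$). Polynomial spaces. $\mathcal P_q(K)$ is the set of polynomials of total degree at most $q$ on $K$. For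 a set $\mathcal T$ of simplices, $\mathcal P_q(\mathcal T)$ is the corresponding broken (elementwise, no continuity) space. Lagrange interpolation. $\mathcal I_h^p:\mathcal P_{p+1}(\mathcal T)\to\mathcal P_p(\mathcal T)$ is the elementwise Lagrange interpolation operator: on each $K$, $(\mathcal I_h^p v)|_K\in\mathcal P_p(K)$ coincides with $v|_K$ at the standard degree-$p$ Lagrange nodes of $K$ (points with barycentric coordinates in $\{0,1/p,\dots,1\}$). Local-best approximation. For $v\in H^1(\Omega)$ (or elementwise $H^1$), $\pi_h^p v\in\mathcal P_p(\mathcal T_h)$ is defined on each $K\in\mathcal T_h$ by $(\pi_h^p v,1)_K=(v,1)_K$ and $(\nabla(\pi_h^p v),\nabla q_h)_K=(\nabla v,\nabla q_h)_K$ for all $q_h\in\mathcal P_p(K)$. Local potential reconstruction. For $\boldsymbol a\in\mathcal V_h$ and $u_h\in\mathcal P_p(\mathcal T_{\boldsymbol a})$, $s_h^{\boldsymbol a}(u_h)\in\mathcal P_p(\mathcal T_{\boldsymbol a})\cap H^1_0(\omega_{\boldsymbol a})$ is the unique minimizer of $\|\nabla_h(\mathcal I_h^p(\psi_{\boldsymbol a}u_h)-v_h)\|_{\omega_{\boldsymbol a}}$ over $v_h\in\mathcal P_p(\mathcal T_{\boldsymbol a})\cap H^1_0(\omega_{\boldsymbol a})$, extended by zero outside $\omega_{\boldsymbol a}$. *)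

theory Defs
  imports "HOL-Analysis.Analysis"
begin

section \<open>Sobolev spaces\<close>

text \<open>
  Elements of \<open>L\<^sup>2(S)\<close> and \<open>H\<^sup>1(S)\<close> are represented by functions on the whole space of which only
  the values on \<open>S\<close>, up to null sets, are relevant.
\<close>

primrec iter_deriv :: "'a list \<Rightarrow> ('a::euclidean_space \<Rightarrow> real) \<Rightarrow> 'a \<Rightarrow> real" where
  "iter_deriv [] f = f"
| "iter_deriv (v # vs) f = iter_deriv vs (\<lambda>x. frechet_derivative f (at x) v)"

definition smooth_fun :: "('a::euclidean_space \<Rightarrow> real) \<Rightarrow> bool" where
  "smooth_fun f \<longleftrightarrow> (\<forall>vs x. iter_deriv vs f differentiable (at x))"

definition test_functions :: "'a::euclidean_space set \<Rightarrow> ('a \<Rightarrow> real) set" where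
  "test_functions S = {\<phi>. smooth_fun \<phi> \<and> compact (closure {x. \<phi> x \<noteq> 0}) \<and>
                          closure {x. \<phi> x \<noteq> 0} \<subseteq> S}"

definition L2 :: "'a::euclidean_space set \<Rightarrow> ('a \<Rightarrow> 'b::euclidean_space) set" where
  "L2 S = {f. f \<in> borel_measurable (lebesgue_on S) \<and>
              integrable (lebesgue_on S) (\<lambda>x. (norm (f x))\<^sup>2)}"

definition L2_norm_on :: "'a::euclidean_space set \<Rightarrow> ('a \<Rightarrow> 'b::euclidean_space) \<Rightarrow> real" where
  "L2_norm_on S f = sqrt (LINT x|lebesgue_on S. (norm (f x))\<^sup>2)"

definition has_weak_gradient ::
  "'a::euclidean_space set \<Rightarrow> ('a \<Rightarrow> real) \<Rightarrow> ('a \<Rightarrow> 'a) \<Rightarrow> bool" where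
  "has_weak_gradient S u g \<longleftrightarrow> u \<in> L2 S \<and> g \<in> L2 S \<and>
     (\<forall>\<phi>\<in>test_functions S. \<forall>b\<in>Basis.
        (LINT x|lebesgue_on S. u x * frechet_derivative \<phi> (at x) b) =
        - (LINT x|lebesgue_on S. (g x \<bullet> b) * \<phi> x))"

definition H1 :: "'a::euclidean_space set \<Rightarrow> ('a \<Rightarrow> real) set" where
  "H1 S = {u. \<exists>g. has_weak_gradient S u g}"

text \<open>For open \<open>S\<close> and \<open>u \<in> H1 S\<close> the weak gradient is determined up to a null subset of \<open>S\<close>.\<close>

definition weak_gradient :: "'a::euclidean_space set \<Rightarrow> ('a \<Rightarrow> real) \<Rightarrow> 'a \<Rightarrow> 'a" where
  "weak_gradient S u = (SOME g. has_weak_gradient S u g)"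

definition H1_norm :: "'a::euclidean_space set \<Rightarrow> ('a \<Rightarrow> real) \<Rightarrow> real" where
  "H1_norm S u = sqrt ((L2_norm_on S u)\<^sup>2 + (L2_norm_on S (weak_gradient S u))\<^sup>2)"

text \<open>\<open>H\<^sup>1\<^sub>0(S)\<close> is the closure of the test functions in \<open>H\<^sup>1(S)\<close>.\<close>

definition H10 :: "'a::euclidean_space set \<Rightarrow> ('a \<Rightarrow> real) set" where
  "H10 S = {u \<in> H1 S. \<forall>\<epsilon>>0. \<exists>\<phi>\<in>test_functions S. H1_norm S (\<lambda>x. u x - \<phi> x) < \<epsilon>}"


section \<open>Domains and meshes\<close>

text \<open>Near each boundary point the domain is the strict epigraph, in some unit direction \<open>e\<close>, of a
  Lipschitz function on the hyperplane orthogonal to \<open>e\<close>.\<close>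

definition lipschitz_boundary :: "'a::euclidean_space set \<Rightarrow> bool" where
  "lipschitz_boundary \<Omega> \<longleftrightarrow>
     (\<forall>x\<in>frontier \<Omega>. \<exists>U e L (g :: 'a \<Rightarrow> real).
        open U \<and> x \<in> U \<and> norm e = 1 \<and> L-lipschitz_on {z. z \<bullet> e = 0} g \<and>
        \<Omega> \<inter> U = {y \<in> U. g (y - (y \<bullet> e) *\<^sub>R e) < y \<bullet> e})"

definition lipschitz_polyhedral_domain :: "'a::euclidean_space set \<Rightarrow> bool" where
  "lipschitz_polyhedral_domain \<Omega> \<longleftrightarrow>
     open \<Omega> \<and> bounded \<Omega> \<and> connected \<Omega> \<and> lipschitz_boundary \<Omega> \<and>
     (\<exists>\<P>. finite \<P> \<and> (\<forall>P\<in>\<P>. polytope P) \<and> closure \<Omega> = \<Union>\<P>)"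

definition open_simplex :: "'a::euclidean_space set \<Rightarrow> bool" where
  "open_simplex K \<longleftrightarrow> (\<exists>S. int DIM('a) simplex S \<and> K = interior S)"

definition vertices :: "'a::euclidean_space set \<Rightarrow> 'a set" where
  "vertices K = {x. x extreme_point_of closure K}"

definition matching_mesh :: "'a::euclidean_space set \<Rightarrow> 'a set set \<Rightarrow> bool" where
  "matching_mesh \<Omega> \<T> \<longleftrightarrow>
     finite \<T> \<and> (\<forall>K\<in>\<T>. open_simplex K \<and> K \<subseteq> \<Omega>) \<and> pairwise disjnt \<T> \<and>
     closure \<Omega> = (\<Union>K\<in>\<T>. closure K) \<and>
     (\<forall>K\<in>\<T>. \<forall>K'\<in>\<T>. K \<noteq> K' \<longrightarrow>
        closure K \<inter> closure K' = {} \<or>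
        (\<exists>d'. 0 \<le> d' \<and> d' \<le> int DIM('a) - 1 \<and> d' simplex (closure K \<inter> closure K')) \<and>
        (closure K \<inter> closure K') face_of closure K \<and>
        (closure K \<inter> closure K') face_of closure K')"

definition mesh_vertices :: "'a::euclidean_space set set \<Rightarrow> 'a set" where
  "mesh_vertices \<T> = (\<Union>K\<in>\<T>. vertices K)"

definition patch :: "'a::euclidean_space set set \<Rightarrow> 'a \<Rightarrow> 'a set set" where
  "patch \<T> a = {K \<in> \<T>. a \<in> vertices K}"

definition patch_domain :: "'a::euclidean_space set set \<Rightarrow> 'a \<Rightarrow> 'a set" where
  "patch_domain \<T> a = interior (\<Union>K\<in>patch \<T> a. closure K)"


section \<open>Polynomials\<close>

definition polynomials :: "nat \<Rightarrow> ('a::euclidean_space \<Rightarrow> real) set" where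
  "polynomials q = {f. \<exists>A c. finite A \<and> (\<forall>\<alpha>\<in>A. (\<Sum>b\<in>Basis. \<alpha> b) \<le> q) \<and>
     f = (\<lambda>x. \<Sum>\<alpha>\<in>A. c \<alpha> * (\<Prod>b\<in>Basis. (x \<bullet> b) ^ (\<alpha> b :: nat)))}"

text \<open>No condition is imposed off the open elements; in particular the values on the mesh skeleton,
  which is a null set, are arbitrary.\<close>

definition broken_polynomials :: "nat \<Rightarrow> 'a::euclidean_space set set \<Rightarrow> ('a \<Rightarrow> real) set" where
  "broken_polynomials q \<T> = {v. \<forall>K\<in>\<T>. \<exists>P\<in>polynomials q. \<forall>x\<in>K. v x = P x}"

definition broken_gradient ::
  "'a::euclidean_space set set \<Rightarrow> ('a \<Rightarrow> real) \<Rightarrow> 'a \<Rightarrow> 'a" where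
  "broken_gradient \<T> v x = (\<Sum>K\<in>\<T>. indicator K x *\<^sub>R weak_gradient K v x)"

text \<open>The hat function is normalised to vanish off the closed elements.\<close>

definition hat_function :: "'a::euclidean_space set set \<Rightarrow> 'a \<Rightarrow> 'a \<Rightarrow> real" where
  "hat_function \<T> a = (THE \<psi>.
     continuous_on (\<Union>K\<in>\<T>. closure K) \<psi> \<and> \<psi> \<in> broken_polynomials 1 \<T> \<and>
     (\<forall>b\<in>mesh_vertices \<T>. \<psi> b = (if b = a then 1 else 0)) \<and>
     (\<forall>x. x \<notin> (\<Union>K\<in>\<T>. closure K) \<longrightarrow> \<psi> x = 0))"

definition lagrange_nodes :: "nat \<Rightarrow> 'a::euclidean_space set \<Rightarrow> 'a set" where
  "lagrange_nodes p K = {\<Sum>b\<in>vertices K. (real (k b) / real p) *\<^sub>R b | k :: 'a \<Rightarrow> nat.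
     (\<Sum>b\<in>vertices K. k b) = p}"

text \<open>Nodes may lie on the boundary of \<open>K\<close>; the value of \<open>v|\<^sub>K\<close> there is the limit from inside \<open>K\<close>.\<close>

definition lagrange_interpolation ::
  "nat \<Rightarrow> 'a::euclidean_space set set \<Rightarrow> ('a \<Rightarrow> real) \<Rightarrow> 'a \<Rightarrow> real" where
  "lagrange_interpolation p \<T> v x = (\<Sum>K\<in>\<T>. indicator K x *
     (THE P. P \<in> polynomials p \<and> (\<forall>y\<in>lagrange_nodes p K. P y = Lim (at y within K) v)) x)"

definition local_best ::
  "nat \<Rightarrow> 'a::euclidean_space set set \<Rightarrow> ('a \<Rightarrow> real) \<Rightarrow> 'a \<Rightarrow> real" where
  "local_best p \<T> v x = (\<Sum>K\<in>\<T>. indicator K x *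
     (THE P. P \<in> polynomials p \<and>
        (LINT y|lebesgue_on K. P y) = (LINT y|lebesgue_on K. v y) \<and>
        (\<forall>q\<in>polynomials p.
           (LINT y|lebesgue_on K. weak_gradient K P y \<bullet> weak_gradient K q y) =
           (LINT y|lebesgue_on K. weak_gradient K v y \<bullet> weak_gradient K q y))) x)"


section \<open>Potential reconstruction and the quasi-interpolation operator\<close>

definition patch_space ::
  "nat \<Rightarrow> 'a::euclidean_space set set \<Rightarrow> 'a \<Rightarrow> ('a \<Rightarrow> real) set" where
  "patch_space p \<T> a = broken_polynomials p (patch \<T> a) \<inter> H10 (patch_domain \<T> a)"

text \<open>The minimiser is unique up to a null subset of the patch domain. Only the values of \<open>u\<close> on
  the elements of the patch enter, so no explicit restriction of \<open>u\<close> is needed; the indicator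
  realises the extension by zero.\<close>

definition potential_reconstruction ::
  "nat \<Rightarrow> 'a::euclidean_space set set \<Rightarrow> 'a \<Rightarrow> ('a \<Rightarrow> real) \<Rightarrow> 'a \<Rightarrow> real" where
  "potential_reconstruction p \<T> a u x = indicator (patch_domain \<T> a) x *
     (arg_min
        (\<lambda>v. L2_norm_on (patch_domain \<T> a) (broken_gradient (patch \<T> a)
           (\<lambda>y. lagrange_interpolation p (patch \<T> a) (\<lambda>z. hat_function \<T> a z * u z) y - v y)))
        (\<lambda>v. v \<in> patch_space p \<T> a)) x"

definition quasi_interpolation ::
  "nat \<Rightarrow> 'a::euclidean_space set set \<Rightarrow> ('a \<Rightarrow> real) \<Rightarrow> 'a \<Rightarrow> real" where
  "quasi_interpolation p \<T> u x =
     (\<Sum>a\<in>mesh_vertices \<T>. potential_reconstruction p \<T> a (local_best p \<T> u) x)"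

end

theory Submission
  imports Defs
begin

text \<open>
  A function \<open>u\<close> that is already a piecewise polynomial in \<open>H\<^sup>1\<^sub>0(\<Omega>)\<close> should survive every step of the
  construction. Elementwise this is algebra. The local projection reproduces \<open>u\<close> on each element
  (\<open>local_best_eq\<close>), and since the hat functions form a partition of unity, the nodal interpolants of
  their products with \<open>u\<close> add up to \<open>u\<close> (\<open>nodal_product_sum\<close>), by the unisolvence of the
  Lagrange nodes (\<open>polynomial_eq_0_if_nodes\<close>). The theorem follows once minimisation on the patch
  of a vertex \<open>a\<close> returns the interpolant \<open>w\<close> of the product of its hat function with \<open>u\<close>. For
  this it is enough that \<open>w\<close> itself belongs to the space over which one minimises: the functional
  then attains the value zero, and a function of \<open>H\<^sup>1\<^sub>0\<close> with zero gradient vanishes by the Poincare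
  inequality (\<open>H10_zero_gradient\<close>).

  So the heart of the matter is that \<open>w\<close> lies in \<open>H\<^sup>1\<^sub>0\<close> of the patch domain, that is, in the closure of
  the test functions. Since \<open>u\<close> has a bounded gradient, its extension by zero is Lipschitz continuous
  (\<open>H10_lipschitz\<close>), which yields at one stroke that its polynomials match on the common faces of
  all dimensions and vanish on the boundary (\<open>trace_agree\<close>). The nodal values of \<open>w\<close> inherit this, and
  the values of a polynomial on a face depend only on the nodes of this face. Hence \<open>w\<close> is a continuous
  function, even a Lipschitz continuous one, and it vanishes off the patch domain
  (\<open>nodal_product_zero\<close>): the smallest face around a point there either misses \<open>a\<close> or lies in the
  boundary of \<open>\<Omega>\<close>. Finally, a Lipschitz function that vanishes off a bounded open set and is a
  polynomial on each element is a limit of test functions (\<open>H10_if_lipschitz\<close>): soft thresholding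
  moves its support into the interior, and mollification does the rest. That \<open>\<Omega>\<close> has a Lipschitz
  boundary serves to approach boundary points from the exterior (\<open>frontier_in_closure_exterior\<close>).
\<close>

section \<open>Smooth functions\<close>

abbreviation dir_deriv :: "('a::euclidean_space \<Rightarrow> real) \<Rightarrow> 'a \<Rightarrow> 'a \<Rightarrow> real" where
  "dir_deriv f v \<equiv> (\<lambda>x. frechet_derivative f (at x) v)"

lemma smooth_fun_coinduct:
  assumes "f \<in> A"
    and step: "\<And>f. f \<in> A \<Longrightarrow> (\<forall>x. f differentiable (at x)) \<and> (\<forall>v. dir_deriv f v \<in> A)"
  shows "smooth_fun f"
proof -
  have "iter_deriv vs g \<in> A" if "g \<in> A" for vs g
    using that by (induction vs arbitrary: g) (use step in auto)
  then show ?thesis using assms by (auto simp: smooth_fun_def)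
qed

lemma smooth_fun_differentiable: "smooth_fun f \<Longrightarrow> f differentiable (at x)"
  unfolding smooth_fun_def by (metis iter_deriv.simps(1))

lemma smooth_fun_dir_deriv: "smooth_fun f \<Longrightarrow> smooth_fun (dir_deriv f v)"
  unfolding smooth_fun_def by (metis iter_deriv.simps(2))

lemma smooth_fun_continuous: "smooth_fun f \<Longrightarrow> continuous_on A f"
  by (meson continuous_at_imp_continuous_on differentiable_imp_continuous_within
      smooth_fun_differentiable)

lemma dir_deriv_eqI: "(f has_derivative D) (at x) \<Longrightarrow> frechet_derivative f (at x) v = D v"
  using frechet_derivative_at by force

inductive_set algebra_span :: "('a::euclidean_space \<Rightarrow> real) set \<Rightarrow> ('a \<Rightarrow> real) set"
  for B where
  base: "f \<in> B \<Longrightarrow> f \<in> algebra_span B"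
| const: "(\<lambda>_. c) \<in> algebra_span B"
| add: "f \<in> algebra_span B \<Longrightarrow> g \<in> algebra_span B \<Longrightarrow> (\<lambda>x. f x + g x) \<in> algebra_span B"
| mult: "f \<in> algebra_span B \<Longrightarrow> g \<in> algebra_span B \<Longrightarrow> (\<lambda>x. f x * g x) \<in> algebra_span B"

text \<open>By the sum and product rules, the derivatives of an algebra of functions stay in the algebra
  as soon as those of its generators do.\<close>

lemma smooth_fun_algebra_span:
  assumes "f \<in> algebra_span B"
    and B: "\<And>f v. f \<in> B \<Longrightarrow> (\<forall>x. f differentiable (at x)) \<and> dir_deriv f v \<in> algebra_span B"
  shows "smooth_fun f"
proof (rule smooth_fun_coinduct[OF assms(1)])
  fix f assume "f \<in> algebra_span B"
  then show "(\<forall>x. f differentiable at x) \<and> (\<forall>v. dir_deriv f v \<in> algebra_span B)"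
  proof induction
    case (base f) then show ?case using B by blast
  next
    case (const c)
    then show ?case by (simp add: frechet_derivative_const algebra_span.const)
  next
    case (add f g)
    have "dir_deriv (\<lambda>x. f x + g x) v = (\<lambda>x. dir_deriv f v x + dir_deriv g v x)" for v
      by (rule ext, rule dir_deriv_eqI)
        (intro has_derivative_add; use add.IH in \<open>simp add: frechet_derivative_works\<close>)
    then show ?case using add.IH by (auto intro: algebra_span.add)
  next
    case (mult f g)
    have "dir_deriv (\<lambda>x. f x * g x) v = (\<lambda>x. f x * dir_deriv g v x + dir_deriv f v x * g x)" for v
      by (rule ext, rule dir_deriv_eqI)
        (rule has_derivative_mult; use mult.IH in \<open>simp add: frechet_derivative_works\<close>)
    then show ?case using mult.IH mult.hyps by (auto intro!: algebra_span.add algebra_span.mult)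
  qed
qed

lemma smooth_fun_algebra_span_smooth:
  assumes "f \<in> algebra_span (Collect smooth_fun)" shows "smooth_fun f"
  using assms
  by (rule smooth_fun_algebra_span)
    (auto intro: algebra_span.base smooth_fun_differentiable smooth_fun_dir_deriv)

lemma smooth_fun_const: "smooth_fun (\<lambda>_. c)"
  by (simp add: smooth_fun_algebra_span_smooth algebra_span.const)

lemma smooth_fun_add: "smooth_fun f \<Longrightarrow> smooth_fun g \<Longrightarrow> smooth_fun (\<lambda>x. f x + g x)"
  by (simp add: smooth_fun_algebra_span_smooth algebra_span.add algebra_span.base)

lemma smooth_fun_mult: "smooth_fun f \<Longrightarrow> smooth_fun g \<Longrightarrow> smooth_fun (\<lambda>x. f x * g x)"
  by (simp add: smooth_fun_algebra_span_smooth algebra_span.mult algebra_span.base)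

lemma smooth_fun_diff: "smooth_fun f \<Longrightarrow> smooth_fun g \<Longrightarrow> smooth_fun (\<lambda>x. f x - g x)"
  using smooth_fun_add[of f "\<lambda>x. (-1) * g x"] smooth_fun_mult[OF smooth_fun_const, of g "-1"] by simp

lemma smooth_fun_prod: "(\<And>i. i \<in> I \<Longrightarrow> smooth_fun (f i)) \<Longrightarrow> smooth_fun (\<lambda>x. \<Prod>i\<in>I. f i x)"
  by (induction I rule: infinite_finite_induct) (auto intro: smooth_fun_mult smooth_fun_const)

lemma smooth_fun_inner: "smooth_fun (\<lambda>x. x \<bullet> v)"
proof (rule smooth_fun_algebra_span[where B = "{\<lambda>x. x \<bullet> v}"])
  have "dir_deriv (\<lambda>x. x \<bullet> v) w = (\<lambda>x. w \<bullet> v)" for w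
    by (rule ext, rule dir_deriv_eqI) (auto intro!: derivative_eq_intros)
  then show "(\<forall>x. f differentiable at x) \<and> dir_deriv f w \<in> algebra_span {\<lambda>x. x \<bullet> v}"
    if "f \<in> {\<lambda>x. x \<bullet> v}" for f w
    using that by (auto intro: algebra_span.const)
qed (auto intro: algebra_span.base)

text \<open>The classical functions that are flat at the origin; the powers in the denominator make the family
  stable under differentiation.\<close>

definition flat :: "nat \<Rightarrow> real \<Rightarrow> real" where
  "flat k t = (if t > 0 then exp (- 1 / t) / t ^ k else 0)"

lemma flat_nonneg: "flat k t \<ge> 0"
  by (simp add: flat_def)

lemma flat_tendsto_0: "((\<lambda>t. flat k t) \<longlongrightarrow> 0) (at 0)"
proof (rule filterlim_split_at_real)
  have "((\<lambda>s::real. s ^ k / exp s) \<longlongrightarrow> 0) at_top"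
    by (rule tendsto_power_div_exp_0)
  then have "((\<lambda>t::real. inverse t ^ k / exp (inverse t)) \<longlongrightarrow> 0) (at_right 0)"
    by (rule filterlim_compose) (rule filterlim_inverse_at_top_right)
  then show "((\<lambda>t. flat k t) \<longlongrightarrow> 0) (at_right 0)"
    by (rule Lim_transform_eventually)
      (auto simp: eventually_at_filter flat_def field_simps exp_minus)
  show "((\<lambda>t. flat k t) \<longlongrightarrow> 0) (at_left 0)"
    by (rule Lim_transform_eventually[OF tendsto_const])
      (auto simp: eventually_at_filter flat_def)
qed

text \<open>The algebra generated by the flat functions is therefore stable under differentiation and consists
  of smooth functions. At the origin the exponential beats every power.\<close>

lemma DERIV_flat: "(flat k has_real_derivative (flat (k + 2) t - real k * flat (k + 1) t)) (at t)"
proof -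
  consider "t < 0" | "t > 0" | "t = 0" by linarith
  then show ?thesis
  proof cases
    case 1
    have "((\<lambda>_. 0) has_real_derivative 0) (at t)" by simp
    then have "(flat k has_real_derivative 0) (at t)"
      by (rule has_field_derivative_transform_within_open[where S = "{..<0}"])
        (use 1 in \<open>auto simp: flat_def\<close>)
    then show ?thesis using 1 by (simp add: flat_def)
  next
    case 2
    have "((\<lambda>s. exp (- 1 / s) / s ^ k) has_real_derivative
        (exp (- 1 / t) / t ^ (k + 2) - real k * (exp (- 1 / t) / t ^ (k + 1)))) (at t)"
      using 2 by (auto intro!: derivative_eq_intros simp: field_simps power2_eq_square)
        (cases k; simp add: field_simps power2_eq_square)
    then have "(flat k has_real_derivative
        (exp (- 1 / t) / t ^ (k + 2) - real k * (exp (- 1 / t) / t ^ (k + 1)))) (at t)"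
      by (rule has_field_derivative_transform_within_open[where S = "{0<..}"])
        (use 2 in \<open>auto simp: flat_def\<close>)
    then show ?thesis using 2 by (simp add: flat_def)
  next
    case 3
    have "((\<lambda>s. (flat k s - flat k 0) / (s - 0)) \<longlongrightarrow> 0) (at 0)"
      by (rule Lim_transform_eventually[OF flat_tendsto_0[of "k + 1"]])
        (auto simp: eventually_at_filter flat_def field_simps)
    then show ?thesis using 3 by (simp add: has_field_derivative_iff flat_def)
  qed
qed

lemma smooth_fun_flat: "smooth_fun (\<lambda>x. flat k (c + x \<bullet> v))"
proof (rule smooth_fun_algebra_span[where B = "range (\<lambda>k x. flat k (c + x \<bullet> v))"])
  let ?B = "range (\<lambda>k x. flat k (c + x \<bullet> v))"
  fix f w assume "f \<in> ?B"
  then obtain j where f: "f = (\<lambda>x. flat j (c + x \<bullet> v))" by auto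
  have D: "(f has_derivative
      (\<lambda>h. (h \<bullet> v) * (flat (j + 2) (c + x \<bullet> v) - real j * flat (j + 1) (c + x \<bullet> v)))) (at x)" for x
    unfolding f
    by (rule DERIV_flat[THEN DERIV_compose_FDERIV]) (auto intro!: derivative_eq_intros)
  have "dir_deriv f w = (\<lambda>x. (w \<bullet> v) * (flat (j + 2) (c + x \<bullet> v) + (- real j) * flat (j + 1) (c + x \<bullet> v)))"
    by (rule ext, subst dir_deriv_eqI[OF D]) simp
  also have "\<dots> \<in> algebra_span ?B"
    by (intro algebra_span.mult algebra_span.add algebra_span.const) (auto intro: algebra_span.base)
  finally show "(\<forall>x. f differentiable at x) \<and> dir_deriv f w \<in> algebra_span ?B"
    using D by (auto simp: differentiable_def)
qed (auto intro: algebra_span.base)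

text \<open>Functions of this form approximate indicators of boxes and, after normalisation, serve as a
  mollifier.\<close>

definition box_bump :: "real \<Rightarrow> 'a::euclidean_space \<Rightarrow> 'a \<Rightarrow> 'a \<Rightarrow> real" where
  "box_bump n a b x = (\<Prod>i\<in>Basis. flat 0 (n * ((x - a) \<bullet> i)) * flat 0 (n * ((b - x) \<bullet> i)))"

lemma smooth_fun_box_bump: "smooth_fun (box_bump n a b)"
proof -
  have "smooth_fun (\<lambda>x. \<Prod>i\<in>Basis. flat 0 (- n * (a \<bullet> i) + x \<bullet> (n *\<^sub>R i)) *
      flat 0 (n * (b \<bullet> i) + x \<bullet> (- n *\<^sub>R i)))"
    by (intro smooth_fun_prod smooth_fun_mult smooth_fun_flat)
  then show ?thesis
    unfolding box_bump_def by (simp add: algebra_simps inner_diff_left)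
qed

lemma flat_0_pos_iff: "flat 0 t > 0 \<longleftrightarrow> t > 0" "flat 0 t = 0 \<longleftrightarrow> t \<le> 0"
  by (auto simp: flat_def)

lemma flat_0_le_1: "flat 0 t \<le> 1"
  by (auto simp: flat_def)

lemma box_bump_nonneg: "box_bump n a b x \<ge> 0"
  by (simp add: box_bump_def flat_nonneg prod_nonneg)

lemma box_bump_le_1: "box_bump n a b x \<le> 1"
  unfolding box_bump_def
  by (intro prod_le_1 conjI mult_le_one mult_nonneg_nonneg flat_nonneg flat_0_le_1)

lemma box_bump_eq_0_iff: "n > 0 \<Longrightarrow> box_bump n a b x = 0 \<longleftrightarrow> x \<notin> box a b"
  by (auto simp: box_bump_def flat_0_pos_iff mem_box mult_le_0_iff inner_diff_left not_less)

lemma box_bump_tendsto: "(\<lambda>n. box_bump (real (Suc n)) a b x) \<longlonglongrightarrow> indicator (box a b) x"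
proof (cases "x \<in> box a b")
  case True
  have *: "(\<lambda>n. flat 0 (real (Suc n) * s)) \<longlonglongrightarrow> 1" if "s > 0" for s
  proof -
    have "(\<lambda>n. - 1 / s * inverse (real (Suc n))) \<longlonglongrightarrow> - 1 / s * 0"
      by (intro tendsto_intros LIMSEQ_inverse_real_of_nat)
    then have "(\<lambda>n. exp (- 1 / s * inverse (real (Suc n)))) \<longlonglongrightarrow> exp 0"
      by (intro tendsto_intros) simp
    moreover have "exp (- 1 / s * inverse (real (Suc n))) = flat 0 (real (Suc n) * s)" for n
    proof -
      have "real (Suc n) * s > 0" using that by simp
      then show ?thesis using that by (simp add: flat_def divide_inverse mult_ac del: of_nat_Suc)
    qed
    ultimately show ?thesis by simp
  qed
  have "(\<lambda>n. box_bump (real (Suc n)) a b x) \<longlonglongrightarrow> (\<Prod>i\<in>(Basis::'a set). 1 * 1)"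
    unfolding box_bump_def using True
    by (intro tendsto_prod tendsto_mult *) (auto simp: mem_box inner_diff_left)
  then show ?thesis using True by simp
next
  case False
  then show ?thesis using box_bump_eq_0_iff[of "real (Suc _)" a b x] by simp
qed

lemma test_functionsD:
  assumes "\<phi> \<in> test_functions S"
  shows "smooth_fun \<phi>" "compact (closure {x. \<phi> x \<noteq> 0})" "closure {x. \<phi> x \<noteq> 0} \<subseteq> S"
    "x \<notin> S \<Longrightarrow> \<phi> x = 0"
  using assms closure_subset[of "{x. \<phi> x \<noteq> 0}"] by (auto simp: test_functions_def)

lemma test_functionsI:
  assumes "smooth_fun \<phi>" "compact C" "C \<subseteq> S" "\<And>x. x \<notin> C \<Longrightarrow> \<phi> x = 0"
  shows "\<phi> \<in> test_functions S"
proof -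
  have "closure {x. \<phi> x \<noteq> 0} \<subseteq> C"
    using assms by (intro closure_minimal compact_imp_closed) auto
  moreover from this have "compact (closure {x. \<phi> x \<noteq> 0})"
    by (metis assms(2) closed_closure compact_Int_closed inf.absorb_iff2)
  ultimately show ?thesis using assms by (auto simp: test_functions_def)
qed

lemma test_functions_mono: "S \<subseteq> T \<Longrightarrow> test_functions S \<subseteq> test_functions T"
  by (auto simp: test_functions_def)

lemma test_functions_diff:
  assumes "\<phi> \<in> test_functions S" "\<eta> \<in> test_functions S"
  shows "(\<lambda>x. \<phi> x - \<eta> x) \<in> test_functions S"
proof (rule test_functionsI)
  let ?C = "closure {x. \<phi> x \<noteq> 0} \<union> closure {x. \<eta> x \<noteq> 0}"
  show "smooth_fun (\<lambda>x. \<phi> x - \<eta> x)"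
    using assms by (intro smooth_fun_diff test_functionsD)
  show "compact ?C" "?C \<subseteq> S"
    using assms by (auto intro!: compact_Un dest: test_functionsD)
  show "\<phi> x - \<eta> x = 0" if "x \<notin> ?C" for x
    using that closure_subset[of "{x. \<phi> x \<noteq> 0}"] closure_subset[of "{x. \<eta> x \<noteq> 0}"]
    by (metis (mono_tags, lifting) UnCI diff_zero mem_Collect_eq subsetD)
qed

section \<open>Weak gradients\<close>

definition grad :: "('a::euclidean_space \<Rightarrow> real) \<Rightarrow> 'a \<Rightarrow> 'a" where
  "grad f x = (\<Sum>b\<in>Basis. dir_deriv f b x *\<^sub>R b)"

lemma grad_inner_Basis: "b \<in> Basis \<Longrightarrow> grad f x \<bullet> b = dir_deriv f b x"
  by (simp add: grad_def inner_sum_left inner_Basis if_distrib cong: if_cong)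

lemma has_derivative_grad:
  assumes "f differentiable (at x)"
  shows "(f has_derivative (\<lambda>h. grad f x \<bullet> h)) (at x)"
proof -
  have D: "(f has_derivative frechet_derivative f (at x)) (at x)"
    using assms by (simp add: frechet_derivative_works)
  then have lin: "linear (frechet_derivative f (at x))"
    by (rule has_derivative_linear)
  have "frechet_derivative f (at x) h = grad f x \<bullet> h" for h
  proof -
    have "frechet_derivative f (at x) h = frechet_derivative f (at x) (\<Sum>b\<in>Basis. (h \<bullet> b) *\<^sub>R b)"
      by (simp add: euclidean_representation)
    also have "\<dots> = (\<Sum>b\<in>Basis. (h \<bullet> b) * frechet_derivative f (at x) b)"
      by (simp add: linear_sum[OF lin] linear_scale[OF lin])
    also have "\<dots> = grad f x \<bullet> h"
      by (simp add: grad_def inner_sum_left inner_sum_right inner_commute mult.commute)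
    finally show ?thesis .
  qed
  then have "frechet_derivative f (at x) = (\<lambda>h. grad f x \<bullet> h)" by (rule ext)
  with D show ?thesis by simp
qed

lemma grad_unique: "(f has_derivative (\<lambda>h. g \<bullet> h)) (at x) \<Longrightarrow> grad f x = g"
  by (rule euclidean_eqI) (simp add: grad_inner_Basis dir_deriv_eqI)

lemma smooth_fun_grad_inner: "smooth_fun f \<Longrightarrow> grad f x \<bullet> v = dir_deriv f v x"
  by (rule dir_deriv_eqI[OF has_derivative_grad, symmetric]) (rule smooth_fun_differentiable)

lemma continuous_on_grad: "smooth_fun f \<Longrightarrow> continuous_on A (grad f)"
  unfolding grad_def
  by (intro continuous_intros smooth_fun_continuous smooth_fun_dir_deriv)

lemma grad_diff: "smooth_fun f \<Longrightarrow> smooth_fun g \<Longrightarrow> grad (\<lambda>x. f x - g x) x = grad f x - grad g x"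
  by (rule grad_unique)
    (simp add: inner_diff_left has_derivative_diff has_derivative_grad smooth_fun_differentiable)

lemma dir_deriv_mult:
  assumes "f differentiable (at x)" "g differentiable (at x)"
  shows "dir_deriv (\<lambda>x. f x * g x) b x = f x * dir_deriv g b x + dir_deriv f b x * g x"
  by (rule dir_deriv_eqI, rule has_derivative_mult) (use assms in \<open>simp_all add: frechet_derivative_works\<close>)

lemma test_functions_dir_deriv:
  assumes "\<phi> \<in> test_functions S"
  shows "dir_deriv \<phi> b \<in> test_functions S"
proof (rule test_functionsI[OF _ test_functionsD(2,3)[OF assms]])
  show "smooth_fun (dir_deriv \<phi> b)"
    using assms by (intro smooth_fun_dir_deriv test_functionsD)
  fix x assume x: "x \<notin> closure {x. \<phi> x \<noteq> 0}"
  have "(\<phi> has_derivative (\<lambda>_. 0)) (at x)"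
    by (rule has_derivative_transform_within_open[OF has_derivative_const[of 0], of "- closure {x. \<phi> x \<noteq> 0}"])
      (use x closure_subset[of "{x. \<phi> x \<noteq> 0}"] in auto)
  then show "dir_deriv \<phi> b x = 0" by (simp add: dir_deriv_eqI)
qed

lemma grad_test_function_eq_0: "\<phi> \<in> test_functions S \<Longrightarrow> x \<notin> S \<Longrightarrow> grad \<phi> x = 0"
  by (simp add: grad_def test_functionsD(4)[OF test_functions_dir_deriv])

lemma open_in_lebesgue: "open S \<Longrightarrow> S \<in> sets lebesgue"
  by auto

lemma integral_lebesgue_on_eq:
  fixes f :: "'a::euclidean_space \<Rightarrow> 'b::euclidean_space"
  assumes "S \<in> sets lebesgue" "\<And>x. x \<notin> S \<Longrightarrow> f x = 0"
  shows "(LINT x|lebesgue_on S. f x) = (LINT x|lebesgue. f x)"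
proof -
  have "(\<lambda>x. if x \<in> S then f x else 0) = f" using assms(2) by auto
  then show ?thesis using Lebesgue_Measure.integral_restrict_UNIV[OF assms(1), of f] by simp
qed

lemma integrable_lebesgue_on_eq:
  fixes f :: "'a::euclidean_space \<Rightarrow> 'b::euclidean_space"
  assumes "S \<in> sets lebesgue" "\<And>x. x \<notin> S \<Longrightarrow> f x = 0"
  shows "integrable (lebesgue_on S) f \<longleftrightarrow> integrable lebesgue f"
proof -
  have "(\<lambda>x. if x \<in> S then f x else 0) = f" using assms(2) by auto
  then show ?thesis using Lebesgue_Measure.integrable_restrict_UNIV[OF assms(1), of f] by simp
qed

lemma AE_lebesgue_on_iff:
  "S \<in> sets lebesgue \<Longrightarrow> (AE x in lebesgue_on S. P x) \<longleftrightarrow> (AE x in lebesgue. x \<in> S \<longrightarrow> P x)"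
  by (simp add: AE_restrict_space_iff)

lemma AE_lebesgue_onI: "AE x in lebesgue. P x \<Longrightarrow> S \<in> sets lebesgue \<Longrightarrow> AE x in lebesgue_on S. P x"
  by (auto simp: AE_lebesgue_on_iff elim: eventually_mono)

lemma integrable_continuous_compact_support:
  fixes f :: "'a::euclidean_space \<Rightarrow> 'b::euclidean_space"
  assumes "continuous_on UNIV f" "compact C" "\<And>x. x \<notin> C \<Longrightarrow> f x = 0"
  shows "integrable lebesgue f"
proof -
  have "integrable lborel (\<lambda>x. indicator C x *\<^sub>R f x)"
    using assms by (intro borel_integrable_compact) (auto intro: continuous_on_subset)
  moreover have "(\<lambda>x. indicator C x *\<^sub>R f x) = f"
    using assms(3) by (auto simp: indicator_def)
  ultimately show ?thesis
    by (metis borel_measurable_integrable integrable_completion sets_lborel measurable_lborel1)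
qed

lemma integrable_test_function:
  assumes "\<phi> \<in> test_functions S" "continuous_on UNIV f"
  shows "integrable lebesgue (\<lambda>x. f x * \<phi> x)"
proof (rule integrable_continuous_compact_support[OF _ test_functionsD(2)[OF assms(1)]])
  show "continuous_on UNIV (\<lambda>x. f x * \<phi> x)"
    by (intro continuous_intros assms smooth_fun_continuous test_functionsD(1)[OF assms(1)])
  show "f x * \<phi> x = 0" if "x \<notin> closure {x. \<phi> x \<noteq> 0}" for x
    using that closure_subset[of "{x. \<phi> x \<noteq> 0}"] by auto
qed

lemma integral_lebesgue_eq_cbox:
  fixes f :: "'a::euclidean_space \<Rightarrow> real"
  assumes "continuous_on UNIV f" "\<And>x. x \<notin> cbox a b \<Longrightarrow> f x = 0"
  shows "(LINT x|lebesgue. f x) = integral (cbox a b) f"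
proof -
  have "integrable lebesgue f"
    by (rule integrable_continuous_compact_support[OF assms(1) compact_cbox assms(2)])
  then have "integrable (lebesgue_on (cbox a b)) f"
    using assms by (subst integrable_lebesgue_on_eq) auto
  then have "(LINT x|lebesgue_on (cbox a b). f x) = integral (cbox a b) f"
    by (rule lebesgue_integral_eq_integral) simp
  then show ?thesis using assms by (subst (asm) integral_lebesgue_on_eq) auto
qed

text \<open>The mean value theorem for the integrals over the translates of a box.\<close>

lemma cbox_integral_translate_diff:
  assumes \<phi>: "\<phi> \<in> test_functions S"
  obtains t where "0 < t" "t < 1" "integral (cbox (a + h) (b + h)) \<phi> - integral (cbox a b) \<phi> =
    integral (cbox (a + t *\<^sub>R h) (b + t *\<^sub>R h)) (dir_deriv \<phi> h)"
proof -
  note smooth = test_functionsD(1)[OF \<phi>]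
  have cont: "continuous_on A (\<lambda>z. f (c z *\<^sub>R h + d z))"
    if "smooth_fun f" "continuous_on A c" "continuous_on A d" for f c d and A :: "'b::topological_space set"
    by (rule continuous_on_compose2[OF smooth_fun_continuous[OF that(1), of UNIV]])
      (auto intro!: continuous_intros that)
  have der: "((\<lambda>t. \<phi> (t *\<^sub>R h + x)) has_field_derivative dir_deriv \<phi> h (t *\<^sub>R h + x)) (at t within T)" for t x T
  proof -
    have "((\<lambda>t. \<phi> (t *\<^sub>R h + x)) has_derivative (\<lambda>k. grad \<phi> (t *\<^sub>R h + x) \<bullet> (k *\<^sub>R h))) (at t within T)"
      by (rule has_derivative_compose[OF _ has_derivative_grad, where f = "\<lambda>t. t *\<^sub>R h + x"])
        (auto intro!: derivative_eq_intros smooth_fun_differentiable smooth)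
    then show ?thesis
      by (rule has_derivative_imp_has_field_derivative) (simp add: smooth_fun_grad_inner[OF smooth])
  qed
  have D: "((\<lambda>t. integral (cbox a b) (\<lambda>x. \<phi> (t *\<^sub>R h + x))) has_field_derivative
      integral (cbox a b) (\<lambda>x. dir_deriv \<phi> h (t *\<^sub>R h + x))) (at t within UNIV)" for t
  proof (rule leibniz_rule_field_derivative[OF der])
    show "(\<lambda>x. \<phi> (t *\<^sub>R h + x)) integrable_on cbox a b" for t
      by (intro integrable_continuous cont[OF smooth] continuous_intros)
    show "continuous_on (UNIV \<times> cbox a b) (\<lambda>(t, x). dir_deriv \<phi> h (t *\<^sub>R h + x))"
      unfolding case_prod_unfold
      by (intro cont[OF smooth_fun_dir_deriv[OF smooth]] continuous_intros)
  qed auto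
  obtain t where t: "0 < t" "t < 1" "integral (cbox a b) (\<lambda>x. \<phi> (1 *\<^sub>R h + x)) - integral (cbox a b) (\<lambda>x. \<phi> (0 *\<^sub>R h + x)) =
      (1 - 0) * integral (cbox a b) (\<lambda>x. dir_deriv \<phi> h (t *\<^sub>R h + x))"
    using MVT2[OF zero_less_one D] by blast
  have "integral (cbox (a + h) (b + h)) \<phi> - integral (cbox a b) \<phi> =
      integral (cbox (a + t *\<^sub>R h) (b + t *\<^sub>R h)) (dir_deriv \<phi> h)"
    using t(3) integral_shift_cbox_plus[of a b \<phi> h] integral_shift_cbox_plus[of a b "dir_deriv \<phi> h" "t *\<^sub>R h"]
    by (simp add: o_def)
  with t(1,2) show ?thesis by (rule that)
qed

text \<open>Applied to a box that stays around the support, this shows that the integral of a directional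
  derivative vanishes.\<close>

lemma integral_dir_deriv_test_function:
  assumes \<phi>: "\<phi> \<in> test_functions S"
  shows "(LINT x|lebesgue. dir_deriv \<phi> v x) = 0"
proof -
  let ?C = "closure {x. \<phi> x \<noteq> 0}"
  have \<phi>C: "\<phi> \<in> test_functions ?C"
    using \<phi> by (simp add: test_functions_def)
  obtain r where r: "r > 0" "?C \<subseteq> ball 0 r"
    using compact_imp_bounded[OF test_functionsD(2)[OF \<phi>]] bounded_subset_ballD by blast
  \<comment> \<open>the box contains the support even after a translation by a part of \<open>v\<close>\<close>
  define a where "a = (r + norm v) *\<^sub>R (One::'a)"
  have inside: "?C \<subseteq> cbox (- a + t *\<^sub>R v) (a + t *\<^sub>R v)" if "0 \<le> t" "t \<le> 1" for t
  proof
    fix x assume "x \<in> ?C"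
    then have x: "norm x \<le> r" using r(2) by auto
    have "\<bar>(x - t *\<^sub>R v) \<bullet> b\<bar> \<le> r + norm v" if "b \<in> Basis" for b
    proof -
      have "\<bar>(x - t *\<^sub>R v) \<bullet> b\<bar> \<le> norm (x - t *\<^sub>R v)" by (rule Basis_le_norm[OF that])
      also have "\<dots> \<le> norm x + t * norm v"
        using norm_triangle_ineq4[of x "t *\<^sub>R v"] \<open>0 \<le> t\<close> by simp
      also have "\<dots> \<le> r + norm v"
        using x \<open>0 \<le> t\<close> \<open>t \<le> 1\<close> by (intro add_mono mult_left_le_one_le) auto
      finally show ?thesis .
    qed
    then show "x \<in> cbox (- a + t *\<^sub>R v) (a + t *\<^sub>R v)"
      by (force simp: mem_box a_def inner_diff_left inner_add_left abs_le_iff)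
  qed
  have all: "(LINT x|lebesgue. f x) = integral (cbox (- a + t *\<^sub>R v) (a + t *\<^sub>R v)) f"
    if "f \<in> test_functions ?C" "0 \<le> t" "t \<le> 1" for f t
    using inside[OF that(2,3)] test_functionsD(4)[OF that(1)]
    by (intro integral_lebesgue_eq_cbox smooth_fun_continuous test_functionsD(1)[OF that(1)]) auto
  obtain t where t: "0 < t" "t < 1" "integral (cbox (- a + v) (a + v)) \<phi> - integral (cbox (- a) a) \<phi> =
      integral (cbox (- a + t *\<^sub>R v) (a + t *\<^sub>R v)) (dir_deriv \<phi> v)"
    by (rule cbox_integral_translate_diff[OF \<phi>])
  show ?thesis
    using all[OF test_functions_dir_deriv[OF \<phi>C], of t v] t all[OF \<phi>C, of 0] all[OF \<phi>C, of 1] by simp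
qed

lemma test_functions_mult:
  assumes "\<phi> \<in> test_functions S" "smooth_fun f"
  shows "(\<lambda>x. f x * \<phi> x) \<in> test_functions S"
proof (rule test_functionsI[OF _ test_functionsD(2,3)[OF assms(1)]])
  show "smooth_fun (\<lambda>x. f x * \<phi> x)"
    by (rule smooth_fun_mult[OF assms(2) test_functionsD(1)[OF assms(1)]])
  show "f x * \<phi> x = 0" if "x \<notin> closure {x. \<phi> x \<noteq> 0}" for x
    using that closure_subset[of "{x. \<phi> x \<noteq> 0}"] by auto
qed

lemma integration_by_parts:
  assumes \<phi>: "\<phi> \<in> test_functions S" and f: "smooth_fun f"
  shows "(LINT x|lebesgue. f x * dir_deriv \<phi> v x) = - (LINT x|lebesgue. dir_deriv f v x * \<phi> x)"
proof -
  have "0 = (LINT x|lebesgue. dir_deriv (\<lambda>x. f x * \<phi> x) v x)"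
    using integral_dir_deriv_test_function[OF test_functions_mult[OF \<phi> f]] by simp
  also have "\<dots> = (LINT x|lebesgue. f x * dir_deriv \<phi> v x + dir_deriv f v x * \<phi> x)"
    using smooth_fun_differentiable[OF f] smooth_fun_differentiable[OF test_functionsD(1)[OF \<phi>]]
    by (simp add: dir_deriv_mult)
  also have "\<dots> = (LINT x|lebesgue. f x * dir_deriv \<phi> v x) + (LINT x|lebesgue. dir_deriv f v x * \<phi> x)"
    using f by (intro Bochner_Integration.integral_add integrable_test_function[OF \<phi>]
        integrable_test_function[OF test_functions_dir_deriv[OF \<phi>]]
        smooth_fun_continuous smooth_fun_dir_deriv)
  finally show ?thesis by simp
qed

lemma L2D:
  assumes "f \<in> L2 S"
  shows "f \<in> borel_measurable (lebesgue_on S)" "integrable (lebesgue_on S) (\<lambda>x. (norm (f x))\<^sup>2)"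
  using assms by (auto simp: L2_def)

lemma L2_subset:
  fixes f :: "'a::euclidean_space \<Rightarrow> 'b::euclidean_space"
  assumes "f \<in> L2 T" "S \<subseteq> T" "S \<in> sets lebesgue" "T \<in> sets lebesgue"
  shows "f \<in> L2 S"
proof -
  have "f \<in> borel_measurable (lebesgue_on S)"
    using measurable_restrict_mono[OF L2D(1)[OF assms(1)] assms(2)] .
  moreover have "set_integrable lebesgue T (\<lambda>x. (norm (f x))\<^sup>2)"
    using L2D(2)[OF assms(1)] assms(4) by (simp add: set_integrable_def integrable_restrict_space)
  then have "set_integrable lebesgue S (\<lambda>x. (norm (f x))\<^sup>2)"
    by (rule set_integrable_subset) (use assms in auto)
  then have "integrable (lebesgue_on S) (\<lambda>x. (norm (f x))\<^sup>2)"
    using assms(3) by (simp add: set_integrable_def integrable_restrict_space)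
  ultimately show ?thesis by (simp add: L2_def)
qed

lemma L2_inner_integrable:
  fixes f g :: "'a::euclidean_space \<Rightarrow> 'b::euclidean_space"
  assumes "f \<in> L2 S" "g \<in> L2 S"
  shows "integrable (lebesgue_on S) (\<lambda>x. f x \<bullet> g x)"
proof (rule Bochner_Integration.integrable_bound)
  show "integrable (lebesgue_on S) (\<lambda>x. (norm (f x))\<^sup>2 + (norm (g x))\<^sup>2)"
    using assms by (intro Bochner_Integration.integrable_add L2D)
  show "(\<lambda>x. f x \<bullet> g x) \<in> borel_measurable (lebesgue_on S)"
    using assms by (intro borel_measurable_inner L2D)
  have "\<bar>f x \<bullet> g x\<bar> \<le> (norm (f x))\<^sup>2 + (norm (g x))\<^sup>2" for x
  proof -
    have "\<bar>f x \<bullet> g x\<bar> \<le> norm (f x) * norm (g x)" by (rule Cauchy_Schwarz_ineq2)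
    also have "\<dots> \<le> (norm (f x))\<^sup>2 + (norm (g x))\<^sup>2"
    proof -
      have "0 \<le> norm (f x) * norm (g x)" by simp
      then show ?thesis
        using sum_squares_bound[of "norm (f x)" "norm (g x)"] unfolding mult.assoc by linarith
    qed
    finally show ?thesis .
  qed
  then show "AE x in lebesgue_on S. norm (f x \<bullet> g x) \<le> norm ((norm (f x))\<^sup>2 + (norm (g x))\<^sup>2)"
    by (simp add: sum_power2_ge_zero abs_of_nonneg)
qed

lemma L2_mult_integrable:
  fixes f g :: "'a::euclidean_space \<Rightarrow> real"
  shows "f \<in> L2 S \<Longrightarrow> g \<in> L2 S \<Longrightarrow> integrable (lebesgue_on S) (\<lambda>x. f x * g x)"
  using L2_inner_integrable[of f S g] by simp

lemma L2_diff:
  fixes f g :: "'a::euclidean_space \<Rightarrow> 'b::euclidean_space"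
  assumes "f \<in> L2 S" "g \<in> L2 S"
  shows "(\<lambda>x. f x - g x) \<in> L2 S"
proof -
  have "integrable (lebesgue_on S) (\<lambda>x. (norm (f x))\<^sup>2 + (norm (g x))\<^sup>2 - 2 * (f x \<bullet> g x))"
    using assms by (intro Bochner_Integration.integrable_add Bochner_Integration.integrable_diff
        Bochner_Integration.integrable_mult_right L2_inner_integrable L2D)
  moreover have "(norm (f x - g x))\<^sup>2 = (norm (f x))\<^sup>2 + (norm (g x))\<^sup>2 - 2 * (f x \<bullet> g x)" for x
    by (simp add: power2_norm_eq_inner inner_diff_left inner_diff_right inner_commute)
  moreover have "(\<lambda>x. f x - g x) \<in> borel_measurable (lebesgue_on S)"
    using assms by (intro borel_measurable_diff L2D)
  ultimately show ?thesis by (simp add: L2_def)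
qed

lemma L2_component: "b \<in> Basis \<Longrightarrow> g \<in> L2 S \<Longrightarrow> (\<lambda>x. g x \<bullet> b) \<in> L2 S"
proof -
  assume b: "b \<in> Basis" and g: "g \<in> L2 S"
  have m: "(\<lambda>x. g x \<bullet> b) \<in> borel_measurable (lebesgue_on S)"
    using L2D(1)[OF g] by simp
  have "integrable (lebesgue_on S) (\<lambda>x. (norm (g x \<bullet> b))\<^sup>2)"
  proof (rule Bochner_Integration.integrable_bound[OF L2D(2)[OF g]])
    have "(norm (g x \<bullet> b))\<^sup>2 \<le> (norm (g x))\<^sup>2" for x
      using Basis_le_norm[OF b, of "g x"] by (intro power_mono) auto
    then show "AE x in lebesgue_on S. norm ((norm (g x \<bullet> b))\<^sup>2) \<le> norm ((norm (g x))\<^sup>2)"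
      by simp
  qed (use m in measurable)
  then show ?thesis using m by (simp add: L2_def)
qed

lemma finite_measure_bounded: "bounded S \<Longrightarrow> open S \<Longrightarrow> finite_measure (lebesgue_on S)"
  by (rule finite_measure_lebesgue_on) (rule lmeasurable_open)

lemma L2_bounded:
  fixes f :: "'a::euclidean_space \<Rightarrow> 'b::euclidean_space"
  assumes "bounded S" "open S" and meas: "f \<in> borel_measurable (lebesgue_on S)"
    and bound: "AE x in lebesgue_on S. norm (f x) \<le> M"
  shows "f \<in> L2 S"
proof -
  interpret finite_measure "lebesgue_on S" by (rule finite_measure_bounded) fact+
  have "integrable (lebesgue_on S) (\<lambda>x. (norm (f x))\<^sup>2)"
  proof (rule integrable_const_bound)
    show "AE x in lebesgue_on S. norm ((norm (f x))\<^sup>2) \<le> M\<^sup>2"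
      using bound by eventually_elim (simp add: power_mono)
  qed (use meas in measurable)
  then show ?thesis using meas by (simp add: L2_def)
qed

lemma L2_continuous:
  fixes f :: "'a::euclidean_space \<Rightarrow> 'b::euclidean_space"
  assumes "bounded S" "open S" "continuous_on UNIV f"
  shows "f \<in> L2 S"
proof -
  have "compact (f ` closure S)"
    using assms by (intro compact_continuous_image) (auto intro: continuous_on_subset)
  then obtain M where "\<forall>x\<in>closure S. norm (f x) \<le> M"
    using compact_imp_bounded bounded_iff by (metis imageI)
  moreover have "f \<in> borel_measurable (lebesgue_on S)"
    using assms by (intro continuous_imp_measurable_on_sets_lebesgue) (auto intro: continuous_on_subset)
  ultimately show ?thesis
    using closure_subset[of S] by (intro L2_bounded[OF assms(1,2), of f M]) (auto intro!: AE_I2)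
qed

lemma L2_cong_AE:
  fixes f g :: "'a::euclidean_space \<Rightarrow> 'b::euclidean_space"
  assumes "f \<in> L2 S" "g \<in> borel_measurable (lebesgue_on S)" "AE x in lebesgue_on S. f x = g x"
  shows "g \<in> L2 S"
proof -
  note [measurable] = L2D(1)[OF assms(1)] assms(2)
  have "integrable (lebesgue_on S) (\<lambda>x. (norm (g x))\<^sup>2) \<longleftrightarrow> integrable (lebesgue_on S) (\<lambda>x. (norm (f x))\<^sup>2)"
    by (rule integrable_cong_AE) (use assms(3) in auto)
  then show ?thesis using assms by (simp add: L2_def)
qed

lemma L2_test_function:
  assumes "\<phi> \<in> test_functions S" "open S"
  shows "\<phi> \<in> L2 S"
proof -
  have "(\<lambda>x. \<phi> x * \<phi> x) \<in> borel_measurable (lebesgue_on S)"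
    "\<phi> \<in> borel_measurable (lebesgue_on S)"
    using assms(2) by (intro continuous_imp_measurable_on_sets_lebesgue continuous_intros
        smooth_fun_continuous[OF test_functionsD(1)[OF assms(1)]] open_in_lebesgue; assumption)+
  moreover have "integrable (lebesgue_on S) (\<lambda>x. \<phi> x * \<phi> x)"
    using integrable_test_function[OF assms(1) smooth_fun_continuous[OF test_functionsD(1)[OF assms(1)]]]
    by (subst integrable_lebesgue_on_eq)
      (simp_all add: test_functionsD(4)[OF assms(1)] open_in_lebesgue[OF assms(2)])
  ultimately show ?thesis by (simp add: L2_def power2_eq_square)
qed

lemma L2_grad_test_function:
  assumes "\<phi> \<in> test_functions S" "open S"
  shows "grad \<phi> \<in> L2 S"
proof -
  have "continuous_on UNIV (grad \<phi>)" by (rule continuous_on_grad[OF test_functionsD(1)[OF assms(1)]])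
  then have "grad \<phi> \<in> borel_measurable (lebesgue_on S)"
    using assms by (intro continuous_imp_measurable_on_sets_lebesgue) (auto intro: continuous_on_subset)
  moreover have "(norm (grad \<phi> x))\<^sup>2 = (\<Sum>b\<in>Basis. dir_deriv \<phi> b x * dir_deriv \<phi> b x)" for x
    unfolding power2_norm_eq_inner
    by (subst euclidean_inner) (simp add: grad_inner_Basis)
  moreover have "integrable (lebesgue_on S) (\<lambda>x. dir_deriv \<phi> b x * dir_deriv \<phi> b x)" for b
    using L2_test_function[OF test_functions_dir_deriv[OF assms(1)] assms(2)] 
    by (intro L2_mult_integrable)
  ultimately show ?thesis by (simp add: L2_def)
qed

lemma sigma_finite_lebesgue: "sigma_finite_measure lebesgue"
proof
  obtain A :: "'a set set" where "countable A" "A \<subseteq> sets lborel" "\<Union>A = space lborel"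
    "\<forall>a\<in>A. emeasure lborel a \<noteq> \<infinity>"
    using lborel.sigma_finite_countable by blast
  then show "\<exists>A::'a set set. countable A \<and> A \<subseteq> sets lebesgue \<and> \<Union>A = space lebesgue \<and>
      (\<forall>a\<in>A. emeasure lebesgue a \<noteq> \<infinity>)"
    by (intro exI[of _ A]) (auto intro: sets_completionI_sets simp: emeasure_completion subset_iff)
qed

text \<open>Test functions separate square integrable functions: smooth bumps increase to indicators of
  boxes, so a function orthogonal to all of them has mean zero over every box, and hence over every
  measurable set, near each point.\<close>

lemma AE_zero_if_orthogonal_to_test_functions:
  assumes S: "open S" and f: "f \<in> L2 S"
    and orth: "\<And>\<phi>. \<phi> \<in> test_functions S \<Longrightarrow> (LINT x|lebesgue_on S. f x * \<phi> x) = 0"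
  shows "AE x in lebesgue_on S. f x = 0"
proof -
  let ?g = "\<lambda>x. indicator S x * f x :: real"
  have gm: "?g \<in> borel_measurable lebesgue"
    using L2D(1)[OF f] S by (simp add: borel_measurable_restrict_space_iff)
  have g2: "integrable lebesgue (\<lambda>x. (?g x)\<^sup>2)"
  proof -
    have "integrable lebesgue (\<lambda>x. indicator S x *\<^sub>R (f x)\<^sup>2)"
      using L2D(2)[OF f] S by (subst (asm) integrable_restrict_space) auto
    moreover have "indicator S x *\<^sub>R (f x)\<^sup>2 = (?g x)\<^sup>2" for x
      by (simp add: indicator_def)
    ultimately show ?thesis by simp
  qed
  have gi: "integrable lebesgue (\<lambda>x. indicator A x * ?g x)"
    if A: "A \<in> sets lebesgue" "A \<subseteq> cbox a b" for A a b
  proof (rule Bochner_Integration.integrable_bound)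
    show "integrable lebesgue (\<lambda>x. indicator (cbox a b) x + (?g x)\<^sup>2)"
      using g2 lmeasurable_cbox[of a b]
      by (intro Bochner_Integration.integrable_add) (auto simp: lmeasurable_iff_integrable)
    show "(\<lambda>x. indicator A x * ?g x) \<in> borel_measurable lebesgue"
      using A(1) by (intro borel_measurable_times borel_measurable_indicator gm)
    have "\<bar>t\<bar> \<le> 1 + t\<^sup>2" for t :: real
      using sum_squares_bound[of 1 "\<bar>t\<bar>"] by simp
    then show "AE x in lebesgue. norm (indicator A x * ?g x) \<le> norm (indicator (cbox a b) x + (?g x)\<^sup>2)"
      using A by (intro AE_I2) (auto simp: indicator_def)
  qed
  have box0: "(LINT x|lebesgue. indicator (box c d) x * ?g x) = 0" if cd: "cbox c d \<subseteq> S" for c d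
  proof -
    have lim: "(\<lambda>n. LINT x|lebesgue. box_bump (real (Suc n)) c d x * ?g x)
        \<longlonglongrightarrow> (LINT x|lebesgue. indicator (box c d) x * ?g x)"
    proof (rule integral_dominated_convergence)
      show "integrable lebesgue (\<lambda>x. norm (indicator (cbox c d) x * ?g x))"
        using gi[of "cbox c d" c d] by (intro integrable_norm) auto
      show "(\<lambda>x. indicator (box c d) x * ?g x) \<in> borel_measurable lebesgue"
        by (intro borel_measurable_times borel_measurable_indicator gm) auto
      have bm: "box_bump (real (Suc n)) c d \<in> borel_measurable lebesgue" for n
        by (intro measurable_completion)
          (simp add: borel_measurable_continuous_onI smooth_fun_continuous smooth_fun_box_bump)
      show "(\<lambda>x. box_bump (real (Suc n)) c d x * ?g x) \<in> borel_measurable lebesgue" for n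
        by (intro borel_measurable_times gm bm)
      show "AE x in lebesgue. (\<lambda>n. box_bump (real (Suc n)) c d x * ?g x) \<longlonglongrightarrow> indicator (box c d) x * ?g x"
        by (intro AE_I2 tendsto_mult box_bump_tendsto tendsto_const)
      have "norm (box_bump (real (Suc n)) c d x * ?g x) \<le> norm (indicator (cbox c d) x * ?g x)" for n x
      proof (cases "x \<in> box c d")
        case True
        then have "indicator (cbox c d) x = (1::real)"
          using box_subset_cbox[of c d] by auto
        then show ?thesis
          using mult_left_le_one_le[of "\<bar>?g x\<bar>" "box_bump (real (Suc n)) c d x"]
          by (simp add: abs_mult box_bump_nonneg box_bump_le_1 del: of_nat_Suc)
      next
        case False
        then show ?thesis using box_bump_eq_0_iff[of "real (Suc n)" c d x] by simp
      qed
      then show "AE x in lebesgue. norm (box_bump (real (Suc n)) c d x * ?g x) \<le> norm (indicator (cbox c d) x * ?g x)" for n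
        by simp
    qed
    have "(LINT x|lebesgue. box_bump (real (Suc n)) c d x * ?g x) = 0" for n
    proof -
      have bump: "box_bump (real (Suc n)) c d \<in> test_functions S"
        by (rule test_functionsI[OF smooth_fun_box_bump compact_cbox cd])
          (use box_bump_eq_0_iff[of "real (Suc n)" c d] box_subset_cbox[of c d] in auto)
      have "(LINT x|lebesgue. box_bump (real (Suc n)) c d x * ?g x) =
          (LINT x|lebesgue_on S. box_bump (real (Suc n)) c d x * ?g x)"
        using S by (subst integral_lebesgue_on_eq) (auto simp: indicator_def)
      also have "\<dots> = (LINT x|lebesgue_on S. f x * box_bump (real (Suc n)) c d x)"
        by (rule Bochner_Integration.integral_cong) auto
      finally show ?thesis using orth[OF bump] by simp
    qed
    with lim show ?thesis by (simp add: LIMSEQ_const_iff)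
  qed
  have zero: "AE x in lebesgue. x \<in> box a b \<longrightarrow> ?g x = 0" if ab: "cbox a b \<subseteq> S" for a b
  proof -
    let ?h = "\<lambda>x. indicator (box a b) x * ?g x"
    have hi: "integrable lebesgue ?h" using box_subset_cbox[of a b] by (intro gi[of _ a b]) auto
    have hiA: "integrable lebesgue (\<lambda>x. indicator A x * ?h x)" if "A \<in> sets lebesgue" for A
      using integrable_mult_indicator[OF that hi] by simp
    have borel: "(LINT x|lebesgue. indicator A x * ?h x) = 0" if "A \<in> sets borel" for A
    proof -
      have "Int_stable (range (\<lambda>(a, b). box a b :: 'a set))"
        by (auto simp: Int_stable_def box_Int_box)
      moreover have "range (\<lambda>(a, b). box a b :: 'a set) \<subseteq> Pow UNIV" by simp
      moreover have "A \<in> sigma_sets UNIV (range (\<lambda>(a, b). box a b :: 'a set))"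
        using that by (subst (asm) borel_eq_box) simp
      ultimately show ?thesis
      proof (induction rule: sigma_sets_induct_disjoint)
        case (basic A)
        then obtain c d where A: "A = box c d" by auto
        obtain c' d' where int: "box c d \<inter> box a b = box c' d'" using box_Int_box[of c d a b] by blast
        show ?case
        proof (cases "box c' d' = {}")
          case True
          have "indicator A x * ?h x = 0" for x
            using int True unfolding A by (auto simp: indicator_def)
          then show ?thesis by (simp only: Bochner_Integration.integral_zero)
        next
          case False
          have eq: "indicator A x * ?h x = indicator (box c' d') x * ?g x" for x
            unfolding int[symmetric] A by (simp add: indicator_inter_arith)
          have "cbox c' d' \<subseteq> S"
            using False int ab closure_mono[of "box c' d'" "box a b"]
            by (metis closure_box box_eq_empty(1) inf_le2 order_trans closure_empty empty_subsetI)
          then show ?thesis unfolding eq by (rule box0)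
        qed
      next
        case empty then show ?case by simp
      next
        case (compl A)
        then have [simp]: "A \<in> sets borel" by (subst borel_eq_box) simp
        have "(LINT x|lebesgue. indicator (UNIV - A) x * ?h x) =
            (LINT x|lebesgue. indicator UNIV x * ?h x - indicator A x * ?h x)"
          by (rule Bochner_Integration.integral_cong) (auto simp: indicator_def)
        also have "\<dots> = (LINT x|lebesgue. indicator UNIV x * ?h x) - (LINT x|lebesgue. indicator A x * ?h x)"
          by (intro Bochner_Integration.integral_diff hiA) auto
        finally show ?case using compl box0[OF ab] by simp
      next
        case (union A)
        then have [simp]: "A i \<in> sets lebesgue" for i
          by (intro sets_completionI_sets) (subst sets_lborel, subst borel_eq_box, auto)
        have "set_lebesgue_integral lebesgue (\<Union>i. A i) ?h = (\<Sum>i. set_lebesgue_integral lebesgue (A i) ?h)"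
        proof (rule lebesgue_integral_countable_add)
          show "set_integrable lebesgue (\<Union>i. A i) ?h"
            unfolding set_integrable_def real_scaleR_def by (rule hiA[OF sets.countable_UN]) auto
          show "A i \<inter> A j = {}" if "i \<noteq> j" for i j
            using union(1) that by (auto simp: disjoint_family_on_def)
        qed simp
        then show ?case using union(3) by (simp add: set_lebesgue_integral_def)
      qed
    qed
    have "AE x in lebesgue. ?h x = 0"
    proof (rule sigma_finite_measure.density_zero[OF sigma_finite_lebesgue hi])
      fix A :: "'a set" assume A: "A \<in> sets lebesgue"
      then obtain B N N' where B: "A = B \<union> N" "N \<subseteq> N'" "N' \<in> null_sets lborel" "B \<in> sets lborel"
        by (rule sets_completionE)
      have "(LINT x|lebesgue. indicator A x * ?h x) = (LINT x|lebesgue. indicator B x * ?h x)"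
      proof (rule integral_cong_AE)
        have "N' \<in> null_sets lebesgue" using B by (simp add: null_sets_completionI)
        then have "AE x in lebesgue. x \<notin> N'" by (rule AE_not_in)
        then show "AE x in lebesgue. indicator A x * ?h x = indicator B x * ?h x"
          by eventually_elim (use B in \<open>auto simp: indicator_def\<close>)
      qed (use A B hiA[of A] hiA[of B] in auto)
      then show "set_lebesgue_integral lebesgue A ?h = 0"
        using borel[of B] B by (simp add: set_lebesgue_integral_def)
    qed
    then show ?thesis by eventually_elim auto
  qed
  have "AE x in lebesgue. x \<in> S \<longrightarrow> ?g x = 0"
  proof -

    obtain \<D> where \<D>: "countable \<D>" "\<D> \<subseteq> {box a b |a b. cbox a b \<subseteq> S}" "\<Union>\<D> = S"
    proof -
      let ?\<B> = "{box a b |a b. cbox a b \<subseteq> S}"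
      have "\<Union>?\<B> = S"
      proof safe
        fix x assume "x \<in> S"
        then obtain a b where "x \<in> box a b" "cbox a b \<subseteq> S"
          using S by (metis open_contains_cbox)
        then show "x \<in> \<Union>?\<B>" by blast
      qed (use box_subset_cbox in blast)
      moreover have "\<And>Q. Q \<in> ?\<B> \<Longrightarrow> open Q" using open_box by blast
      then obtain \<D> where "\<D> \<subseteq> ?\<B>" "countable \<D>" "\<Union>\<D> = \<Union>?\<B>"
        by (rule Lindelof)
      ultimately show ?thesis by (intro that[of \<D>]) simp_all
    qed
    have "AE x in lebesgue. \<forall>Q\<in>\<D>. x \<in> Q \<longrightarrow> ?g x = 0"
    proof (subst AE_ball_countable[OF \<D>(1)], rule ballI)
      fix Q assume "Q \<in> \<D>"
      then obtain a b where "Q = box a b" "cbox a b \<subseteq> S" using \<D>(2) by blast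
      then show "AE x in lebesgue. x \<in> Q \<longrightarrow> ?g x = 0" using zero by simp
    qed
    then show ?thesis by (rule eventually_mono) (use \<D>(3) in blast)
  qed
  then show ?thesis
    using S by (simp add: AE_lebesgue_on_iff)
qed

lemma weak_gradientD:
  assumes "has_weak_gradient S u g"
  shows "u \<in> L2 S" "g \<in> L2 S"
    "\<phi> \<in> test_functions S \<Longrightarrow> b \<in> Basis \<Longrightarrow>
      (LINT x|lebesgue_on S. u x * dir_deriv \<phi> b x) = - (LINT x|lebesgue_on S. (g x \<bullet> b) * \<phi> x)"
  using assms by (auto simp: has_weak_gradient_def)

lemma weak_gradient_unique:
  assumes S: "open S" and g: "has_weak_gradient S u g" and h: "has_weak_gradient S u h"
  shows "AE x in lebesgue_on S. g x = h x"
proof -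
  have "AE x in lebesgue_on S. g x \<bullet> b - h x \<bullet> b = 0" if b: "b \<in> Basis" for b
  proof (rule AE_zero_if_orthogonal_to_test_functions[OF S])
    have L: "(\<lambda>x. g x \<bullet> b) \<in> L2 S" "(\<lambda>x. h x \<bullet> b) \<in> L2 S"
      by (rule L2_component[OF b weak_gradientD(2)[OF g]] L2_component[OF b weak_gradientD(2)[OF h]])+
    then show "(\<lambda>x. g x \<bullet> b - h x \<bullet> b) \<in> L2 S" by (rule L2_diff)
    fix \<phi> assume \<phi>: "\<phi> \<in> test_functions S"
    have "(LINT x|lebesgue_on S. (g x \<bullet> b - h x \<bullet> b) * \<phi> x) =
        (LINT x|lebesgue_on S. (g x \<bullet> b) * \<phi> x) - (LINT x|lebesgue_on S. (h x \<bullet> b) * \<phi> x)"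
      unfolding left_diff_distrib
      by (intro Bochner_Integration.integral_diff L2_mult_integrable L L2_test_function[OF \<phi> S])
    then show "(LINT x|lebesgue_on S. (g x \<bullet> b - h x \<bullet> b) * \<phi> x) = 0"
      using weak_gradientD(3)[OF g \<phi> b] weak_gradientD(3)[OF h \<phi> b] by simp
  qed
  then have "AE x in lebesgue_on S. \<forall>b\<in>Basis. g x \<bullet> b - h x \<bullet> b = 0"
    by (subst AE_ball_countable[OF countable_finite[OF finite_Basis]]) blast
  then show ?thesis by (rule eventually_mono) (auto intro: euclidean_eqI)
qed

lemma has_weak_gradient_weak_gradient: "u \<in> H1 S \<Longrightarrow> has_weak_gradient S u (weak_gradient S u)"
  unfolding H1_def weak_gradient_def by (auto intro: someI[of "has_weak_gradient S u"])

lemma weak_gradient_AE_eq: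
  "open S \<Longrightarrow> has_weak_gradient S u g \<Longrightarrow> AE x in lebesgue_on S. weak_gradient S u x = g x"
  by (rule weak_gradient_unique, assumption, rule has_weak_gradient_weak_gradient)
    (auto simp: H1_def)

lemma L2_cong:
  fixes f g :: "'a::euclidean_space \<Rightarrow> 'b::euclidean_space"
  assumes "\<And>x. x \<in> S \<Longrightarrow> f x = g x"
  shows "f \<in> L2 S \<longleftrightarrow> g \<in> L2 S"
proof -
  have "f \<in> borel_measurable (lebesgue_on S) \<longleftrightarrow> g \<in> borel_measurable (lebesgue_on S)"
    using assms by (intro measurable_cong) simp
  moreover have "integrable (lebesgue_on S) (\<lambda>x. (norm (f x))\<^sup>2) \<longleftrightarrow>
      integrable (lebesgue_on S) (\<lambda>x. (norm (g x))\<^sup>2)"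
    using assms by (intro Bochner_Integration.integrable_cong) auto
  ultimately show ?thesis by (simp add: L2_def)
qed

lemma has_weak_gradient_cong:
  assumes "\<And>x. x \<in> S \<Longrightarrow> u x = v x"
  shows "has_weak_gradient S u = has_weak_gradient S v"
proof -
  have "(LINT x|lebesgue_on S. u x * d x) = (LINT x|lebesgue_on S. v x * d x)" for d
    using assms by (intro Bochner_Integration.integral_cong) auto
  then show ?thesis
    using L2_cong[of S u v, OF assms] by (auto simp: has_weak_gradient_def fun_eq_iff)
qed

text \<open>An equation between functions, not just almost everywhere: both choices are made from the same
  predicate.\<close>

lemma weak_gradient_cong: "(\<And>x. x \<in> S \<Longrightarrow> u x = v x) \<Longrightarrow> weak_gradient S u = weak_gradient S v"
  unfolding weak_gradient_def using has_weak_gradient_cong[of S u v] by simp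

lemma has_weak_gradient_cong_AE:
  assumes S: "open S" and ug: "has_weak_gradient S u g"
    and v: "v \<in> borel_measurable (lebesgue_on S)" "AE x in lebesgue_on S. u x = v x"
    and h: "h \<in> borel_measurable (lebesgue_on S)" "AE x in lebesgue_on S. g x = h x"
  shows "has_weak_gradient S v h"
  unfolding has_weak_gradient_def
proof (intro conjI ballI)
  show "v \<in> L2 S" "h \<in> L2 S"
    using L2_cong_AE[OF weak_gradientD(1)[OF ug] v] L2_cong_AE[OF weak_gradientD(2)[OF ug] h] by auto
  fix \<phi> and b :: 'a assume \<phi>: "\<phi> \<in> test_functions S" and b: "b \<in> Basis"
  note L2D(1)[OF weak_gradientD(1)[OF ug], measurable] L2D(1)[OF weak_gradientD(2)[OF ug], measurable]
    v(1)[measurable] h(1)[measurable] L2D(1)[OF L2_test_function[OF \<phi> S], measurable]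
    L2D(1)[OF L2_test_function[OF test_functions_dir_deriv[OF \<phi>] S], measurable]
  have "(LINT x|lebesgue_on S. v x * dir_deriv \<phi> b x) = (LINT x|lebesgue_on S. u x * dir_deriv \<phi> b x)"
    by (rule integral_cong_AE) (use v(2) in auto)
  moreover have "(LINT x|lebesgue_on S. (h x \<bullet> b) * \<phi> x) = (LINT x|lebesgue_on S. (g x \<bullet> b) * \<phi> x)"
    by (rule integral_cong_AE) (use h(2) in auto)
  ultimately show "(LINT x|lebesgue_on S. v x * dir_deriv \<phi> b x) = - (LINT x|lebesgue_on S. (h x \<bullet> b) * \<phi> x)"
    using weak_gradientD(3)[OF ug \<phi> b] by simp
qed

lemma has_weak_gradient_diff:
  assumes S: "open S" and u: "has_weak_gradient S u g" and v: "has_weak_gradient S v h"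
  shows "has_weak_gradient S (\<lambda>x. u x - v x) (\<lambda>x. g x - h x)"
  unfolding has_weak_gradient_def
proof (intro conjI ballI)
  note L = weak_gradientD(1,2)[OF u] weak_gradientD(1,2)[OF v]
  show "(\<lambda>x. u x - v x) \<in> L2 S" "(\<lambda>x. g x - h x) \<in> L2 S"
    using L by (auto intro: L2_diff)
  fix \<phi> and b :: 'a assume \<phi>: "\<phi> \<in> test_functions S" and b: "b \<in> Basis"
  have "(LINT x|lebesgue_on S. (u x - v x) * dir_deriv \<phi> b x) =
      (LINT x|lebesgue_on S. u x * dir_deriv \<phi> b x) - (LINT x|lebesgue_on S. v x * dir_deriv \<phi> b x)"
    unfolding left_diff_distrib
    by (intro Bochner_Integration.integral_diff L2_mult_integrable L
        L2_test_function[OF test_functions_dir_deriv[OF \<phi>] S])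
  moreover have "(LINT x|lebesgue_on S. ((g x - h x) \<bullet> b) * \<phi> x) =
      (LINT x|lebesgue_on S. (g x \<bullet> b) * \<phi> x) - (LINT x|lebesgue_on S. (h x \<bullet> b) * \<phi> x)"
    unfolding left_diff_distrib inner_diff_left
    by (intro Bochner_Integration.integral_diff L2_mult_integrable L2_component[OF b] L
        L2_test_function[OF \<phi> S])
  ultimately show "(LINT x|lebesgue_on S. (u x - v x) * dir_deriv \<phi> b x) =
      - (LINT x|lebesgue_on S. ((g x - h x) \<bullet> b) * \<phi> x)"
    using weak_gradientD(3)[OF u \<phi> b] weak_gradientD(3)[OF v \<phi> b] by simp
qed

lemma has_weak_gradient_subset:
  assumes "open S" "open T" "S \<subseteq> T" and u: "has_weak_gradient T u g"
  shows "has_weak_gradient S u g"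
  unfolding has_weak_gradient_def
proof (intro conjI ballI)
  show "u \<in> L2 S" "g \<in> L2 S"
    using weak_gradientD(1,2)[OF u] assms by (auto intro: L2_subset open_in_lebesgue)
  fix \<phi> and b :: 'a assume \<phi>: "\<phi> \<in> test_functions S" and b: "b \<in> Basis"
  have eq: "(LINT x|lebesgue_on S. d x * \<eta> x) = (LINT x|lebesgue_on T. d x * \<eta> x)"
    if "\<eta> \<in> test_functions S" for \<eta> d :: "'a \<Rightarrow> real"
    using test_functionsD(4)[OF that] \<open>S \<subseteq> T\<close>
    by (subst (1 2) integral_lebesgue_on_eq) (auto intro: open_in_lebesgue assms)
  show "(LINT x|lebesgue_on S. u x * dir_deriv \<phi> b x) = - (LINT x|lebesgue_on S. (g x \<bullet> b) * \<phi> x)"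
    unfolding eq[OF \<phi>] eq[OF test_functions_dir_deriv[OF \<phi>]]
    using weak_gradientD(3)[OF u _ b] \<phi> test_functions_mono[OF \<open>S \<subseteq> T\<close>] by blast
qed

lemma has_weak_gradient_smooth_L2:
  assumes "open S" "smooth_fun f" "f \<in> L2 S" "grad f \<in> L2 S"
  shows "has_weak_gradient S f (grad f)"
  unfolding has_weak_gradient_def
proof (intro conjI ballI assms)
  fix \<phi> and b :: 'a assume \<phi>: "\<phi> \<in> test_functions S" and b: "b \<in> Basis"
  have eq: "(LINT x|lebesgue_on S. d x * \<eta> x) = (LINT x|lebesgue. d x * \<eta> x)"
    if "\<eta> \<in> test_functions S" for \<eta> d :: "'a \<Rightarrow> real"
    using test_functionsD(4)[OF that]
    by (subst integral_lebesgue_on_eq) (auto intro: open_in_lebesgue assms)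
  show "(LINT x|lebesgue_on S. f x * dir_deriv \<phi> b x) = - (LINT x|lebesgue_on S. (grad f x \<bullet> b) * \<phi> x)"
    unfolding eq[OF \<phi>] eq[OF test_functions_dir_deriv[OF \<phi>]]
    using integration_by_parts[OF \<phi> assms(2)] b by (simp add: grad_inner_Basis)
qed

lemma has_weak_gradient_smooth:
  "open S \<Longrightarrow> bounded S \<Longrightarrow> smooth_fun f \<Longrightarrow> has_weak_gradient S f (grad f)"
  by (intro has_weak_gradient_smooth_L2 L2_continuous continuous_on_grad smooth_fun_continuous)

lemma has_weak_gradient_test_function:
  "open S \<Longrightarrow> \<phi> \<in> test_functions S \<Longrightarrow> has_weak_gradient S \<phi> (grad \<phi>)"
  by (intro has_weak_gradient_smooth_L2 L2_test_function L2_grad_test_function test_functionsD(1))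

section \<open>Functions with zero boundary values\<close>

lemma L2_norm_on_square: "(L2_norm_on S f)\<^sup>2 = (LINT x|lebesgue_on S. (norm (f x))\<^sup>2)"
  by (simp add: L2_norm_on_def)

lemma H1_norm_square_diff_test_function:
  assumes S: "open S" and u: "has_weak_gradient S u g" and \<phi>: "\<phi> \<in> test_functions S"
  shows "H1_norm S (\<lambda>x. u x - \<phi> x) =
    sqrt ((LINT x|lebesgue_on S. (u x - \<phi> x)\<^sup>2) + (LINT x|lebesgue_on S. (norm (g x - grad \<phi> x))\<^sup>2))"
proof -
  let ?w = "weak_gradient S (\<lambda>x. u x - \<phi> x)"
  have d: "has_weak_gradient S (\<lambda>x. u x - \<phi> x) (\<lambda>x. g x - grad \<phi> x)"
    by (rule has_weak_gradient_diff[OF S u has_weak_gradient_test_function[OF S \<phi>]])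
  then have "has_weak_gradient S (\<lambda>x. u x - \<phi> x) ?w"
    by (intro has_weak_gradient_weak_gradient) (auto simp: H1_def)
  note [measurable] = L2D(1)[OF weak_gradientD(2)[OF this]] L2D(1)[OF weak_gradientD(2)[OF d]]
  have "(LINT x|lebesgue_on S. (norm (?w x))\<^sup>2) = (LINT x|lebesgue_on S. (norm (g x - grad \<phi> x))\<^sup>2)"
    by (rule integral_cong_AE) (use weak_gradient_AE_eq[OF S d] in auto)
  then show ?thesis by (simp add: H1_norm_def L2_norm_on_square)
qed

text \<open>The norm of \<open>H\<^sup>1\<close> involves chosen weak gradients of differences. The next two rules replace it by
  integrals with a weak gradient at hand.\<close>

lemma H10_approx:
  assumes S: "open S" and u: "u \<in> H10 S" "has_weak_gradient S u g" and "\<epsilon> > 0"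
  obtains \<phi> where "\<phi> \<in> test_functions S" "(LINT x|lebesgue_on S. (u x - \<phi> x)\<^sup>2) < \<epsilon>"
    "(LINT x|lebesgue_on S. (norm (g x - grad \<phi> x))\<^sup>2) < \<epsilon>"
proof -
  obtain \<phi> where \<phi>: "\<phi> \<in> test_functions S" "H1_norm S (\<lambda>x. u x - \<phi> x) < sqrt \<epsilon>"
    using u(1) real_sqrt_gt_zero[OF \<open>\<epsilon> > 0\<close>] unfolding H10_def by blast
  then have "(LINT x|lebesgue_on S. (u x - \<phi> x)\<^sup>2) + (LINT x|lebesgue_on S. (norm (g x - grad \<phi> x))\<^sup>2) < \<epsilon>"
    using H1_norm_square_diff_test_function[OF S u(2) \<phi>(1)] by simp
  moreover have "(LINT x|lebesgue_on S. (u x - \<phi> x)\<^sup>2) \<ge> 0"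
    "(LINT x|lebesgue_on S. (norm (g x - grad \<phi> x))\<^sup>2) \<ge> 0"
    by (auto intro: Bochner_Integration.integral_nonneg)
  ultimately show ?thesis using \<phi>(1) by (intro that[of \<phi>]) linarith+
qed

lemma H10_intro:
  assumes S: "open S" and u: "has_weak_gradient S u g"
    and ap: "\<And>\<epsilon>. \<epsilon> > 0 \<Longrightarrow> \<exists>\<phi>\<in>test_functions S. (LINT x|lebesgue_on S. (u x - \<phi> x)\<^sup>2) < \<epsilon> \<and>
      (LINT x|lebesgue_on S. (norm (g x - grad \<phi> x))\<^sup>2) < \<epsilon>"
  shows "u \<in> H10 S"
  unfolding H10_def
proof (intro CollectI conjI allI impI)
  show "u \<in> H1 S" using u by (auto simp: H1_def)
  fix \<epsilon> :: real assume "\<epsilon> > 0"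
  then have "\<epsilon>\<^sup>2 / 2 > 0" by simp
  from ap[OF this] obtain \<phi> where \<phi>: "\<phi> \<in> test_functions S" "(LINT x|lebesgue_on S. (u x - \<phi> x)\<^sup>2) < \<epsilon>\<^sup>2 / 2"
    "(LINT x|lebesgue_on S. (norm (g x - grad \<phi> x))\<^sup>2) < \<epsilon>\<^sup>2 / 2" by blast
  have "sqrt ((LINT x|lebesgue_on S. (u x - \<phi> x)\<^sup>2) + (LINT x|lebesgue_on S. (norm (g x - grad \<phi> x))\<^sup>2)) < sqrt (\<epsilon>\<^sup>2)"
    using \<phi> by (intro real_sqrt_less_mono) linarith
  then have "H1_norm S (\<lambda>x. u x - \<phi> x) < \<epsilon>"
    using H1_norm_square_diff_test_function[OF S u \<phi>(1)] \<open>\<epsilon> > 0\<close> by simp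
  then show "\<exists>\<phi>\<in>test_functions S. H1_norm S (\<lambda>x. u x - \<phi> x) < \<epsilon>" using \<phi>(1) by blast
qed

lemma H10_weak_gradient: "u \<in> H10 S \<Longrightarrow> has_weak_gradient S u (weak_gradient S u)"
  by (rule has_weak_gradient_weak_gradient) (simp add: H10_def)

lemma L2_norm_diff_square_le:
  fixes f g :: "'a::euclidean_space \<Rightarrow> 'b::euclidean_space"
  assumes "f \<in> L2 S" "g \<in> L2 S"
  shows "(LINT x|lebesgue_on S. (norm (f x - g x))\<^sup>2) \<le>
    2 * (LINT x|lebesgue_on S. (norm (f x))\<^sup>2) + 2 * (LINT x|lebesgue_on S. (norm (g x))\<^sup>2)"
proof -
  have "(norm (f x - g x))\<^sup>2 \<le> 2 * (norm (f x))\<^sup>2 + 2 * (norm (g x))\<^sup>2" for x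
  proof -
    have "(norm (f x - g x))\<^sup>2 \<le> (norm (f x) + norm (g x))\<^sup>2"
      by (intro power_mono norm_triangle_ineq4) auto
    also have "\<dots> \<le> 2 * (norm (f x))\<^sup>2 + 2 * (norm (g x))\<^sup>2"
      using sum_squares_bound[of "norm (f x)" "norm (g x)"] unfolding power2_sum by linarith
    finally show ?thesis .
  qed
  then have "(LINT x|lebesgue_on S. (norm (f x - g x))\<^sup>2) \<le>
      (LINT x|lebesgue_on S. 2 * (norm (f x))\<^sup>2 + 2 * (norm (g x))\<^sup>2)"
    using assms by (intro Bochner_Integration.integral_mono L2D(2) L2_diff
        Bochner_Integration.integrable_add Bochner_Integration.integrable_mult_right)
  then show ?thesis
    using L2D(2)[OF assms(1)] L2D(2)[OF assms(2)] by simp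
qed

lemma H10_diff:
  assumes S: "open S" and u: "u \<in> H10 S" and v: "v \<in> H10 S"
  shows "(\<lambda>x. u x - v x) \<in> H10 S"
proof (rule H10_intro[OF S])
  let ?g = "weak_gradient S u" and ?h = "weak_gradient S v"
  note gu = H10_weak_gradient[OF u] and gv = H10_weak_gradient[OF v]
  show "has_weak_gradient S (\<lambda>x. u x - v x) (\<lambda>x. ?g x - ?h x)"
    by (rule has_weak_gradient_diff[OF S gu gv])
  fix \<epsilon> :: real assume "\<epsilon> > 0"
  then have e: "\<epsilon> / 4 > 0" by simp
  obtain \<phi> where \<phi>: "\<phi> \<in> test_functions S" "(LINT x|lebesgue_on S. (u x - \<phi> x)\<^sup>2) < \<epsilon> / 4"
    "(LINT x|lebesgue_on S. (norm (?g x - grad \<phi> x))\<^sup>2) < \<epsilon> / 4" by (rule H10_approx[OF S u gu e])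
  obtain \<eta> where \<eta>: "\<eta> \<in> test_functions S" "(LINT x|lebesgue_on S. (v x - \<eta> x)\<^sup>2) < \<epsilon> / 4"
    "(LINT x|lebesgue_on S. (norm (?h x - grad \<eta> x))\<^sup>2) < \<epsilon> / 4" by (rule H10_approx[OF S v gv e])
  have g: "grad (\<lambda>x. \<phi> x - \<eta> x) x = grad \<phi> x - grad \<eta> x" for x
    by (rule grad_diff[OF test_functionsD(1)[OF \<phi>(1)] test_functionsD(1)[OF \<eta>(1)]])
  have "(LINT x|lebesgue_on S. (norm ((u x - \<phi> x) - (v x - \<eta> x)))\<^sup>2) \<le>
      2 * (LINT x|lebesgue_on S. (norm (u x - \<phi> x))\<^sup>2) + 2 * (LINT x|lebesgue_on S. (norm (v x - \<eta> x))\<^sup>2)"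
    by (intro L2_norm_diff_square_le L2_diff weak_gradientD(1)[OF gu] weak_gradientD(1)[OF gv]
        L2_test_function S \<phi>(1) \<eta>(1))
  moreover have "(LINT x|lebesgue_on S. (norm ((?g x - grad \<phi> x) - (?h x - grad \<eta> x)))\<^sup>2) \<le>
      2 * (LINT x|lebesgue_on S. (norm (?g x - grad \<phi> x))\<^sup>2) + 2 * (LINT x|lebesgue_on S. (norm (?h x - grad \<eta> x))\<^sup>2)"
    by (intro L2_norm_diff_square_le L2_diff weak_gradientD(2)[OF gu] weak_gradientD(2)[OF gv]
        L2_grad_test_function S \<phi>(1) \<eta>(1))
  ultimately show "\<exists>\<phi>\<in>test_functions S. (LINT x|lebesgue_on S. (u x - v x - \<phi> x)\<^sup>2) < \<epsilon> \<and>
      (LINT x|lebesgue_on S. (norm (?g x - ?h x - grad \<phi> x))\<^sup>2) < \<epsilon>"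
    using \<phi>(2,3) \<eta>(2,3)
    by (intro bexI[OF _ test_functions_diff[OF \<phi>(1) \<eta>(1)]]) (simp add: g algebra_simps)
qed

lemma norm_grad_ge: "b \<in> Basis \<Longrightarrow> (dir_deriv f b x)\<^sup>2 \<le> (norm (grad f x))\<^sup>2"
  using Basis_le_norm[of b "grad f x"] by (simp add: grad_inner_Basis abs_le_square_iff[symmetric])

text \<open>The Poincare inequality: integrating \<open>\<partial>\<^sub>b (x\<^sub>b \<phi>\<^sup>2) = \<phi>\<^sup>2 + 2 x\<^sub>b \<phi> \<partial>\<^sub>b \<phi>\<close> gives zero, and on a bounded
  set the second term is absorbed by the first one and the gradient.\<close>

lemma Poincare_test_function:
  assumes S: "open S" and \<phi>: "\<phi> \<in> test_functions S" and R: "\<And>x. x \<in> S \<Longrightarrow> norm x \<le> R"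
  shows "(LINT x|lebesgue_on S. (\<phi> x)\<^sup>2) \<le> 4 * R\<^sup>2 * (LINT x|lebesgue_on S. (norm (grad \<phi> x))\<^sup>2)"
proof -
  obtain b :: 'a where b: "b \<in> Basis" by (metis SOME_Basis)
  let ?d = "dir_deriv \<phi> b"
  note smooth = test_functionsD(1)[OF \<phi>]
  have sm: "smooth_fun (\<lambda>x. x \<bullet> b * \<phi> x)" by (rule smooth_fun_mult[OF smooth_fun_inner smooth])
  have dd: "dir_deriv (\<lambda>x. x \<bullet> b * \<phi> x) b x = (x \<bullet> b) * ?d x + \<phi> x" for x
  proof -
    have "dir_deriv (\<lambda>x. x \<bullet> b) b x = 1"
      using b by (subst dir_deriv_eqI[of _ "\<lambda>h. h \<bullet> b"]) (auto intro!: derivative_eq_intros)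
    then show ?thesis
      using smooth_fun_differentiable[OF smooth_fun_inner] smooth_fun_differentiable[OF smooth]
      by (subst dir_deriv_mult) simp_all
  qed
  note i1 = integrable_test_function[OF \<phi> smooth_fun_continuous[OF smooth]]
  note i2 = integrable_test_function[OF test_functions_dir_deriv[OF \<phi>, of b] smooth_fun_continuous[OF sm]]
  note i3 = integrable_test_function[OF test_functions_dir_deriv[OF \<phi>, of b]
      smooth_fun_continuous[OF smooth_fun_dir_deriv[OF smooth, of b]]]
  have "(LINT x|lebesgue. (x \<bullet> b * \<phi> x) * ?d x) = - (LINT x|lebesgue. ((x \<bullet> b) * ?d x + \<phi> x) * \<phi> x)"
    using integration_by_parts[OF \<phi> sm, of b] unfolding dd .
  also have "(LINT x|lebesgue. ((x \<bullet> b) * ?d x + \<phi> x) * \<phi> x) =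
      (LINT x|lebesgue. (x \<bullet> b * \<phi> x) * ?d x + \<phi> x * \<phi> x)"
    by (simp add: algebra_simps)
  also have "\<dots> = (LINT x|lebesgue. (x \<bullet> b * \<phi> x) * ?d x) + (LINT x|lebesgue. \<phi> x * \<phi> x)"
    by (intro Bochner_Integration.integral_add i1 i2)
  finally have "(LINT x|lebesgue. \<phi> x * \<phi> x) = - 2 * (LINT x|lebesgue. (x \<bullet> b * \<phi> x) * ?d x)" by simp
  also have "\<dots> = (LINT x|lebesgue. - 2 * ((x \<bullet> b * \<phi> x) * ?d x))" by simp
  also have "\<dots> \<le> (LINT x|lebesgue. \<phi> x * \<phi> x / 2 + 2 * R\<^sup>2 * (?d x * ?d x))"
  proof (rule Bochner_Integration.integral_mono)
    fix x
    show "- 2 * ((x \<bullet> b * \<phi> x) * ?d x) \<le> \<phi> x * \<phi> x / 2 + 2 * R\<^sup>2 * (?d x * ?d x)"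
    proof (cases "x \<in> S")
      case True
      have "\<bar>x \<bullet> b\<bar> \<le> R" using Basis_le_norm[OF b, of x] R[OF True] by linarith
      then have "(x \<bullet> b)\<^sup>2 \<le> R\<^sup>2" using power_mono[of "\<bar>x \<bullet> b\<bar>" R 2] by simp
      then have "(x \<bullet> b)\<^sup>2 * (?d x)\<^sup>2 \<le> R\<^sup>2 * (?d x)\<^sup>2" by (rule mult_right_mono) simp
      moreover have "0 \<le> (\<phi> x + 2 * (x \<bullet> b) * ?d x)\<^sup>2" by simp
      ultimately show ?thesis by (simp add: power2_eq_square algebra_simps)
    next
      case False
      then show ?thesis using test_functionsD(4)[OF \<phi>] by simp
    qed
  qed (intro Bochner_Integration.integrable_add integrable_mult_right integrable_divide i1 i2 i3)+
  also have "\<dots> = (LINT x|lebesgue. \<phi> x * \<phi> x) / 2 + 2 * R\<^sup>2 * (LINT x|lebesgue. ?d x * ?d x)"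
    by (subst Bochner_Integration.integral_add)
      (auto intro: Bochner_Integration.integrable_add integrable_mult_right integrable_divide i1 i3)
  finally have "(LINT x|lebesgue. \<phi> x * \<phi> x) \<le> 4 * R\<^sup>2 * (LINT x|lebesgue. ?d x * ?d x)" by simp
  moreover have "(LINT x|lebesgue_on S. (\<phi> x)\<^sup>2) = (LINT x|lebesgue. \<phi> x * \<phi> x)"
    using S test_functionsD(4)[OF \<phi>] by (subst integral_lebesgue_on_eq) (auto simp: power2_eq_square)
  moreover have "(LINT x|lebesgue_on S. (?d x)\<^sup>2) = (LINT x|lebesgue. ?d x * ?d x)"
    using S test_functionsD(4)[OF test_functions_dir_deriv[OF \<phi>]]
    by (subst integral_lebesgue_on_eq) (auto simp: power2_eq_square)
  moreover have "(LINT x|lebesgue_on S. (?d x)\<^sup>2) \<le> (LINT x|lebesgue_on S. (norm (grad \<phi> x))\<^sup>2)"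
    using L2D(2)[OF L2_test_function[OF test_functions_dir_deriv[OF \<phi>, of b] S]]
      L2D(2)[OF L2_grad_test_function[OF \<phi> S]] norm_grad_ge[OF b, of \<phi>]
    by (intro Bochner_Integration.integral_mono) auto
  then have "4 * R\<^sup>2 * (LINT x|lebesgue_on S. (?d x)\<^sup>2) \<le> 4 * R\<^sup>2 * (LINT x|lebesgue_on S. (norm (grad \<phi> x))\<^sup>2)"
    by (intro mult_left_mono) auto
  ultimately show ?thesis by simp
qed

text \<open>Approximating test functions have small gradients, so they are small by the Poincare inequality.\<close>

lemma H10_zero_gradient:
  assumes S: "open S" "bounded S" and v: "v \<in> H10 S" and g: "has_weak_gradient S v g"
    and g0: "AE x in lebesgue_on S. g x = 0"
  shows "AE x in lebesgue_on S. v x = 0"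
proof -
  obtain R where R: "\<And>x. x \<in> S \<Longrightarrow> norm x \<le> R" using S(2) by (auto simp: bounded_iff)
  have vL: "v \<in> L2 S" by (rule weak_gradientD(1)[OF g])
  have small: "(LINT x|lebesgue_on S. (norm (v x))\<^sup>2) \<le> 0 + \<epsilon>" if "\<epsilon> > 0" for \<epsilon>
  proof -
    \<comment> \<open>two times the approximation error, and two times \<open>4 * R\<^sup>2\<close> from the Poincare inequality\<close>
    have e: "\<epsilon> / (2 + 8 * R\<^sup>2) > 0" using that by (simp add: add_pos_nonneg)
    obtain \<phi> where \<phi>: "\<phi> \<in> test_functions S" "(LINT x|lebesgue_on S. (v x - \<phi> x)\<^sup>2) < \<epsilon> / (2 + 8 * R\<^sup>2)"
      "(LINT x|lebesgue_on S. (norm (g x - grad \<phi> x))\<^sup>2) < \<epsilon> / (2 + 8 * R\<^sup>2)"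
      by (rule H10_approx[OF S(1) v g e])
    note L = L2_test_function[OF \<phi>(1) S(1)] L2_grad_test_function[OF \<phi>(1) S(1)]
    note [measurable] = L2D(1)[OF weak_gradientD(2)[OF g]] L2D(1)[OF L(2)]
    have "(LINT x|lebesgue_on S. (norm (grad \<phi> x))\<^sup>2) = (LINT x|lebesgue_on S. (norm (g x - grad \<phi> x))\<^sup>2)"
      by (rule integral_cong_AE) (use g0 in auto)
    then have "(LINT x|lebesgue_on S. (\<phi> x)\<^sup>2) \<le> 4 * R\<^sup>2 * (\<epsilon> / (2 + 8 * R\<^sup>2))"
      using \<phi>(3) Poincare_test_function[OF S(1) \<phi>(1) R]
      by (smt (verit, best) mult_left_mono zero_le_power2 mult_nonneg_nonneg)
    moreover have "(LINT x|lebesgue_on S. (norm (v x))\<^sup>2) =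
        (LINT x|lebesgue_on S. (norm ((v x - \<phi> x) - (0 - \<phi> x)))\<^sup>2)" by simp
    moreover have "(LINT x|lebesgue_on S. (norm ((v x - \<phi> x) - (0 - \<phi> x)))\<^sup>2) \<le>
        2 * (LINT x|lebesgue_on S. (norm (v x - \<phi> x))\<^sup>2) + 2 * (LINT x|lebesgue_on S. (norm (0 - \<phi> x))\<^sup>2)"
      by (intro L2_norm_diff_square_le L2_diff vL L) (auto simp: L2_def)
    ultimately have "(LINT x|lebesgue_on S. (norm (v x))\<^sup>2) \<le>
        2 * (\<epsilon> / (2 + 8 * R\<^sup>2)) + 2 * (4 * R\<^sup>2 * (\<epsilon> / (2 + 8 * R\<^sup>2)))"
      using \<phi>(2) by simp
    also have "\<dots> = (2 + 8 * R\<^sup>2) * (\<epsilon> / (2 + 8 * R\<^sup>2))" by (simp only: distrib_right)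
    also have "\<dots> = \<epsilon>"
    proof -
      have "2 + 8 * R\<^sup>2 \<noteq> 0" using zero_le_power2[of R] by linarith
      then show ?thesis by simp
    qed
    finally show ?thesis by simp
  qed
  have "(LINT x|lebesgue_on S. (norm (v x))\<^sup>2) = 0"
    by (intro antisym field_le_epsilon[OF small] Bochner_Integration.integral_nonneg zero_le_power2)
  then have "AE x in lebesgue_on S. (norm (v x))\<^sup>2 = 0"
    by (subst (asm) integral_nonneg_eq_0_iff_AE) (use L2D(2)[OF vL] in auto)
  then show ?thesis by simp
qed

lemma L2_zero_extension:
  fixes f :: "'a::euclidean_space \<Rightarrow> 'b::euclidean_space"
  assumes S: "S \<in> sets lebesgue" and f: "f \<in> L2 S"
  shows "(\<lambda>x. if x \<in> S then f x else 0) \<in> L2 UNIV"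
    and "(LINT x|lebesgue. (norm (if x \<in> S then f x else 0))\<^sup>2) = (LINT x|lebesgue_on S. (norm (f x))\<^sup>2)"
proof -
  have eq: "(norm (if x \<in> S then f x else 0))\<^sup>2 = (if x \<in> S then (norm (f x))\<^sup>2 else 0)" for x
    by simp
  show "(LINT x|lebesgue. (norm (if x \<in> S then f x else 0))\<^sup>2) = (LINT x|lebesgue_on S. (norm (f x))\<^sup>2)"
    unfolding eq by (rule Lebesgue_Measure.integral_restrict_UNIV[OF S])
  have "integrable lebesgue (\<lambda>x. if x \<in> S then (norm (f x))\<^sup>2 else 0)"
    using L2D(2)[OF f] by (simp add: Lebesgue_Measure.integrable_restrict_UNIV[OF S])
  moreover have "(\<lambda>x. if x \<in> S then f x else 0) \<in> borel_measurable lebesgue"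
    using borel_measurable_if_I[OF L2D(1)[OF f] S] .
  ultimately show "(\<lambda>x. if x \<in> S then f x else 0) \<in> L2 UNIV"
    unfolding L2_def lebesgue_on_UNIV_eq mem_Collect_eq eq by blast
qed

lemma L2_cbox_integrable:
  fixes f :: "'a::euclidean_space \<Rightarrow> 'b::euclidean_space"
  assumes "f \<in> L2 UNIV"
  shows "integrable (lebesgue_on (cbox a b)) f"
proof -
  have f: "f \<in> L2 (cbox a b)" by (rule L2_subset[OF assms]) auto
  interpret finite_measure "lebesgue_on (cbox a b)" by (rule finite_measure_lebesgue_on) simp
  show ?thesis
  proof (rule Bochner_Integration.integrable_bound)
    show "integrable (lebesgue_on (cbox a b)) (\<lambda>x. 1 + (norm (f x))\<^sup>2)"
      using L2D(2)[OF f] by simp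
    have "s \<le> \<bar>1 + s\<^sup>2\<bar>" for s :: real
      using sum_squares_bound[of 1 s] by simp (smt (verit) zero_le_power2)
    then show "AE x in lebesgue_on (cbox a b). norm (f x) \<le> norm (1 + (norm (f x))\<^sup>2)" by simp
  qed (rule L2D(1)[OF f])
qed

text \<open>The bound \<open>s\<close> on the square mean is at the same time the weight in Young's inequality
  \<open>t \<le> s + t\<^sup>2 / s\<close>.\<close>

lemma cbox_integral_norm_le:
  fixes f :: "'a::euclidean_space \<Rightarrow> 'b::euclidean_space"
  assumes f: "f \<in> L2 UNIV" and "s > 0" and e: "(LINT x|lebesgue. (norm (f x))\<^sup>2) \<le> s\<^sup>2"
  shows "(LINT x|lebesgue_on (cbox a b). norm (f x)) \<le> s * (measure lebesgue (cbox a b) + 1)"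
proof -
  have f': "f \<in> L2 (cbox a b)" by (rule L2_subset[OF f]) auto
  interpret finite_measure "lebesgue_on (cbox a b)" by (rule finite_measure_lebesgue_on) simp
  have "t \<le> s + t\<^sup>2 / s" for t
  proof -
    have "2 * s * t \<le> s\<^sup>2 + t\<^sup>2" by (rule sum_squares_bound)
    moreover have "s * t \<le> s\<^sup>2 + t\<^sup>2"
      using calculation zero_le_power2[of s] zero_le_power2[of t] unfolding mult.assoc by linarith
    ultimately show ?thesis
      using \<open>s > 0\<close> by (simp add: field_simps power2_eq_square)
  qed
  then have "(LINT x|lebesgue_on (cbox a b). norm (f x)) \<le> (LINT x|lebesgue_on (cbox a b). s + (norm (f x))\<^sup>2 / s)"
    using L2D(2)[OF f'] L2_cbox_integrable[OF f, of a b]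
    by (intro Bochner_Integration.integral_mono) auto
  also have "\<dots> = s * measure lebesgue (cbox a b) + (LINT x|lebesgue_on (cbox a b). (norm (f x))\<^sup>2) / s"
    using L2D(2)[OF f'] by (simp add: measure_restrict_space)
  also have "(LINT x|lebesgue_on (cbox a b). (norm (f x))\<^sup>2) \<le> (LINT x|lebesgue. (norm (f x))\<^sup>2)"
    using integral_mono_lebesgue_on_AE[of UNIV "\<lambda>x. (norm (f x))\<^sup>2" "\<lambda>x. (norm (f x))\<^sup>2" "cbox a b"] L2D(2)[OF f]
    by (simp add: lebesgue_on_UNIV_eq)
  then have "(LINT x|lebesgue_on (cbox a b). (norm (f x))\<^sup>2) / s \<le> s\<^sup>2 / s"
    using e \<open>s > 0\<close> by (intro divide_right_mono) auto
  finally show ?thesis using \<open>s > 0\<close> by (simp add: power2_eq_square algebra_simps)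
qed

text \<open>For averages over boxes, a Lipschitz bound passes to the limit from test functions, since only the
  mean of the gradient over a translate of the box enters. At points of continuity, averages over
  shrinking boxes then give the bound for the values of the extension by zero.\<close>

lemma H10_box_average_lipschitz:
  assumes S: "open S" and v: "v \<in> H10 S" and g: "has_weak_gradient S v g"
    and M: "AE x in lebesgue_on S. norm (g x) \<le> M" "M \<ge> 0"
  defines "w \<equiv> \<lambda>x. if x \<in> S then v x else 0"
  shows "\<bar>(LINT x|lebesgue_on (cbox (a + h) (b + h)). w x) - (LINT x|lebesgue_on (cbox a b). w x)\<bar>
    \<le> M * norm h * measure lebesgue (cbox a b)"
proof -
  let ?\<mu> = "measure lebesgue (cbox a b)"
  let ?D = "\<bar>(LINT x|lebesgue_on (cbox (a + h) (b + h)). w x) - (LINT x|lebesgue_on (cbox a b). w x)\<bar>"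
  define G where "G = (\<lambda>x. if x \<in> S then g x else 0)"
  note Sm = open_in_lebesgue[OF S]
  have w2: "w \<in> L2 UNIV" and G2: "G \<in> L2 UNIV"
    unfolding w_def G_def by (rule L2_zero_extension(1)[OF Sm weak_gradientD(1)[OF g]]
        L2_zero_extension(1)[OF Sm weak_gradientD(2)[OF g]])+
  have vol: "measure lebesgue (cbox (a + c) (b + c)) = ?\<mu>" for c
    using measure_translation[of c "cbox a b"] cbox_translation[of c a b] by (simp add: add.commute)
  have "?D \<le> norm h * (M * ?\<mu> + s * (?\<mu> + 1)) + 2 * (s * (?\<mu> + 1))" if s: "s > 0" for s
  proof -
    have "s\<^sup>2 > 0" using s by simp
    then obtain \<phi> where \<phi>: "\<phi> \<in> test_functions S" "(LINT x|lebesgue_on S. (v x - \<phi> x)\<^sup>2) < s\<^sup>2"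
      "(LINT x|lebesgue_on S. (norm (g x - grad \<phi> x))\<^sup>2) < s\<^sup>2" by (rule H10_approx[OF S v g])
    note smooth = test_functionsD(1)[OF \<phi>(1)]
    have ex1: "(if x \<in> S then v x - \<phi> x else 0) = w x - \<phi> x" for x
      by (auto simp: w_def test_functionsD(4)[OF \<phi>(1)])
    have ex2: "(if x \<in> S then g x - grad \<phi> x else 0) = G x - grad \<phi> x" for x
      by (auto simp: G_def grad_test_function_eq_0[OF \<phi>(1)])
    have L1: "(\<lambda>x. v x - \<phi> x) \<in> L2 S" and L2: "(\<lambda>x. g x - grad \<phi> x) \<in> L2 S"
      by (intro L2_diff weak_gradientD(1)[OF g] weak_gradientD(2)[OF g] L2_test_function
          L2_grad_test_function \<phi>(1) S)+
    have E1: "(\<lambda>x. w x - \<phi> x) \<in> L2 UNIV" "(LINT x|lebesgue. (norm (w x - \<phi> x))\<^sup>2) \<le> s\<^sup>2"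
      using L2_zero_extension[OF Sm L1] \<phi>(2) unfolding ex1 by auto
    have E2: "(\<lambda>x. G x - grad \<phi> x) \<in> L2 UNIV" "(LINT x|lebesgue. (norm (G x - grad \<phi> x))\<^sup>2) \<le> s\<^sup>2"
      using L2_zero_extension[OF Sm L2] \<phi>(3) unfolding ex2 by auto
    have int_c: "integrable (lebesgue_on (cbox a b)) f" "(LINT x|lebesgue_on (cbox a b). f x) = integral (cbox a b) f"
      if "continuous_on UNIV f" for f :: "'a \<Rightarrow> real" and a b
    proof -
      show i: "integrable (lebesgue_on (cbox a b)) f"
        using that by (intro continuous_imp_integrable) (rule continuous_on_subset, auto)
      show "(LINT x|lebesgue_on (cbox a b). f x) = integral (cbox a b) f"
        using i by (rule lebesgue_integral_eq_integral) simp
    qed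
    have near: "\<bar>(LINT x|lebesgue_on (cbox c d). w x) - integral (cbox c d) \<phi>\<bar> \<le> s * (?\<mu> + 1)"
      if cd: "measure lebesgue (cbox c d) = ?\<mu>" for c d
    proof -
      have "(LINT x|lebesgue_on (cbox c d). w x) - integral (cbox c d) \<phi> =
          (LINT x|lebesgue_on (cbox c d). w x - \<phi> x)"
        using int_c[OF smooth_fun_continuous[OF smooth], of c d] L2_cbox_integrable[OF w2, of c d]
        by simp
      also have "\<bar>\<dots>\<bar> \<le> (LINT x|lebesgue_on (cbox c d). norm (w x - \<phi> x))"
        using integral_norm_bound[of "lebesgue_on (cbox c d)" "\<lambda>x. w x - \<phi> x"] by simp
      also have "\<dots> \<le> s * (?\<mu> + 1)"
        using cbox_integral_norm_le[OF E1(1) s E1(2), of c d] cd by simp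
      finally show ?thesis .
    qed
    obtain t where t: "integral (cbox (a + h) (b + h)) \<phi> - integral (cbox a b) \<phi> =
        integral (cbox (a + t *\<^sub>R h) (b + t *\<^sub>R h)) (dir_deriv \<phi> h)"
      by (rule cbox_integral_translate_diff[OF \<phi>(1)])
    define c d where "c = a + t *\<^sub>R h" and "d = b + t *\<^sub>R h"
    have cd: "measure lebesgue (cbox c d) = ?\<mu>" unfolding c_def d_def by (rule vol)
    interpret finite_measure "lebesgue_on (cbox c d)" by (rule finite_measure_lebesgue_on) simp
    have "\<bar>integral (cbox c d) (dir_deriv \<phi> h)\<bar> = \<bar>LINT x|lebesgue_on (cbox c d). dir_deriv \<phi> h x\<bar>"
      using int_c(2)[OF smooth_fun_continuous[OF smooth_fun_dir_deriv[OF smooth]]] by simp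
    also have "\<dots> \<le> (LINT x|lebesgue_on (cbox c d). norm (dir_deriv \<phi> h x))"
      using integral_norm_bound[of "lebesgue_on (cbox c d)" "dir_deriv \<phi> h"] by simp
    also have "\<dots> \<le> (LINT x|lebesgue_on (cbox c d). norm h * (M + norm (G x - grad \<phi> x)))"
    proof (rule integral_mono_AE)
      show "integrable (lebesgue_on (cbox c d)) (\<lambda>x. norm (dir_deriv \<phi> h x))"
        by (intro integrable_norm int_c(1) smooth_fun_continuous smooth_fun_dir_deriv smooth)
      show "integrable (lebesgue_on (cbox c d)) (\<lambda>x. norm h * (M + norm (G x - grad \<phi> x)))"
        using L2_cbox_integrable[OF E2(1), of c d]
        by (intro Bochner_Integration.integrable_mult_right Bochner_Integration.integrable_add) auto
      have "AE x in lebesgue. x \<in> S \<longrightarrow> norm (g x) \<le> M"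
        using M(1) Sm by (simp add: AE_lebesgue_on_iff)
      then have "AE x in lebesgue. x \<in> cbox c d \<longrightarrow> norm (dir_deriv \<phi> h x) \<le> norm h * (M + norm (G x - grad \<phi> x))"
      proof (rule eventually_mono, intro impI)
        fix x assume "x \<in> S \<longrightarrow> norm (g x) \<le> M"
        then have "norm (G x) \<le> M" using M(2) by (auto simp: G_def)
        then have "norm (grad \<phi> x) \<le> M + norm (G x - grad \<phi> x)"
          using norm_triangle_sub[of "grad \<phi> x" "G x"] norm_minus_commute[of "G x"] by simp
        moreover have "norm (dir_deriv \<phi> h x) \<le> norm h * norm (grad \<phi> x)"
          using Cauchy_Schwarz_ineq2[of "grad \<phi> x" h] smooth_fun_grad_inner[OF smooth, of x h]
          by (simp add: mult.commute)
        ultimately show "norm (dir_deriv \<phi> h x) \<le> norm h * (M + norm (G x - grad \<phi> x))"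
          by (meson mult_left_mono norm_ge_zero order_trans)
      qed
      then show "AE x in lebesgue_on (cbox c d). norm (dir_deriv \<phi> h x) \<le> norm h * (M + norm (G x - grad \<phi> x))"
        by (simp add: AE_lebesgue_on_iff)
    qed
    also have "\<dots> = norm h * (M * ?\<mu> + (LINT x|lebesgue_on (cbox c d). norm (G x - grad \<phi> x)))"
      using L2_cbox_integrable[OF E2(1), of c d] cd by (simp add: measure_restrict_space)
    also have "\<dots> \<le> norm h * (M * ?\<mu> + s * (?\<mu> + 1))"
      using cbox_integral_norm_le[OF E2(1) s E2(2), of c d] cd by (intro mult_left_mono add_left_mono) auto
    finally have "\<bar>integral (cbox c d) (dir_deriv \<phi> h)\<bar> \<le> norm h * (M * ?\<mu> + s * (?\<mu> + 1))" .
    then show ?thesis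
      using t near[OF vol, of h] near[OF refl] unfolding c_def[symmetric] d_def[symmetric] by linarith
  qed
  moreover have "((\<lambda>s. norm h * (M * ?\<mu> + s * (?\<mu> + 1)) + 2 * (s * (?\<mu> + 1))) \<longlongrightarrow>
      norm h * (M * ?\<mu> + 0 * (?\<mu> + 1)) + 2 * (0 * (?\<mu> + 1))) (at_right 0)"
    by (intro tendsto_intros)
  ultimately have "?D \<le> norm h * (M * ?\<mu> + 0 * (?\<mu> + 1)) + 2 * (0 * (?\<mu> + 1))"
    by (intro tendsto_lowerbound[where F = "at_right 0"])
      (auto simp: eventually_at_filter)
  then show ?thesis by (simp add: mult.commute mult.left_commute)
qed

lemma cbox_average_approx:
  fixes w :: "'a::euclidean_space \<Rightarrow> real"
  assumes "w \<in> L2 UNIV" "\<And>z. z \<in> cbox a b \<Longrightarrow> \<bar>w z - c\<bar> \<le> e"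
  shows "\<bar>(LINT x|lebesgue_on (cbox a b). w x) - c * measure lebesgue (cbox a b)\<bar> \<le> e * measure lebesgue (cbox a b)"
proof -
  interpret finite_measure "lebesgue_on (cbox a b)" by (rule finite_measure_lebesgue_on) simp
  have i: "integrable (lebesgue_on (cbox a b)) w" by (rule L2_cbox_integrable[OF assms(1)])
  have "(LINT x|lebesgue_on (cbox a b). w x) - c * measure lebesgue (cbox a b) =
      (LINT x|lebesgue_on (cbox a b). w x - c)"
    using i by (simp add: measure_restrict_space)
  also have "\<bar>\<dots>\<bar> \<le> (LINT x|lebesgue_on (cbox a b). norm (w x - c))"
    using integral_norm_bound[of "lebesgue_on (cbox a b)" "\<lambda>x. w x - c"] by simp
  also have "\<dots> \<le> (LINT x|lebesgue_on (cbox a b). e)"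
    using i assms(2) by (intro Bochner_Integration.integral_mono) auto
  also have "\<dots> = e * measure lebesgue (cbox a b)" by (simp add: measure_restrict_space)
  finally show ?thesis .
qed

lemma isCont_cbox:
  fixes w :: "'a::euclidean_space \<Rightarrow> real"
  assumes "isCont w x" "e > 0"
  obtains r where "r > 0" "\<And>z. z \<in> cbox (x - r *\<^sub>R One) (x + r *\<^sub>R One) \<Longrightarrow> \<bar>w z - w x\<bar> \<le> e"
proof -
  obtain d where d: "d > 0" "\<And>z. dist z x < d \<Longrightarrow> \<bar>w z - w x\<bar> < e"
    using assms unfolding continuous_at_eps_delta by (metis dist_norm real_norm_def)
  define r where "r = d / (2 * real DIM('a))"
  have "r > 0" using d(1) by (simp add: r_def)
  have "\<bar>w z - w x\<bar> \<le> e" if "z \<in> cbox (x - r *\<^sub>R One) (x + r *\<^sub>R One)" for z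
  proof -
    have "norm (z - x) \<le> (\<Sum>b\<in>Basis. \<bar>(z - x) \<bullet> b\<bar>)" by (rule norm_le_l1)
    also have "\<dots> \<le> (\<Sum>b\<in>(Basis::'a set). r)"
      using that by (intro sum_mono) (auto simp: mem_box inner_diff_left inner_add_left abs_le_iff algebra_simps)
    also have "\<dots> = d / 2" by (simp add: r_def)
    finally show ?thesis using d by (intro less_imp_le d(2)) (simp add: dist_norm)
  qed
  with \<open>r > 0\<close> show ?thesis by (rule that)
qed

lemma H10_lipschitz:
  assumes S: "open S" and v: "v \<in> H10 S" and g: "has_weak_gradient S v g"
    and M: "AE x in lebesgue_on S. norm (g x) \<le> M" "M \<ge> 0"
  defines "w \<equiv> \<lambda>x. if x \<in> S then v x else 0"
  assumes x: "isCont w x" and y: "isCont w y"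
  shows "\<bar>w y - w x\<bar> \<le> M * norm (y - x)"
proof (rule field_le_epsilon)
  fix e :: real assume "e > 0"
  then have e2: "e / 2 > 0" by simp
  have w2: "w \<in> L2 UNIV"
    unfolding w_def by (rule L2_zero_extension(1)[OF open_in_lebesgue[OF S] weak_gradientD(1)[OF g]])
  obtain r1 where r1: "r1 > 0" "\<And>z. z \<in> cbox (x - r1 *\<^sub>R One) (x + r1 *\<^sub>R One) \<Longrightarrow> \<bar>w z - w x\<bar> \<le> e / 2"
    using isCont_cbox[OF x e2] by blast
  obtain r2 where r2: "r2 > 0" "\<And>z. z \<in> cbox (y - r2 *\<^sub>R One) (y + r2 *\<^sub>R One) \<Longrightarrow> \<bar>w z - w y\<bar> \<le> e / 2"
    using isCont_cbox[OF y e2] by blast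
  define r where "r = min r1 r2"
  have "r > 0" using r1 r2 by (simp add: r_def)
  let ?a = "x - r *\<^sub>R One" and ?b = "x + r *\<^sub>R One" and ?h = "y - x"
  let ?\<mu> = "measure lebesgue (cbox ?a ?b)"
  have "box ?a ?b \<noteq> {}" using \<open>r > 0\<close> by (auto simp: box_ne_empty inner_diff_left inner_add_left)
  then have \<mu>: "?\<mu> > 0" by (simp add: content_pos_lt_eq box_ne_empty)
  have sub: "cbox (z - r *\<^sub>R One) (z + r *\<^sub>R One) \<subseteq> cbox (z - s *\<^sub>R One) (z + s *\<^sub>R One)" if "r \<le> s" for z s
    using that by (auto simp: subset_box inner_diff_left inner_add_left)
  have ab: "?a + ?h = y - r *\<^sub>R One" "?b + ?h = y + r *\<^sub>R One" by auto
  have "measure lebesgue (cbox (?a + ?h) (?b + ?h)) = ?\<mu>"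
    using measure_translation[of ?h "cbox ?a ?b"] cbox_translation[of ?h ?a ?b] by (simp add: add.commute)
  then have 1: "\<bar>(LINT x|lebesgue_on (cbox (?a + ?h) (?b + ?h)). w x) - w y * ?\<mu>\<bar> \<le> e / 2 * ?\<mu>"
    using cbox_average_approx[OF w2, of "?a + ?h" "?b + ?h" "w y" "e / 2"] r2(2) sub[of r2 y]
    unfolding ab by (auto simp: r_def)
  have 2: "\<bar>(LINT x|lebesgue_on (cbox ?a ?b). w x) - w x * ?\<mu>\<bar> \<le> e / 2 * ?\<mu>"
    using r1(2) sub[of r1 x] by (intro cbox_average_approx[OF w2]) (auto simp: r_def)
  have 3: "\<bar>(LINT x|lebesgue_on (cbox (?a + ?h) (?b + ?h)). w x) - (LINT x|lebesgue_on (cbox ?a ?b). w x)\<bar>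
      \<le> M * norm ?h * ?\<mu>"
    unfolding w_def by (rule H10_box_average_lipschitz[OF S v g M])
  have "\<bar>w y - w x\<bar> * ?\<mu> = \<bar>w y * ?\<mu> - w x * ?\<mu>\<bar>"
    using \<mu> by (simp add: abs_mult left_diff_distrib[symmetric])
  also have "\<dots> \<le> M * norm ?h * ?\<mu> + e / 2 * ?\<mu> + e / 2 * ?\<mu>"
    using 1 2 3 by linarith
  also have "\<dots> = (M * norm ?h + e) * ?\<mu>" by (simp add: algebra_simps)
  finally show "\<bar>w y - w x\<bar> \<le> M * norm (y - x) + e" using \<mu> by simp
qed

section \<open>Approximation of Lipschitz functions with zero boundary values\<close>

text \<open>Differentiation under the integral sign shows that convolutions with smooth functions are
  stable under directional derivatives.\<close>

lemma smooth_fun_convolution: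
  fixes f :: "'a::euclidean_space \<Rightarrow> real"
  assumes f: "continuous_on UNIV f" and "smooth_fun \<eta>"
  shows "smooth_fun (\<lambda>x. integral (cbox a b) (\<lambda>y. f y * \<eta> (x - y)))"
proof (rule smooth_fun_coinduct[where A = "(\<lambda>\<eta> x. integral (cbox a b) (\<lambda>y. f y * \<eta> (x - y))) ` Collect smooth_fun"])
  let ?c = "\<lambda>\<eta> x. integral (cbox a b) (\<lambda>y. f y * \<eta> (x - y))"
  show "?c \<eta> \<in> ?c ` Collect smooth_fun" using assms(2) by blast
  fix F assume "F \<in> ?c ` Collect smooth_fun"
  then obtain \<eta> where \<eta>: "smooth_fun \<eta>" and F: "F = ?c \<eta>" by blast
  define fx where "fx = (\<lambda>x y. blinfun_inner_right (f y *\<^sub>R grad \<eta> (x - y)))"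
  have cont: "continuous_on A (\<lambda>z. h (c z))"
    if "continuous_on UNIV h" "continuous_on A c" for h :: "'a \<Rightarrow> 'b::real_normed_vector" and c and A :: "'c::topological_space set"
    by (rule continuous_on_compose2[OF that(1,2)]) simp
  have D: "(F has_derivative integral (cbox a b) (fx x)) (at x within UNIV)" for x
    unfolding F
  proof (rule leibniz_rule)
    fix x y :: 'a
    have "((\<lambda>x. \<eta> (x - y)) has_derivative (\<lambda>h. grad \<eta> (x - y) \<bullet> h)) (at x)"
      by (rule has_derivative_compose[OF _ has_derivative_grad, where f = "\<lambda>x. x - y"])
        (auto intro!: derivative_eq_intros smooth_fun_differentiable \<eta>)
    then have "((\<lambda>x. f y * \<eta> (x - y)) has_derivative (\<lambda>h. f y * (grad \<eta> (x - y) \<bullet> h))) (at x)"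
      by (rule has_derivative_mult_right)
    moreover have "blinfun_apply (fx x y) = (\<lambda>h. f y * (grad \<eta> (x - y) \<bullet> h))"
      by (auto simp: fx_def)
    ultimately show "((\<lambda>x. f y * \<eta> (x - y)) has_derivative blinfun_apply (fx x y)) (at x within UNIV)"
      by simp
    show "(\<lambda>y. f y * \<eta> (x - y)) integrable_on cbox a b"
      by (intro integrable_continuous continuous_intros cont[OF f] cont[OF smooth_fun_continuous[OF \<eta>]])
  next
    show "continuous_on (UNIV \<times> cbox a b) (\<lambda>(x, y). fx x y)"
      unfolding fx_def case_prod_unfold
      by (intro bounded_linear.continuous_on[OF bounded_linear_blinfun_inner_right]
          continuous_intros cont[OF f] cont[OF continuous_on_grad[OF \<eta>]])
  qed auto
  have "fx x integrable_on cbox a b" for x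
    unfolding fx_def
    by (intro integrable_continuous bounded_linear.continuous_on[OF bounded_linear_blinfun_inner_right]
        continuous_intros cont[OF f] cont[OF continuous_on_grad[OF \<eta>]])
  then have "dir_deriv F v = ?c (dir_deriv \<eta> v)" for v
    using dir_deriv_eqI[OF D]
    by (auto simp: blinfun_apply_integral fx_def smooth_fun_grad_inner[OF \<eta>])
  then show "(\<forall>x. F differentiable at x) \<and> (\<forall>v. dir_deriv F v \<in> ?c ` Collect smooth_fun)"
    using D smooth_fun_dir_deriv[OF \<eta>] by (auto simp: differentiable_def)
qed

lemma mollifier_exists:
  assumes "\<rho> > 0"
  obtains \<eta> :: "'a::euclidean_space \<Rightarrow> real" where "smooth_fun \<eta>" "\<And>x. \<eta> x \<ge> 0"
    "\<And>x. norm x > \<rho> \<Longrightarrow> \<eta> x = 0" "(LINT x|lebesgue. \<eta> x) = 1"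
proof -
  \<comment> \<open>a cube of this size lies in the ball of radius \<open>\<rho>\<close>\<close>
  define s where "s = \<rho> / real DIM('a)"
  have s: "s > 0" using assms by (simp add: s_def)
  define B where "B = box_bump 1 (- s *\<^sub>R One) (s *\<^sub>R One :: 'a)"
  have B0: "B x = 0 \<longleftrightarrow> x \<notin> box (- s *\<^sub>R One) (s *\<^sub>R One)" for x
    unfolding B_def by (rule box_bump_eq_0_iff) simp
  have Bs: "smooth_fun B" unfolding B_def by (rule smooth_fun_box_bump)
  have Bn: "B x \<ge> 0" for x unfolding B_def by (rule box_bump_nonneg)
  have supp: "B x = 0" if "norm x > \<rho>" for x
  proof (rule ccontr)
    assume "B x \<noteq> 0"
    then have "\<bar>x \<bullet> b\<bar> \<le> s" if "b \<in> Basis" for b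
      using that B0[of x] by (force simp: mem_box abs_le_iff)
    then have "(\<Sum>b\<in>Basis. \<bar>x \<bullet> b\<bar>) \<le> (\<Sum>b\<in>(Basis::'a set). s)" by (intro sum_mono) auto
    also have "\<dots> = \<rho>" by (simp add: s_def)
    finally show False using that norm_le_l1[of x] by linarith
  qed
  have Bi: "integrable lebesgue B"
    by (rule integrable_continuous_compact_support[of B "cball 0 \<rho>"])
      (auto intro: smooth_fun_continuous Bs supp)
  have "(LINT x|lebesgue. B x) \<noteq> 0"
  proof
    assume "(LINT x|lebesgue. B x) = 0"
    then have "AE x in lebesgue. B x = 0"
      using Bi Bn by (subst (asm) integral_nonneg_eq_0_iff_AE) auto
    moreover have "closed {x. B x = 0}"
      using smooth_fun_continuous[OF Bs, of UNIV]
      by (intro closed_Collect_eq) auto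
    ultimately have "0 \<in> {x. B x = 0}"
      by (intro mem_closed_if_AE_lebesgue) auto
    then show False using B0[of 0] s by (simp add: mem_box)
  qed
  moreover have "(LINT x|lebesgue. B x) \<ge> 0" using Bn by (intro Bochner_Integration.integral_nonneg)
  ultimately have pos: "(LINT x|lebesgue. B x) > 0" by linarith
  show ?thesis
  proof (rule that[of "\<lambda>x. (1 / (LINT x|lebesgue. B x)) * B x"])
    show "smooth_fun (\<lambda>x. 1 / (LINT x|lebesgue. B x) * B x)"
      by (rule smooth_fun_mult[OF smooth_fun_const Bs])
    show "(LINT x|lebesgue. 1 / (LINT x|lebesgue. B x) * B x) = 1" using pos by simp
  qed (use pos Bn supp in \<open>auto simp: less_imp_le\<close>)
qed

lemma norm_gradient_le_lipschitz:
  assumes D: "(f has_derivative (\<lambda>h. k \<bullet> h)) (at x)" and lip: "\<epsilon>-lipschitz_on (ball x r) f" and "r > 0"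
  shows "norm k \<le> \<epsilon>"
proof (cases "k = 0")
  case True
  then show ?thesis using lipschitz_on_nonneg[OF lip] by simp
next
  case False
  have "((\<lambda>t. f (x + t *\<^sub>R k)) has_derivative (\<lambda>t. k \<bullet> (t *\<^sub>R k))) (at 0)"
    by (rule has_derivative_compose[where f = "\<lambda>t. x + t *\<^sub>R k"])
      (use D in \<open>auto intro!: derivative_eq_intros\<close>)
  then have "((\<lambda>t. f (x + t *\<^sub>R k)) has_field_derivative (k \<bullet> k)) (at 0)"
    by (rule has_derivative_imp_has_field_derivative) simp
  then have lim: "((\<lambda>t. (f (x + t *\<^sub>R k) - f x) / t) \<longlongrightarrow> k \<bullet> k) (at 0)"
    by (simp add: has_field_derivative_iff)
  have "eventually (\<lambda>t. norm t < r / norm k) (at (0::real))"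
    using \<open>r > 0\<close> False eventually_at[of "\<lambda>t. norm t < r / norm k" "0::real" UNIV]
    by (auto intro!: exI[of _ "r / norm k"])
  then have "eventually (\<lambda>t. norm ((f (x + t *\<^sub>R k) - f x) / t) \<le> \<epsilon> * norm k) (at 0)"
  proof (rule eventually_elim2)
    show "\<forall>\<^sub>F t in at (0::real). t \<noteq> 0" by (simp add: eventually_at_filter)
    fix t :: real assume t: "norm t < r / norm k" "t \<noteq> 0"
    have "norm (t *\<^sub>R k) < r" using t False by (simp add: field_simps)
    then have "dist (f (x + t *\<^sub>R k)) (f x) \<le> \<epsilon> * dist (x + t *\<^sub>R k) x"
      using \<open>r > 0\<close> by (intro lipschitz_onD[OF lip]) (auto simp: dist_norm)
    then show "norm ((f (x + t *\<^sub>R k) - f x) / t) \<le> \<epsilon> * norm k"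
      using t by (simp add: dist_norm field_simps)
  qed
  then have "norm (k \<bullet> k) \<le> \<epsilon> * norm k"
    by (rule Lim_norm_ubound[OF _ lim, rotated]) simp
  then show ?thesis using False by (simp add: power2_norm_eq_inner[symmetric] power2_eq_square)
qed

lemma integral_reflect:
  fixes f :: "'a::euclidean_space \<Rightarrow> real"
  assumes "continuous_on UNIV f"
  shows "(LINT y|lebesgue. f (x - y)) = (LINT y|lebesgue. f y)"
proof -
  have [measurable]: "f \<in> borel_measurable borel"
    using assms by (rule borel_measurable_continuous_onI)
  have "lborel = distr lborel borel (\<lambda>y::'a. x - y)"
    using lborel_affine[of "-1" x] by (simp add: density_1)
  then have "(LINT y|lborel. f y) = (LINT y|distr lborel borel (\<lambda>y. x - y). f y)" by simp
  also have "\<dots> = (LINT y|lborel. f (x - y))"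
    by (rule integral_distr) auto
  finally show ?thesis by (simp add: integral_completion)
qed

text \<open>Mollification replaces a Lipschitz function by an average of its translates. It therefore does
  not enlarge the Lipschitz constant of the difference to a linear function, which controls the
  gradients.\<close>

lemma mollification:
  fixes f :: "'a::euclidean_space \<Rightarrow> real"
  assumes lip: "L-lipschitz_on UNIV f" and C: "compact C" "\<And>x. x \<notin> C \<Longrightarrow> f x = 0" and \<rho>: "\<rho> > 0"
  obtains \<phi> where "smooth_fun \<phi>" "\<And>x. \<phi> x \<noteq> 0 \<Longrightarrow> \<exists>y\<in>C. dist x y \<le> \<rho>"
    "\<And>x. \<bar>\<phi> x - f x\<bar> \<le> L * \<rho>"
    "\<And>x c \<epsilon> r. r > \<rho> \<Longrightarrow> \<epsilon>-lipschitz_on (ball x r) (\<lambda>y. f y - c \<bullet> y) \<Longrightarrow> norm (grad \<phi> x - c) \<le> \<epsilon>"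
proof -
  obtain a where a: "C \<subseteq> cbox (- a) a"
    using bounded_subset_cbox_symmetric[OF compact_imp_bounded[OF C(1)]] by blast
  obtain \<eta> :: "'a \<Rightarrow> real" where \<eta>: "smooth_fun \<eta>" "\<And>x. \<eta> x \<ge> 0" "\<And>x. norm x > \<rho> \<Longrightarrow> \<eta> x = 0"
    "(LINT x|lebesgue. \<eta> x) = 1" by (rule mollifier_exists[OF \<rho>]) blast
  have f: "continuous_on A f" for A
    using lipschitz_on_continuous_on[OF lip] continuous_on_subset by blast
  define \<phi> where "\<phi> = (\<lambda>x. integral (cbox (- a) a) (\<lambda>y. f y * \<eta> (x - y)))"
  have smooth: "smooth_fun \<phi>" unfolding \<phi>_def by (rule smooth_fun_convolution[OF f \<eta>(1)])
  have cont: "continuous_on UNIV (\<lambda>y. h (x - y))" if "continuous_on UNIV h" for h :: "'a \<Rightarrow> real" and x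
    by (rule continuous_on_compose2[OF that]) (auto intro!: continuous_intros)
  note \<eta>c = smooth_fun_continuous[OF \<eta>(1), of UNIV]
  have \<phi>1: "\<phi> x = (LINT y|lebesgue. f y * \<eta> (x - y))" for x
    unfolding \<phi>_def
    by (rule integral_lebesgue_eq_cbox[symmetric])
      (use a C(2) in \<open>auto intro!: continuous_on_mult f cont \<eta>c\<close>)
  have \<phi>2: "\<phi> x = (LINT z|lebesgue. f (x - z) * \<eta> z)" for x
    using integral_reflect[of "\<lambda>y. f y * \<eta> (x - y)" x] unfolding \<phi>1
    by (simp add: continuous_on_mult f cont \<eta>c)
  have int: "integrable lebesgue (\<lambda>z. h z * \<eta> z)" if "continuous_on UNIV h" for h
    by (rule integrable_continuous_compact_support[of _ "cball 0 \<rho>"])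
      (use \<eta>(3) in \<open>auto intro!: continuous_on_mult that \<eta>c\<close>)
  have avg: "\<bar>LINT z|lebesgue. h z * \<eta> z\<bar> \<le> e"
    if h: "continuous_on UNIV h" "\<And>z. norm z \<le> \<rho> \<Longrightarrow> \<bar>h z\<bar> \<le> e" for h e
  proof -
    have "\<bar>LINT z|lebesgue. h z * \<eta> z\<bar> \<le> (LINT z|lebesgue. norm (h z * \<eta> z))"
      using integral_norm_bound[of lebesgue "\<lambda>z. h z * \<eta> z"] by simp
    also have "\<dots> \<le> (LINT z|lebesgue. e * \<eta> z)"
    proof (rule Bochner_Integration.integral_mono)
      fix z
      show "norm (h z * \<eta> z) \<le> e * \<eta> z"
        using h(2)[of z] \<eta>(2)[of z] \<eta>(3)[of z]
        by (cases "norm z \<le> \<rho>") (auto simp: abs_mult intro: mult_right_mono)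
    qed (intro integrable_norm int h continuous_on_const)+
    also have "\<dots> = e" using \<eta>(4) by simp
    finally show ?thesis .
  qed
  show ?thesis
  proof (rule that[OF smooth])
    show "\<exists>y\<in>C. dist x y \<le> \<rho>" if "\<phi> x \<noteq> 0" for x
    proof (rule ccontr)
      assume "\<not> (\<exists>y\<in>C. dist x y \<le> \<rho>)"
      then have "(\<lambda>y. f y * \<eta> (x - y)) = (\<lambda>_. 0)"
        using C(2) \<eta>(3)[of "x - _"] by (auto simp: dist_norm not_le fun_eq_iff)
      then have "\<phi> x = 0" unfolding \<phi>_def by simp
      then show False using that by simp
    qed
    show "\<bar>\<phi> x - f x\<bar> \<le> L * \<rho>" for x
    proof -
      have "\<phi> x - f x = (LINT z|lebesgue. f (x - z) * \<eta> z) - (LINT z|lebesgue. f x * \<eta> z)"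
        using \<eta>(4) by (simp add: \<phi>2)
      also have "\<dots> = (LINT z|lebesgue. (f (x - z) - f x) * \<eta> z)"
        unfolding left_diff_distrib
        by (intro Bochner_Integration.integral_diff[symmetric] int[OF cont[OF f]] int[OF continuous_on_const])
      also have "\<bar>\<dots>\<bar> \<le> L * \<rho>"
      proof (rule avg)
        fix z :: 'a assume "norm z \<le> \<rho>"
        moreover have "\<bar>f (x - z) - f x\<bar> \<le> L * norm z"
          using lipschitz_onD[OF lip, of "x - z" x] by (simp add: dist_norm)
        ultimately show "\<bar>f (x - z) - f x\<bar> \<le> L * \<rho>"
          using lipschitz_on_nonneg[OF lip] by (meson mult_left_mono order_trans)
      qed (intro continuous_intros cont[OF f])
      finally show ?thesis .
    qed
    fix x c \<epsilon> r assume r: "r > \<rho>" and l: "\<epsilon>-lipschitz_on (ball x r) (\<lambda>y. f y - c \<bullet> y)"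
    let ?k = "\<lambda>y. f y - c \<bullet> y"
    have kc: "continuous_on UNIV ?k" by (intro continuous_intros f)
    have "\<epsilon>-lipschitz_on (ball x (r - \<rho>)) (\<lambda>y. \<phi> y - c \<bullet> y)"
    proof (rule lipschitz_onI)
      fix y z assume yz: "y \<in> ball x (r - \<rho>)" "z \<in> ball x (r - \<rho>)"
      have split: "f (y - s) * \<eta> s - f (z - s) * \<eta> s - (c \<bullet> (y - z)) * \<eta> s = (?k (y - s) - ?k (z - s)) * \<eta> s" for s
        by (simp add: algebra_simps inner_diff_right)
      have "(\<phi> y - c \<bullet> y) - (\<phi> z - c \<bullet> z) =
          (LINT s|lebesgue. f (y - s) * \<eta> s) - (LINT s|lebesgue. f (z - s) * \<eta> s)
            - (LINT s|lebesgue. (c \<bullet> (y - z)) * \<eta> s)"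
        using \<eta>(4) by (simp add: \<phi>2 inner_diff_right)
      also have "\<dots> = (LINT s|lebesgue. (?k (y - s) - ?k (z - s)) * \<eta> s)"
        unfolding split[symmetric]
        by (subst Bochner_Integration.integral_diff Bochner_Integration.integral_diff,
            intro Bochner_Integration.integrable_diff int[OF cont[OF f]],
            rule int[OF continuous_on_const],
            subst Bochner_Integration.integral_diff, rule int[OF cont[OF f]], rule int[OF cont[OF f]], rule refl)
      also have "\<bar>\<dots>\<bar> \<le> \<epsilon> * dist y z"
      proof (rule avg)
        fix s :: 'a assume s: "norm s \<le> \<rho>"
        have "w - s \<in> ball x r" if "w \<in> ball x (r - \<rho>)" for w
          using that s norm_triangle_ineq[of "x - w" s] by (simp add: dist_norm algebra_simps)
        then have "dist (?k (y - s)) (?k (z - s)) \<le> \<epsilon> * dist (y - s) (z - s)"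
          using yz by (intro lipschitz_onD[OF l]) auto
        then show "\<bar>?k (y - s) - ?k (z - s)\<bar> \<le> \<epsilon> * dist y z" by (simp add: dist_norm)
      qed (intro continuous_on_diff cont[OF kc])
      finally show "dist (\<phi> y - c \<bullet> y) (\<phi> z - c \<bullet> z) \<le> \<epsilon> * dist y z" by (simp add: dist_norm)
    qed (rule lipschitz_on_nonneg[OF l])
    moreover have "((\<lambda>y. \<phi> y - c \<bullet> y) has_derivative (\<lambda>h. (grad \<phi> x - c) \<bullet> h)) (at x)"
      unfolding inner_diff_left
      by (intro has_derivative_diff has_derivative_grad smooth_fun_differentiable[OF smooth]
          has_derivative_inner_right has_derivative_ident)
    ultimately show "norm (grad \<phi> x - c) \<le> \<epsilon>" using r by (intro norm_gradient_le_lipschitz) auto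
  qed
qed

text \<open>Bounded sequences with bounded gradients that converge almost everywhere converge in \<open>H\<^sup>1\<close>, by
  dominated convergence on a set of finite measure.\<close>

lemma H10_limit:
  assumes S: "open S" "bounded S" and \<phi>: "\<And>n. \<phi> n \<in> test_functions S"
    and lim: "\<And>x. x \<in> S \<Longrightarrow> (\<lambda>n. \<phi> n x) \<longlonglongrightarrow> w x"
    and glim: "AE x in lebesgue_on S. (\<lambda>n. grad (\<phi> n) x) \<longlonglongrightarrow> G x"
    and bound: "\<And>n x. x \<in> S \<Longrightarrow> \<bar>\<phi> n x\<bar> \<le> M" "\<And>n x. x \<in> S \<Longrightarrow> norm (grad (\<phi> n) x) \<le> M"
    and meas: "G \<in> borel_measurable (lebesgue_on S)"
  shows "has_weak_gradient S w G" "w \<in> H10 S"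
proof -
  interpret finite_measure "lebesgue_on S" by (rule finite_measure_bounded[OF S(2,1)])
  note Sm = open_in_lebesgue[OF S(1)]
  have \<phi>m: "\<phi> n \<in> borel_measurable (lebesgue_on S)" for n
    by (rule L2D(1)[OF L2_test_function[OF \<phi> S(1)]])
  have gm: "grad (\<phi> n) \<in> borel_measurable (lebesgue_on S)" for n
    by (rule L2D(1)[OF L2_grad_test_function[OF \<phi> S(1)]])
  have wm: "w \<in> borel_measurable (lebesgue_on S)"
    by (rule borel_measurable_LIMSEQ_real[OF _ \<phi>m]) (use lim in simp)
  note [measurable] = \<phi>m gm wm meas
  have wb: "\<bar>w x\<bar> \<le> M" if "x \<in> S" for x
    using Lim_bounded[OF tendsto_rabs[OF lim[OF that]], of 0 M] bound(1)[OF that] by blast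
  have Gb: "AE x in lebesgue_on S. norm (G x) \<le> M"
    using glim AE_space[of "lebesgue_on S"]
  proof eventually_elim
    case (elim x)
    then show ?case
      using Lim_bounded[OF tendsto_norm[of _ "G x" sequentially], of "\<lambda>n. grad (\<phi> n) x" 0 M] bound(2) by simp
  qed
  have wL: "w \<in> L2 S" by (rule L2_bounded[OF S(2,1) wm]) (use wb in \<open>auto intro!: AE_I2\<close>)
  have GL: "G \<in> L2 S" by (rule L2_bounded[OF S(2,1) meas Gb])
  show weak: "has_weak_gradient S w G"
    unfolding has_weak_gradient_def
  proof (intro conjI ballI wL GL)
    fix \<psi> and b :: 'a assume \<psi>: "\<psi> \<in> test_functions S" and b: "b \<in> Basis"
    note dt = test_functions_dir_deriv[OF \<psi>, of b]
    have i: "integrable (lebesgue_on S) (\<lambda>x. M * norm (\<eta> x))" if "\<eta> \<in> test_functions S" for \<eta> :: "'a \<Rightarrow> real"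
      using integrable_test_function[OF that continuous_on_const, of 1] test_functionsD(4)[OF that]
      by (intro Bochner_Integration.integrable_mult_right integrable_norm)
        (subst integrable_lebesgue_on_eq[OF Sm], auto)
    note [measurable] = L2D(1)[OF L2_test_function[OF \<psi> S(1)]] L2D(1)[OF L2_test_function[OF dt S(1)]]
    have "(\<lambda>n. LINT x|lebesgue_on S. \<phi> n x * dir_deriv \<psi> b x) \<longlonglongrightarrow> (LINT x|lebesgue_on S. w x * dir_deriv \<psi> b x)"
      by (rule integral_dominated_convergence[OF _ _ i[OF dt]])
        (auto intro!: AE_I2 tendsto_intros lim mult_right_mono bound(1) simp: abs_mult)
    moreover have "(\<lambda>n. LINT x|lebesgue_on S. (grad (\<phi> n) x \<bullet> b) * \<psi> x) \<longlonglongrightarrow> (LINT x|lebesgue_on S. (G x \<bullet> b) * \<psi> x)"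
    proof (rule integral_dominated_convergence[OF _ _ i[OF \<psi>]])
      show "AE x in lebesgue_on S. (\<lambda>n. grad (\<phi> n) x \<bullet> b * \<psi> x) \<longlonglongrightarrow> G x \<bullet> b * \<psi> x"
        using glim by eventually_elim (intro tendsto_intros)
      have "norm (grad (\<phi> n) x \<bullet> b * \<psi> x) \<le> M * norm (\<psi> x)" if "x \<in> S" for n x
        using Basis_le_norm[OF b, of "grad (\<phi> n) x"] bound(2)[OF that, of n]
        by (simp add: abs_mult mult_right_mono)
      then show "AE x in lebesgue_on S. norm (grad (\<phi> n) x \<bullet> b * \<psi> x) \<le> M * norm (\<psi> x)" for n
        by (intro AE_I2) simp
    qed measurable
    moreover have "(LINT x|lebesgue_on S. \<phi> n x * dir_deriv \<psi> b x) =
        - (LINT x|lebesgue_on S. (grad (\<phi> n) x \<bullet> b) * \<psi> x)" for n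
      by (rule weak_gradientD(3)[OF has_weak_gradient_test_function[OF S(1) \<phi>] \<psi> b])
    ultimately show "(LINT x|lebesgue_on S. w x * dir_deriv \<psi> b x) = - (LINT x|lebesgue_on S. (G x \<bullet> b) * \<psi> x)"
      by (intro LIMSEQ_unique[of "\<lambda>n. LINT x|lebesgue_on S. \<phi> n x * dir_deriv \<psi> b x"])
        (auto intro: tendsto_minus)
  qed
  have l1: "(\<lambda>n. LINT x|lebesgue_on S. (w x - \<phi> n x)\<^sup>2) \<longlonglongrightarrow> (LINT x|lebesgue_on S. 0)"
  proof (rule integral_dominated_convergence[where w = "\<lambda>_. (2 * M)\<^sup>2"])
    show "AE x in lebesgue_on S. (\<lambda>n. (w x - \<phi> n x)\<^sup>2) \<longlonglongrightarrow> 0"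
    proof (intro AE_I2)
      fix x assume "x \<in> space (lebesgue_on S)"
      then have "(\<lambda>n. (w x - \<phi> n x)\<^sup>2) \<longlonglongrightarrow> (w x - w x)\<^sup>2"
        by (intro tendsto_power tendsto_diff tendsto_const lim) simp
      then show "(\<lambda>n. (w x - \<phi> n x)\<^sup>2) \<longlonglongrightarrow> 0" by simp
    qed
    have "norm ((w x - \<phi> n x)\<^sup>2) \<le> (2 * M)\<^sup>2" if "x \<in> S" for n x
      using wb[OF that] bound(1)[OF that, of n] power_mono[of "\<bar>w x - \<phi> n x\<bar>" "2 * M" 2] by simp
    then show "AE x in lebesgue_on S. norm ((w x - \<phi> n x)\<^sup>2) \<le> (2 * M)\<^sup>2" for n
      by (intro AE_I2) simp
  qed auto
  have l2: "(\<lambda>n. LINT x|lebesgue_on S. (norm (G x - grad (\<phi> n) x))\<^sup>2) \<longlonglongrightarrow> (LINT x|lebesgue_on S. 0)"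
  proof (rule integral_dominated_convergence[where w = "\<lambda>_. (2 * M)\<^sup>2"])
    show "AE x in lebesgue_on S. (\<lambda>n. (norm (G x - grad (\<phi> n) x))\<^sup>2) \<longlonglongrightarrow> 0"
      using glim
    proof eventually_elim
      case (elim x)
      then have "(\<lambda>n. (norm (G x - grad (\<phi> n) x))\<^sup>2) \<longlonglongrightarrow> (norm (G x - G x))\<^sup>2"
        by (intro tendsto_power tendsto_norm tendsto_diff tendsto_const)
      then show ?case by simp
    qed
    show "AE x in lebesgue_on S. norm ((norm (G x - grad (\<phi> n) x))\<^sup>2) \<le> (2 * M)\<^sup>2" for n
      using Gb AE_space[of "lebesgue_on S"]
    proof eventually_elim
      case (elim x)
      then have "norm (G x - grad (\<phi> n) x) \<le> 2 * M"
        using bound(2)[of x n] norm_triangle_ineq4[of "G x" "grad (\<phi> n) x"] by simp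
      then show ?case using power_mono[of "norm (G x - grad (\<phi> n) x)" "2 * M" 2] by simp
    qed
  qed auto
  show "w \<in> H10 S"
  proof (rule H10_intro[OF S(1) weak])
    fix \<epsilon> :: real assume "\<epsilon> > 0"
    then have "eventually (\<lambda>n. (LINT x|lebesgue_on S. (w x - \<phi> n x)\<^sup>2) < \<epsilon>) sequentially"
      "eventually (\<lambda>n. (LINT x|lebesgue_on S. (norm (G x - grad (\<phi> n) x))\<^sup>2) < \<epsilon>) sequentially"
      using order_tendstoD(2)[OF l1, of \<epsilon>] order_tendstoD(2)[OF l2, of \<epsilon>] by auto
    then have "eventually (\<lambda>n. (LINT x|lebesgue_on S. (w x - \<phi> n x)\<^sup>2) < \<epsilon> \<and>
        (LINT x|lebesgue_on S. (norm (G x - grad (\<phi> n) x))\<^sup>2) < \<epsilon>) sequentially"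
      by (rule eventually_conj)
    then obtain n where "(LINT x|lebesgue_on S. (w x - \<phi> n x)\<^sup>2) < \<epsilon> \<and>
        (LINT x|lebesgue_on S. (norm (G x - grad (\<phi> n) x))\<^sup>2) < \<epsilon>"
      by (auto simp: eventually_sequentially)
    then show "\<exists>\<phi>\<in>test_functions S. (LINT x|lebesgue_on S. (w x - \<phi> x)\<^sup>2) < \<epsilon> \<and>
        (LINT x|lebesgue_on S. (norm (G x - grad \<phi> x))\<^sup>2) < \<epsilon>"
      using \<phi>[of n] by blast
  qed
qed

lemma H10_cong_AE:
  assumes S: "open S" and w: "w \<in> H10 S" and v: "v \<in> borel_measurable (lebesgue_on S)"
    and eq: "AE x in lebesgue_on S. w x = v x"
  shows "v \<in> H10 S"
proof (rule H10_intro[OF S])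
  let ?g = "weak_gradient S w"
  note g = H10_weak_gradient[OF w]
  show "has_weak_gradient S v ?g"
    by (rule has_weak_gradient_cong_AE[OF S g v eq L2D(1)[OF weak_gradientD(2)[OF g]]]) simp
  fix \<epsilon> :: real assume "\<epsilon> > 0"
  then obtain \<phi> where \<phi>: "\<phi> \<in> test_functions S" "(LINT x|lebesgue_on S. (w x - \<phi> x)\<^sup>2) < \<epsilon>"
    "(LINT x|lebesgue_on S. (norm (?g x - grad \<phi> x))\<^sup>2) < \<epsilon>" by (rule H10_approx[OF S w g])
  note [measurable] = v L2D(1)[OF weak_gradientD(1)[OF g]] L2D(1)[OF L2_test_function[OF \<phi>(1) S]]
  have "(LINT x|lebesgue_on S. (v x - \<phi> x)\<^sup>2) = (LINT x|lebesgue_on S. (w x - \<phi> x)\<^sup>2)"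
    by (rule integral_cong_AE) (use eq in auto)
  then show "\<exists>\<phi>\<in>test_functions S. (LINT x|lebesgue_on S. (v x - \<phi> x)\<^sup>2) < \<epsilon> \<and>
      (LINT x|lebesgue_on S. (norm (?g x - grad \<phi> x))\<^sup>2) < \<epsilon>"
    using \<phi>(2,3) by (intro bexI[OF _ \<phi>(1)]) simp
qed

text \<open>A contraction of the line that moves every value towards zero by \<open>\<delta>\<close> and hence sends small values to
  zero.\<close>

definition soft_threshold :: "real \<Rightarrow> real \<Rightarrow> real" where
  "soft_threshold \<delta> t = t - max (- \<delta>) (min \<delta> t)"

lemma soft_threshold_simps:
  "\<delta> \<ge> 0 \<Longrightarrow> \<bar>t\<bar> \<le> \<delta> \<Longrightarrow> soft_threshold \<delta> t = 0"
  "\<delta> \<ge> 0 \<Longrightarrow> t \<ge> \<delta> \<Longrightarrow> soft_threshold \<delta> t = t - \<delta>"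
  "\<delta> \<ge> 0 \<Longrightarrow> t \<le> - \<delta> \<Longrightarrow> soft_threshold \<delta> t = t + \<delta>"
  by (auto simp: soft_threshold_def)

lemma soft_threshold_bound: "\<delta> \<ge> 0 \<Longrightarrow> \<bar>soft_threshold \<delta> t - t\<bar> \<le> \<delta>"
  by (auto simp: soft_threshold_def)

lemma soft_threshold_lipschitz: "\<bar>soft_threshold \<delta> s - soft_threshold \<delta> t\<bar> \<le> \<bar>s - t\<bar>"
  by (auto simp: soft_threshold_def)

lemma lipschitz_on_soft_threshold:
  assumes "L-lipschitz_on X w"
  shows "L-lipschitz_on X (\<lambda>x. soft_threshold \<delta> (w x))"
proof (rule lipschitz_onI)
  show "dist (soft_threshold \<delta> (w x)) (soft_threshold \<delta> (w y)) \<le> L * dist x y"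
    if "x \<in> X" "y \<in> X" for x y
    using lipschitz_onD[OF assms that] soft_threshold_lipschitz[of \<delta> "w x" "w y"]
    by (simp add: dist_norm)
qed (rule lipschitz_on_nonneg[OF assms])

text \<open>Strict differentiability. This is the form of differentiability that a mollification inherits,
  since it bounds Lipschitz constants near the point.\<close>

definition strict_gradient :: "('a::euclidean_space \<Rightarrow> real) \<Rightarrow> 'a \<Rightarrow> 'a \<Rightarrow> bool" where
  "strict_gradient w x g \<longleftrightarrow> (\<forall>\<epsilon>>0. \<exists>r>0. \<epsilon>-lipschitz_on (ball x r) (\<lambda>y. w y - g \<bullet> y))"

text \<open>Where \<open>w\<close> does not vanish, thresholding only shifts \<open>w\<close> by a constant; where the gradient
  vanishes, it does not increase the local Lipschitz constant. In both cases it respects the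
  linearisation of \<open>w\<close>.\<close>

lemma soft_threshold_strict_gradient:
  assumes w: "strict_gradient w x g" "isCont w x" and zero: "w x = 0 \<Longrightarrow> g = 0"
    and "\<epsilon> > 0"
  obtains r d where "r > 0" "d > 0"
    "\<And>\<delta>. 0 \<le> \<delta> \<Longrightarrow> \<delta> < d \<Longrightarrow> \<epsilon>-lipschitz_on (ball x r) (\<lambda>y. soft_threshold \<delta> (w y) - g \<bullet> y)"
proof -
  obtain r where r: "r > 0" "\<epsilon>-lipschitz_on (ball x r) (\<lambda>y. w y - g \<bullet> y)"
    using w(1) \<open>\<epsilon> > 0\<close> unfolding strict_gradient_def by blast
  show ?thesis
  proof (cases "w x = 0")
    case True
    then have "\<epsilon>-lipschitz_on (ball x r) w" using r zero by simp
    then show ?thesis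
      using zero[OF True] by (intro that[OF r(1) zero_less_one]) (simp add: lipschitz_on_soft_threshold)
  next
    case False
    obtain r' where r': "r' > 0" "\<And>y. dist y x < r' \<Longrightarrow> dist (w y) (w x) < \<bar>w x\<bar> / 2"
      using w(2) False unfolding continuous_at_eps_delta
      by (metis zero_less_abs_iff half_gt_zero_iff)
    let ?r = "min r r'"
    show ?thesis
    proof (rule that[of ?r "\<bar>w x\<bar> / 2"])
      fix \<delta> assume \<delta>: "0 \<le> \<delta>" "\<delta> < \<bar>w x\<bar> / 2"
      have "soft_threshold \<delta> (w y) = w y - \<delta> * sgn (w x)" if "y \<in> ball x ?r" for y
      proof -
        have "\<bar>w y - w x\<bar> < \<bar>w x\<bar> / 2" using r'(2)[of y] that by (simp only: dist_real_def mem_ball dist_commute[of x] min_less_iff_conj)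
        then show ?thesis
          using False \<delta> soft_threshold_simps(2,3)[of \<delta> "w y"]
          by (cases "w x > 0") (auto simp: sgn_if abs_if split: if_splits)
      qed
      then have eq: "soft_threshold \<delta> (w y) - g \<bullet> y = (w y - g \<bullet> y) - \<delta> * sgn (w x)" if "y \<in> ball x ?r" for y
        using that by simp
      have "(\<epsilon> + 0)-lipschitz_on (ball x ?r) (\<lambda>y. (w y - g \<bullet> y) - \<delta> * sgn (w x))"
        by (intro lipschitz_on_diff lipschitz_on_constant lipschitz_on_subset[OF r(2)]) auto
      then have "\<epsilon>-lipschitz_on (ball x ?r) (\<lambda>y. (w y - g \<bullet> y) - \<delta> * sgn (w x))"
        by (simp only: add_0_right)
      then show "\<epsilon>-lipschitz_on (ball x ?r) (\<lambda>y. soft_threshold \<delta> (w y) - g \<bullet> y)"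
        by (rule lipschitz_on_transform) (rule eq)
    qed (use r r' False in auto)
  qed
qed

text \<open>Thresholding moves the support of \<open>w\<close> into the interior of \<open>S\<close>, whatever the shape of the
  boundary, and mollification makes the result smooth. The gradients stay bounded by the Lipschitz
  constant and, by strict differentiability, converge almost everywhere.\<close>

lemma H10_if_lipschitz:
  fixes w :: "'a::euclidean_space \<Rightarrow> real"
  assumes S: "open S" "bounded S" and lip: "L-lipschitz_on UNIV w" and zero: "\<And>x. x \<notin> S \<Longrightarrow> w x = 0"
    and G: "G \<in> borel_measurable (lebesgue_on S)"
      "AE x in lebesgue_on S. strict_gradient w x (G x) \<and> (w x = 0 \<longrightarrow> G x = 0)"
  shows "w \<in> H10 S"
proof -
  have wc: "continuous_on A w" for A
    using lipschitz_on_continuous_on[OF lip] continuous_on_subset by blast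
  define \<delta> where "\<delta> n = inverse (real (Suc n))" for n
  have \<delta>: "\<delta> n > 0" "\<delta> n \<le> 1" for n by (simp_all add: \<delta>_def inverse_le_1_iff)
  have \<delta>0: "\<delta> \<longlonglongrightarrow> 0" unfolding \<delta>_def[abs_def] by (rule LIMSEQ_inverse_real_of_nat)
  let ?f = "\<lambda>n x. soft_threshold (\<delta> n) (w x)"
  define A where "A n \<phi> \<rho> \<longleftrightarrow> \<phi> \<in> test_functions S \<and> \<rho> \<le> \<delta> n \<and> (\<forall>x. \<bar>\<phi> x - ?f n x\<bar> \<le> L * \<delta> n) \<and>
      (\<forall>x c \<epsilon> r. r > \<rho> \<longrightarrow> \<epsilon>-lipschitz_on (ball x r) (\<lambda>y. ?f n y - c \<bullet> y) \<longrightarrow> norm (grad \<phi> x - c) \<le> \<epsilon>)"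
    for n \<phi> \<rho>
  have "\<exists>\<phi> \<rho>. A n \<phi> \<rho>" for n
  proof -
    define C where "C = {x. \<delta> n \<le> \<bar>w x\<bar>}"
    have CS: "C \<subseteq> S" using zero \<delta>(1)[of n] by (force simp: C_def)
    have "closed C" unfolding C_def by (intro closed_Collect_le continuous_intros wc)
    then have C: "compact C" using CS S(2) bounded_subset by (auto simp: compact_eq_bounded_closed)
    obtain e where e: "e > 0" "(\<Union>x\<in>C. cball x e) \<subseteq> S"
      by (rule compact_subset_open_imp_cball_epsilon_subset[OF C S(1) CS])
    \<comment> \<open>small enough to stay inside \<open>S\<close>, and tending to zero with \<open>n\<close>\<close>
    define \<rho> where "\<rho> = min e (\<delta> n)"
    have \<rho>: "\<rho> > 0" "\<rho> \<le> e" "\<rho> \<le> \<delta> n" using e(1) \<delta>(1)[of n] by (auto simp: \<rho>_def)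
    have fC: "?f n x = 0" if "x \<notin> C" for x
      using that \<delta>(1)[of n] by (intro soft_threshold_simps) (auto simp: C_def)
    obtain \<phi> where \<phi>: "smooth_fun \<phi>" "\<And>x. \<phi> x \<noteq> 0 \<Longrightarrow> \<exists>y\<in>C. dist x y \<le> \<rho>" "\<And>x. \<bar>\<phi> x - ?f n x\<bar> \<le> L * \<rho>"
      "\<And>x c \<epsilon> r. r > \<rho> \<Longrightarrow> \<epsilon>-lipschitz_on (ball x r) (\<lambda>y. ?f n y - c \<bullet> y) \<Longrightarrow> norm (grad \<phi> x - c) \<le> \<epsilon>"
      using mollification[OF lipschitz_on_soft_threshold[OF lip, of "\<delta> n"] C fC \<rho>(1), of thesis] by blast
    have "\<phi> \<in> test_functions S"
    proof (rule test_functionsI[OF \<phi>(1)])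
      show "compact {x + y | x y. x \<in> C \<and> y \<in> cball 0 \<rho>}" by (rule compact_sums[OF C compact_cball])
      show "{x + y | x y. x \<in> C \<and> y \<in> cball 0 \<rho>} \<subseteq> S"
      proof clarify
        fix x y :: 'a assume "x \<in> C" "y \<in> cball 0 \<rho>"
        then have "x + y \<in> cball x e" using \<rho>(2) by (simp add: dist_norm)
        then show "x + y \<in> S" using e(2) \<open>x \<in> C\<close> by blast
      qed
      show "\<phi> x = 0" if x: "x \<notin> {x + y | x y. x \<in> C \<and> y \<in> cball 0 \<rho>}" for x
      proof (rule ccontr)
        assume "\<phi> x \<noteq> 0"
        then obtain y where "y \<in> C" "dist x y \<le> \<rho>" using \<phi>(2) by blast
        then have "x = y + (x - y) \<and> y \<in> C \<and> x - y \<in> cball 0 \<rho>" by (simp add: dist_norm norm_minus_commute)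
        then show False using x by blast
      qed
    qed
    moreover have "\<bar>\<phi> x - ?f n x\<bar> \<le> L * \<delta> n" for x
      using \<phi>(3)[of x] mult_left_mono[OF \<rho>(3) lipschitz_on_nonneg[OF lip]] by linarith
    ultimately show ?thesis unfolding A_def using \<rho>(3) \<phi>(4) by blast
  qed
  then obtain \<phi> \<rho> where A: "\<And>n. A n (\<phi> n) (\<rho> n)" by metis
  then have \<phi>: "\<And>n. \<phi> n \<in> test_functions S" and \<rho>: "\<And>n. \<rho> n \<le> \<delta> n"
    and close: "\<And>n x. \<bar>\<phi> n x - ?f n x\<bar> \<le> L * \<delta> n"
    and grad: "\<And>n x c \<epsilon> r. r > \<rho> n \<Longrightarrow> \<epsilon>-lipschitz_on (ball x r) (\<lambda>y. ?f n y - c \<bullet> y) \<Longrightarrow>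
      norm (grad (\<phi> n) x - c) \<le> \<epsilon>"
    unfolding A_def by blast+
  have L: "L \<ge> 0" by (rule lipschitz_on_nonneg[OF lip])
  have dist: "\<bar>\<phi> n x - w x\<bar> \<le> (L + 1) * \<delta> n" for n x
    using close[of n x] soft_threshold_bound[OF less_imp_le[OF \<delta>(1)[of n]], of "w x"] by (simp add: algebra_simps)
  have "bounded (w ` closure S)"
    using S(2) by (intro compact_imp_bounded compact_continuous_image wc) simp
  then obtain K where K: "\<And>x. x \<in> S \<Longrightarrow> \<bar>w x\<bar> \<le> K"
    unfolding bounded_iff using closure_subset[of S] by (metis imageI real_norm_def subsetD)
  define M where "M = max L (\<bar>K\<bar> + (L + 1))"
  show ?thesis
  proof (rule H10_limit(2)[OF S \<phi> _ _ _ _ G(1)])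
    show "(\<lambda>n. \<phi> n x) \<longlonglongrightarrow> w x" for x
    proof (rule LIM_zero_cancel, rule Lim_null_comparison)
      show "eventually (\<lambda>n. norm (\<phi> n x - w x) \<le> (L + 1) * \<delta> n) sequentially" using dist by simp
      show "(\<lambda>n. (L + 1) * \<delta> n) \<longlonglongrightarrow> 0" using tendsto_mult_left[OF \<delta>0, of "L + 1"] by simp
    qed
    show "\<bar>\<phi> n x\<bar> \<le> M" if "x \<in> S" for n x
    proof -
      have "(L + 1) * \<delta> n \<le> L + 1" using \<delta>(1,2)[of n] L by (intro mult_left_le) auto
      then show ?thesis using dist[of n x] K[OF that] unfolding M_def by linarith
    qed
    show "norm (grad (\<phi> n) x) \<le> M" for n x
    proof -
      have "L-lipschitz_on (ball x (\<rho> n + 1)) (\<lambda>y. ?f n y - 0 \<bullet> y)"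
        using lipschitz_on_subset[OF lipschitz_on_soft_threshold[OF lip]] by simp
      then have "norm (grad (\<phi> n) x - 0) \<le> L" by (intro grad) auto
      then show ?thesis by (simp add: M_def)
    qed
    show "AE x in lebesgue_on S. (\<lambda>n. grad (\<phi> n) x) \<longlonglongrightarrow> G x"
      using G(2)
    proof eventually_elim
      case (elim x)
      show "(\<lambda>n. grad (\<phi> n) x) \<longlonglongrightarrow> G x"
      proof (rule LIMSEQ_I)
        fix e :: real assume "e > 0"
        then have e2: "e / 2 > 0" by simp
        have c: "isCont w x" using wc[of UNIV] by (simp add: continuous_on_eq_continuous_at)
        have g: "strict_gradient w x (G x)" "w x = 0 \<Longrightarrow> G x = 0" using elim by auto
        obtain r d where r: "r > 0" "d > 0"
          "\<And>\<delta>. 0 \<le> \<delta> \<Longrightarrow> \<delta> < d \<Longrightarrow> (e / 2)-lipschitz_on (ball x r) (\<lambda>y. soft_threshold \<delta> (w y) - G x \<bullet> y)"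
          by (rule soft_threshold_strict_gradient[OF g(1) c g(2) e2]) blast+
        have "eventually (\<lambda>n. \<delta> n < min r d) sequentially"
          using order_tendstoD(2)[OF \<delta>0, of "min r d"] r by simp
        then obtain N where N: "\<And>n. n \<ge> N \<Longrightarrow> \<delta> n < min r d" by (auto simp: eventually_sequentially)
        show "\<exists>N. \<forall>n\<ge>N. norm (grad (\<phi> n) x - G x) < e"
        proof (intro exI allI impI)
          fix n assume "n \<ge> N"
          then have "norm (grad (\<phi> n) x - G x) \<le> e / 2"
            using N[of n] \<delta>(1)[of n] \<rho>[of n] by (intro grad[of n r] r(3)) auto
          then show "norm (grad (\<phi> n) x - G x) < e" using \<open>e > 0\<close> by simp
        qed
      qed
    qed
  qed
qed

section \<open>Polynomials of bounded degree\<close>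

abbreviation monomial_fun :: "('a::euclidean_space \<Rightarrow> nat) \<Rightarrow> 'a \<Rightarrow> real" where
  "monomial_fun \<alpha> \<equiv> (\<lambda>x. \<Prod>b\<in>Basis. (x \<bullet> b) ^ \<alpha> b)"

lemma polynomials_monomial:
  assumes "(\<Sum>b\<in>Basis. \<alpha> b) \<le> q"
  shows "(\<lambda>x. c * monomial_fun \<alpha> x) \<in> polynomials q"
  unfolding polynomials_def using assms
  by (intro CollectI exI[of _ "{\<alpha>}"] exI[of _ "\<lambda>_. c"]) simp

lemma polynomials_const: "(\<lambda>_. c) \<in> polynomials q"
  using polynomials_monomial[of "\<lambda>_. 0" q c] by simp

lemma polynomials_add:
  assumes "f \<in> polynomials q" "g \<in> polynomials q"
  shows "(\<lambda>x. f x + g x) \<in> polynomials q"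
proof -
  obtain A c where A: "finite A" "\<forall>\<alpha>\<in>A. (\<Sum>b\<in>Basis. \<alpha> b) \<le> q" "f = (\<lambda>x. \<Sum>\<alpha>\<in>A. c \<alpha> * monomial_fun \<alpha> x)"
    using assms(1) unfolding polynomials_def by blast
  obtain B d where B: "finite B" "\<forall>\<alpha>\<in>B. (\<Sum>b\<in>Basis. \<alpha> b) \<le> q" "g = (\<lambda>x. \<Sum>\<alpha>\<in>B. d \<alpha> * monomial_fun \<alpha> x)"
    using assms(2) unfolding polynomials_def by blast
  have ext: "(\<Sum>\<alpha>\<in>A. c \<alpha> * m \<alpha>) = (\<Sum>\<alpha>\<in>A \<union> B. (if \<alpha> \<in> A then c \<alpha> else 0) * m \<alpha>)"
    "(\<Sum>\<alpha>\<in>B. d \<alpha> * m \<alpha>) = (\<Sum>\<alpha>\<in>A \<union> B. (if \<alpha> \<in> B then d \<alpha> else 0) * m \<alpha>)"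
    for m :: "('a \<Rightarrow> nat) \<Rightarrow> real"
    using A(1) B(1) by (auto intro!: sum.mono_neutral_cong_left)
  have "(\<lambda>x. f x + g x) = (\<lambda>x. \<Sum>\<alpha>\<in>A \<union> B.
      ((if \<alpha> \<in> A then c \<alpha> else 0) + (if \<alpha> \<in> B then d \<alpha> else 0)) * monomial_fun \<alpha> x)"
    unfolding A(3) B(3) ext by (simp add: distrib_right sum.distrib)
  then show ?thesis
    unfolding polynomials_def using A(1,2) B(1,2)
    by (intro CollectI exI[of _ "A \<union> B"] exI conjI) auto
qed

lemma polynomials_sum:
  "(\<And>i. i \<in> I \<Longrightarrow> f i \<in> polynomials q) \<Longrightarrow> (\<lambda>x. \<Sum>i\<in>I. f i x) \<in> polynomials q"
  by (induction I rule: infinite_finite_induct) (auto intro: polynomials_add polynomials_const)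

lemma polynomials_as_sum:
  assumes "f \<in> polynomials q"
  obtains A c where "finite A" "\<And>\<alpha>. \<alpha> \<in> A \<Longrightarrow> (\<Sum>b\<in>Basis. \<alpha> b) \<le> q"
    "f = (\<lambda>x. \<Sum>\<alpha>\<in>A. c \<alpha> * monomial_fun \<alpha> x)"
  using assms unfolding polynomials_def by blast

lemma polynomials_mult:
  assumes f: "f \<in> polynomials q" and g: "g \<in> polynomials q'"
  shows "(\<lambda>x. f x * g x) \<in> polynomials (q + q')"
proof -
  obtain A c where A: "finite A" "\<And>\<alpha>. \<alpha> \<in> A \<Longrightarrow> (\<Sum>b\<in>Basis. \<alpha> b) \<le> q" "f = (\<lambda>x. \<Sum>\<alpha>\<in>A. c \<alpha> * monomial_fun \<alpha> x)"
    by (rule polynomials_as_sum[OF f]) blast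
  obtain B d where B: "finite B" "\<And>\<alpha>. \<alpha> \<in> B \<Longrightarrow> (\<Sum>b\<in>Basis. \<alpha> b) \<le> q'" "g = (\<lambda>x. \<Sum>\<alpha>\<in>B. d \<alpha> * monomial_fun \<alpha> x)"
    by (rule polynomials_as_sum[OF g]) blast
  have "f x * g x = (\<Sum>\<alpha>\<in>A. \<Sum>\<beta>\<in>B. (c \<alpha> * d \<beta>) * monomial_fun (\<lambda>b. \<alpha> b + \<beta> b) x)" for x
    unfolding A(3) B(3) sum_product by (simp add: power_add prod.distrib mult_ac)
  moreover have "(\<lambda>x. \<Sum>\<alpha>\<in>A. \<Sum>\<beta>\<in>B. (c \<alpha> * d \<beta>) * monomial_fun (\<lambda>b. \<alpha> b + \<beta> b) x) \<in> polynomials (q + q')"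
    by (intro polynomials_sum polynomials_monomial) (simp add: sum.distrib add_mono A B)
  ultimately show ?thesis by simp
qed

lemma polynomials_cmult: "f \<in> polynomials q \<Longrightarrow> (\<lambda>x. c * f x) \<in> polynomials q"
  using polynomials_mult[OF polynomials_const[of c 0], of f q] by simp

lemma polynomials_diff: "f \<in> polynomials q \<Longrightarrow> g \<in> polynomials q \<Longrightarrow> (\<lambda>x. f x - g x) \<in> polynomials q"
  using polynomials_add[OF _ polynomials_cmult[of g q "-1"], of f] by simp

lemma polynomials_coordinate:
  assumes "b \<in> Basis"
  shows "(\<lambda>x. x \<bullet> b) \<in> polynomials 1"
proof -
  let ?\<alpha> = "\<lambda>b'. if b' = b then 1 else 0 :: nat"
  have "monomial_fun ?\<alpha> x = x \<bullet> b" for x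
  proof -
    have "monomial_fun ?\<alpha> x = (\<Prod>b'\<in>Basis. if b' = b then x \<bullet> b' else 1)"
      by (intro prod.cong) auto
    then show ?thesis using assms by simp
  qed
  then show ?thesis using polynomials_monomial[of ?\<alpha> 1 1] assms by simp
qed

lemma polynomials_inner: "(\<lambda>x. x \<bullet> v) \<in> polynomials 1"
proof -
  have "(\<lambda>x. x \<bullet> v) = (\<lambda>x. \<Sum>b\<in>Basis. (v \<bullet> b) * (x \<bullet> b))"
    by (subst euclidean_inner) (simp add: mult.commute)
  moreover have "\<dots> \<in> polynomials 1"
    by (intro polynomials_sum polynomials_cmult polynomials_coordinate)
  ultimately show ?thesis by (simp only:)
qed

lemma polynomials_prod:
  "(\<And>i. i \<in> I \<Longrightarrow> f i \<in> polynomials (q i)) \<Longrightarrow> (\<lambda>x. \<Prod>i\<in>I. f i x) \<in> polynomials (\<Sum>i\<in>I. q i)"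
  by (induction I rule: infinite_finite_induct) (auto intro: polynomials_mult polynomials_const)

text \<open>Properties of polynomials that respect degrees may be checked on constants, sums, and products
  with a coordinate.\<close>

lemma polynomials_induct [consumes 1, case_names const add coordinate raise]:
  fixes Q :: "nat \<Rightarrow> ('a::euclidean_space \<Rightarrow> real) \<Rightarrow> bool"
  assumes "f \<in> polynomials q"
    and const: "\<And>c. Q 0 (\<lambda>_. c)"
    and add: "\<And>q f g. Q q f \<Longrightarrow> Q q g \<Longrightarrow> Q q (\<lambda>x. f x + g x)"
    and coord: "\<And>q f b. Q q f \<Longrightarrow> b \<in> Basis \<Longrightarrow> Q (Suc q) (\<lambda>x. f x * (x \<bullet> b))"
    and raise: "\<And>q f. Q q f \<Longrightarrow> Q (Suc q) f"
  shows "Q q f"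
proof -
  have up: "Q q' g" if "Q k g" "k \<le> q'" for k q' g
    using that(2,1) by (induction rule: dec_induct) (auto intro: raise)
  have pow: "Q (k + n) (\<lambda>x. g x * (x \<bullet> b) ^ n)" if "Q k g" "b \<in> Basis" for k g n b
  proof (induction n)
    case 0 then show ?case using that by simp
  next
    case (Suc n)
    have "(\<lambda>x. g x * (x \<bullet> b) ^ n * (x \<bullet> b)) = (\<lambda>x. g x * (x \<bullet> b) ^ Suc n)"
      by (rule ext) (simp only: power_Suc mult_ac)
    with coord[OF Suc that(2)] show ?case by (simp only: add_Suc_right)
  qed
  have mono: "Q (\<Sum>b\<in>B. \<alpha> b) (\<lambda>x. c * (\<Prod>b\<in>B. (x \<bullet> b) ^ \<alpha> b))" if "B \<subseteq> Basis" for B c \<alpha>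
  proof -
    have "finite B" by (rule finite_subset[OF that finite_Basis])
    then show ?thesis using that
    proof (induction B)
      case empty then show ?case using const[of c] by simp
    next
      case (insert b B)
      then have "Q ((\<Sum>b\<in>B. \<alpha> b) + \<alpha> b) (\<lambda>x. c * (\<Prod>b\<in>B. (x \<bullet> b) ^ \<alpha> b) * (x \<bullet> b) ^ \<alpha> b)"
        by (intro pow) auto
      moreover have "(\<lambda>x. c * (\<Prod>b\<in>B. (x \<bullet> b) ^ \<alpha> b) * (x \<bullet> b) ^ \<alpha> b) =
          (\<lambda>x. c * (\<Prod>b\<in>insert b B. (x \<bullet> b) ^ \<alpha> b))"
        unfolding prod.insert[OF insert.hyps] by (rule ext) (simp only: mult_ac)
      moreover have "(\<Sum>b\<in>B. \<alpha> b) + \<alpha> b = (\<Sum>b\<in>insert b B. \<alpha> b)"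
        unfolding sum.insert[OF insert.hyps] by (rule add.commute)
      ultimately show ?case by (simp only:)
    qed
  qed
  obtain A c where A: "finite A" "\<And>\<alpha>. \<alpha> \<in> A \<Longrightarrow> (\<Sum>b\<in>Basis. \<alpha> b) \<le> q" "f = (\<lambda>x. \<Sum>\<alpha>\<in>A. c \<alpha> * monomial_fun \<alpha> x)"
    by (rule polynomials_as_sum[OF assms(1)]) blast
  have "Q q (\<lambda>x. \<Sum>\<alpha>\<in>A'. c \<alpha> * monomial_fun \<alpha> x)" if "A' \<subseteq> A" for A'
  proof -
    have "finite A'" by (rule finite_subset[OF that A(1)])
    then show ?thesis using that
    proof (induction A')
      case empty then show ?case using up[OF const[of 0], of q] by simp
    next
      case (insert \<alpha> A')
      have "Q q (\<lambda>x. c \<alpha> * monomial_fun \<alpha> x)"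
        using insert A(2) by (intro up[OF mono[of Basis]]) auto
      from add[OF this insert.IH] show ?case using insert by simp
    qed
  qed
  then show ?thesis unfolding A(3) by blast
qed

lemma smooth_fun_polynomial: "P \<in> polynomials q \<Longrightarrow> smooth_fun P"
  by (induction rule: polynomials_induct)
    (auto intro: smooth_fun_const smooth_fun_add smooth_fun_mult smooth_fun_inner)

lemma polynomial_on_line:
  assumes "P \<in> polynomials q"
  shows "\<exists>r. degree r \<le> q \<and> (\<forall>t. P (x + t *\<^sub>R v) = poly r t)"
  using assms
proof (induction rule: polynomials_induct)
  case (const c)
  show ?case by (rule exI[of _ "[:c:]"]) simp
next
  case (add q f g)
  then obtain r s where "degree r \<le> q" "degree s \<le> q" "\<forall>t. f (x + t *\<^sub>R v) = poly r t" "\<forall>t. g (x + t *\<^sub>R v) = poly s t"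
    by blast
  then show ?case by (intro exI[of _ "r + s"]) (auto intro: degree_add_le)
next
  case (coordinate q f b)
  then obtain r where r: "degree r \<le> q" "\<forall>t. f (x + t *\<^sub>R v) = poly r t" by blast
  have "degree (r * [:x \<bullet> b, v \<bullet> b:]) \<le> Suc q"
    by (rule order_trans[OF degree_mult_le]) (use r(1) in auto)
  then show ?case using r(2)
    by (intro exI[of _ "r * [:x \<bullet> b, v \<bullet> b:]"]) (simp add: inner_add_left algebra_simps)
qed (meson le_Suc_eq)

text \<open>On every line through a point of the open set, the polynomial has infinitely many zeros.\<close>

lemma polynomial_eq_0_if_open:
  assumes P: "P \<in> polynomials q" and "open S" "z \<in> S" and zero: "\<And>x. x \<in> S \<Longrightarrow> P x = 0"
  shows "P x = 0"
proof -
  obtain r where r: "\<And>t. P (z + t *\<^sub>R (x - z)) = poly r t"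
    using polynomial_on_line[OF P, of z "x - z"] by blast
  obtain e where e: "e > 0" "ball z e \<subseteq> S" using assms(2,3) open_contains_ball by blast
  define d where "d = e / (norm (x - z) + 1)"
  have n: "norm (x - z) + 1 > 0" by (simp add: add_nonneg_pos)
  have d: "z + t *\<^sub>R (x - z) \<in> S" if "\<bar>t\<bar> < d" for t
  proof -
    have "\<bar>t\<bar> * norm (x - z) \<le> \<bar>t\<bar> * (norm (x - z) + 1)" by (simp add: mult_left_mono)
    also have "\<dots> < d * (norm (x - z) + 1)" using that n by (rule mult_strict_right_mono)
    also have "\<dots> = e" using n by (simp add: d_def)
    finally show "z + t *\<^sub>R (x - z) \<in> S" by (intro subsetD[OF e(2)]) (simp add: dist_norm)
  qed
  have d0: "d > 0" unfolding d_def using e(1) n by simp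
  have "infinite {0<..<d}" using d0 by (simp add: infinite_Ioo)
  moreover have "{0<..<d} \<subseteq> {t. poly r t = 0}" using d zero by (auto simp: r[symmetric])
  ultimately have "infinite {t. poly r t = 0}" by (metis finite_subset)
  then have "r = 0" using poly_roots_finite by blast
  then show ?thesis using r[of 1] by simp
qed

text \<open>Consider the zeros at which the derivative in direction \<open>v\<close> does not vanish. Translates of this set
  along \<open>v\<close> cover each point at most \<open>q\<close> times, while any number of small translates of a bounded part
  of it fits into a fixed ball. So this part has measure zero.\<close>

lemma AE_polynomial_zero_critical:
  fixes P :: "'a::euclidean_space \<Rightarrow> real"
  assumes P: "P \<in> polynomials q"
  shows "AE x in lebesgue. P x = 0 \<longrightarrow> dir_deriv P v x = 0"
proof -
  define Z where "Z R = {x. P x = 0 \<and> dir_deriv P v x \<noteq> 0} \<inter> cball 0 R" for R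
  note smooth = smooth_fun_polynomial[OF P]
  have Zb: "Z R \<in> sets borel" for R
  proof -
    have "closed {x. P x = 0}" "closed {x. dir_deriv P v x = 0}"
      using smooth_fun_continuous[OF smooth, of UNIV] smooth_fun_continuous[OF smooth_fun_dir_deriv[OF smooth], of UNIV]
      by (auto intro!: closed_Collect_eq)
    then have "({x. P x = 0} - {x. dir_deriv P v x = 0}) \<inter> cball 0 R \<in> sets borel" by auto
    moreover have "Z R = ({x. P x = 0} - {x. dir_deriv P v x = 0}) \<inter> cball 0 R" by (auto simp: Z_def)
    ultimately show ?thesis by simp
  qed
  have few: "card {i. i < N \<and> x \<in> (+) ((real i / real N) *\<^sub>R v) ` Z R} \<le> q" if "N > 0" for x N R
  proof (cases "\<exists>i<N. x \<in> (+) ((real i / real N) *\<^sub>R v) ` Z R")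
    case False
    then have "{i. i < N \<and> x \<in> (+) ((real i / real N) *\<^sub>R v) ` Z R} = {}" by blast
    then show ?thesis by (simp only: card.empty zero_le)
  next
    case True
    then obtain i z where "x = (real i / real N) *\<^sub>R v + z" "z \<in> Z R" by blast
    then have i: "x - (real i / real N) *\<^sub>R v \<in> Z R" by simp
    obtain r where r: "degree r \<le> q" "\<And>t. P (x + t *\<^sub>R (- v)) = poly r t"
      using polynomial_on_line[OF P, of x "- v"] by blast
    have "r \<noteq> 0"
    proof
      assume "r = 0"
      then have z: "P (x + t *\<^sub>R (- v)) = 0" for t
        using r(2)[of t] by (simp only: \<open>r = 0\<close> poly_0)
      have line: "P (y + t *\<^sub>R v) = 0" if "y = x - s *\<^sub>R v" for y s t
      proof -
        have "y + t *\<^sub>R v = x + (s - t) *\<^sub>R (- v)" unfolding that by (simp add: algebra_simps)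
        then show ?thesis using z[of "s - t"] by (simp only:)
      qed
      let ?y = "x - (real i / real N) *\<^sub>R v"
      have "((\<lambda>t. P (?y + t *\<^sub>R v)) has_derivative (\<lambda>t. grad P ?y \<bullet> (t *\<^sub>R v))) (at 0)"
        by (rule has_derivative_compose[where f = "\<lambda>t. ?y + t *\<^sub>R v"])
          (auto intro!: derivative_eq_intros has_derivative_grad smooth_fun_differentiable smooth)
      then have "((\<lambda>_. 0) has_derivative (\<lambda>t. grad P ?y \<bullet> (t *\<^sub>R v))) (at (0::real))"
        by (simp only: line[OF refl])
      then have "(\<lambda>t::real. grad P ?y \<bullet> (t *\<^sub>R v)) = (\<lambda>_. 0)"
        by (rule has_derivative_unique) (rule has_derivative_const)
      then have "grad P ?y \<bullet> (1 *\<^sub>R v) = 0" by (rule fun_cong)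
      then show False using i by (simp add: Z_def smooth_fun_grad_inner[OF smooth])
    qed
    then have fin: "finite {t. poly r t = 0}" "card {t. poly r t = 0} \<le> q"
      using poly_roots_finite[of r] card_poly_roots_bound[of r] r(1) by auto
    have "(\<lambda>i. real i / real N) ` {i. i < N \<and> x \<in> (+) ((real i / real N) *\<^sub>R v) ` Z R} \<subseteq> {t. poly r t = 0}"
      by (auto simp: r(2)[symmetric] Z_def)
    moreover have "inj_on (\<lambda>i. real i / real N) {i. i < N \<and> x \<in> (+) ((real i / real N) *\<^sub>R v) ` Z R}"
      using that by (auto simp: inj_on_def)
    ultimately show ?thesis using fin by (meson card_inj_on_le order_trans)
  qed
  have null: "measure lebesgue (Z R) = 0" for R
  proof -
    let ?B = "cball (0::'a) (R + norm v)"
    have fm: "(+) c ` Z R \<in> lmeasurable" for c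
      using Zb[of R] by (intro measurable_translation) (auto simp: Z_def intro!: bounded_set_imp_lmeasurable)
    have bound: "real N * measure lebesgue (Z R) \<le> real q * measure lebesgue ?B" if "N > 0" for N
    proof -
      let ?T = "\<lambda>i. (+) ((real i / real N) *\<^sub>R v) ` Z R"
      have "real N * measure lebesgue (Z R) = (\<Sum>i<N. measure lebesgue (?T i))"
        by (simp add: measure_translation)
      also have "\<dots> = (\<Sum>i<N. LINT x|lebesgue. indicator (?T i) x)"
        using fm by (intro sum.cong refl) simp
      also have "\<dots> = (LINT x|lebesgue. (\<Sum>i<N. indicator (?T i) x))"
        using fm by (intro Bochner_Integration.integral_sum[symmetric]) (simp add: lmeasurable_iff_integrable[symmetric])
      also have "\<dots> \<le> (LINT x|lebesgue. real q * indicator ?B x)"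
      proof (rule Bochner_Integration.integral_mono)
        show "integrable lebesgue (\<lambda>x. \<Sum>i<N. indicat_real (?T i) x)"
          using fm by (intro Bochner_Integration.integrable_sum) (simp add: lmeasurable_iff_integrable[symmetric])
        show "integrable lebesgue (\<lambda>x. real q * indicat_real ?B x)"
          using lmeasurable_cball[of "0::'a" "R + norm v"] by (intro Bochner_Integration.integrable_mult_right) (simp add: lmeasurable_iff_integrable)
        fix x
        have sum: "(\<Sum>i<N. indicator (?T i) x) = real (card {i. i < N \<and> x \<in> ?T i})"
          by (simp add: indicator_def sum.If_cases) (auto intro: arg_cong[of _ _ card])
        show "(\<Sum>i<N. indicator (?T i) x) \<le> real q * indicator ?B x"
        proof (cases "x \<in> ?B")
          case True
          then show ?thesis using few[OF that, of x R] unfolding sum by simp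
        next
          case False
          have "x \<notin> ?T i" if "i < N" for i
          proof
            assume "x \<in> ?T i"
            then obtain z where z: "z \<in> Z R" "x = (real i / real N) *\<^sub>R v + z" by blast
            have "norm x \<le> norm ((real i / real N) *\<^sub>R v) + norm z" unfolding z(2) by (rule norm_triangle_ineq)
            also have "\<dots> \<le> norm v + R"
            proof (rule add_mono)
              have "real i / real N \<le> 1" using that by simp
              then have "real i / real N * norm v \<le> 1 * norm v" by (rule mult_right_mono) simp
              then show "norm ((real i / real N) *\<^sub>R v) \<le> norm v" by simp
              show "norm z \<le> R" using z(1) by (simp add: Z_def)
            qed
            finally show False using False by simp
          qed
          then show ?thesis using False by simp
        qed
      qed
      finally show ?thesis by simp
    qed
    show ?thesis
    proof (rule ccontr)
      assume "measure lebesgue (Z R) \<noteq> 0"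
      then have pos: "measure lebesgue (Z R) > 0" using measure_nonneg[of lebesgue "Z R"] by linarith
      then obtain N :: nat where N: "real q * measure lebesgue ?B / measure lebesgue (Z R) < real N"
        using reals_Archimedean2 by blast
      moreover have "0 \<le> real q * measure lebesgue ?B / measure lebesgue (Z R)" by simp
      ultimately have "N > 0" by linarith
      then show False using bound[of N] N pos by (simp add: divide_less_eq)
    qed
  qed
  have "AE x in lebesgue. x \<notin> Z (real n)" for n
  proof (rule AE_not_in)
    have "Z (real n) \<in> lmeasurable"
      using Zb by (intro bounded_set_imp_lmeasurable) (auto simp: Z_def)
    then show "Z (real n) \<in> null_sets lebesgue"
      using null[of "real n"] by (auto simp: null_sets_def fmeasurable_def emeasure_eq_ennreal_measure less_top)
  qed
  then have "AE x in lebesgue. \<forall>n. x \<notin> Z (real n)" by (simp add: AE_all_countable)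
  then show ?thesis
  proof eventually_elim
    case (elim x)
    obtain n where "norm x \<le> real n" using real_arch_simple by blast
    then show ?case using elim[rule_format, of n] by (auto simp: Z_def)
  qed
qed

section \<open>Lagrange interpolation on simplices\<close>

text \<open>Newton's basis of the polynomials in the integer variables \<open>t b\<close> for \<open>b \<in> I\<close>.\<close>

definition multi_indices :: "'b set \<Rightarrow> nat \<Rightarrow> ('b \<Rightarrow> nat) set" where
  "multi_indices I q = {\<alpha>. (\<forall>b. b \<notin> I \<longrightarrow> \<alpha> b = 0) \<and> (\<Sum>b\<in>I. \<alpha> b) \<le> q}"

definition newton_basis :: "'b set \<Rightarrow> ('b \<Rightarrow> nat) \<Rightarrow> ('b \<Rightarrow> real) \<Rightarrow> real" where
  "newton_basis I \<alpha> t = (\<Prod>b\<in>I. t b gchoose \<alpha> b)"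

definition newton_span :: "'b set \<Rightarrow> nat \<Rightarrow> (('b \<Rightarrow> real) \<Rightarrow> real) set" where
  "newton_span I q = {g. \<exists>c. g = (\<lambda>t. \<Sum>\<alpha>\<in>multi_indices I q. c \<alpha> * newton_basis I \<alpha> t)}"

lemma finite_multi_indices: "finite I \<Longrightarrow> finite (multi_indices I q)"
proof (rule finite_subset)
  assume I: "finite I"
  show "finite {\<alpha>. \<forall>b. (b \<in> I \<longrightarrow> \<alpha> b \<in> {..q}) \<and> (b \<notin> I \<longrightarrow> \<alpha> b = 0)}"
    by (rule finite_set_of_finite_funs[OF I finite_atMost])
  have "\<alpha> b \<le> q" if "\<alpha> \<in> multi_indices I q" "b \<in> I" for \<alpha> b
    using that member_le_sum[OF that(2), of \<alpha>] I by (auto simp: multi_indices_def)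
  then show "multi_indices I q \<subseteq> {\<alpha>. \<forall>b. (b \<in> I \<longrightarrow> \<alpha> b \<in> {..q}) \<and> (b \<notin> I \<longrightarrow> \<alpha> b = 0)}"
    by (auto simp: multi_indices_def)
qed

lemma newton_span_add:
  assumes "f \<in> newton_span I q" "g \<in> newton_span I q"
  shows "(\<lambda>t. f t + g t) \<in> newton_span I q"
proof -
  obtain c where c: "f = (\<lambda>t. \<Sum>\<alpha>\<in>multi_indices I q. c \<alpha> * newton_basis I \<alpha> t)"
    using assms(1) unfolding newton_span_def by blast
  obtain d where d: "g = (\<lambda>t. \<Sum>\<alpha>\<in>multi_indices I q. d \<alpha> * newton_basis I \<alpha> t)"
    using assms(2) unfolding newton_span_def by blast
  show ?thesis unfolding newton_span_def
    by (intro CollectI exI[of _ "\<lambda>\<alpha>. c \<alpha> + d \<alpha>"]) (simp add: c d distrib_right sum.distrib)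
qed

lemma newton_span_basis:
  assumes "finite I" "\<alpha> \<in> multi_indices I q"
  shows "(\<lambda>t. c * newton_basis I \<alpha> t) \<in> newton_span I q"
proof -
  have "(\<lambda>t. c * newton_basis I \<alpha> t) =
      (\<lambda>t. \<Sum>\<beta>\<in>multi_indices I q. (if \<beta> = \<alpha> then c else 0) * newton_basis I \<beta> t)"
  proof
    fix t
    have "(\<Sum>\<beta>\<in>multi_indices I q. (if \<beta> = \<alpha> then c else 0) * newton_basis I \<beta> t) =
        (\<Sum>\<beta>\<in>multi_indices I q. if \<beta> = \<alpha> then c * newton_basis I \<beta> t else 0)"
      by (intro sum.cong) auto
    then show "c * newton_basis I \<alpha> t =
        (\<Sum>\<beta>\<in>multi_indices I q. (if \<beta> = \<alpha> then c else 0) * newton_basis I \<beta> t)"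
      using assms finite_multi_indices[OF assms(1), of q] by simp
  qed
  then show ?thesis unfolding newton_span_def by (intro CollectI exI)
qed

lemma newton_span_0: "(\<lambda>_. 0) \<in> newton_span I q"
  unfolding newton_span_def by (intro CollectI exI[of _ "\<lambda>_. 0"]) simp

lemma newton_span_sum:
  "(\<And>i. i \<in> J \<Longrightarrow> f i \<in> newton_span I q) \<Longrightarrow> (\<lambda>t. \<Sum>i\<in>J. f i t) \<in> newton_span I q"
  by (induction J rule: infinite_finite_induct) (auto intro: newton_span_add newton_span_0)

lemma newton_span_cmult:
  assumes "f \<in> newton_span I q" shows "(\<lambda>t. a * f t) \<in> newton_span I q"
proof -
  obtain c where c: "f = (\<lambda>t. \<Sum>\<alpha>\<in>multi_indices I q. c \<alpha> * newton_basis I \<alpha> t)"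
    using assms unfolding newton_span_def by blast
  show ?thesis unfolding newton_span_def
    by (intro CollectI exI[of _ "\<lambda>\<alpha>. a * c \<alpha>"]) (simp add: c sum_distrib_left mult.assoc)
qed

lemma newton_span_const:
  assumes "finite I" shows "(\<lambda>_. c) \<in> newton_span I q"
  using newton_span_basis[OF assms, of "\<lambda>_. 0" q c] by (simp add: multi_indices_def newton_basis_def)

lemma newton_span_raise:
  assumes I: "finite I" and f: "f \<in> newton_span I q"
  shows "f \<in> newton_span I (Suc q)"
proof -
  obtain c where c: "f = (\<lambda>t. \<Sum>\<alpha>\<in>multi_indices I q. c \<alpha> * newton_basis I \<alpha> t)"
    using f unfolding newton_span_def by blast
  show ?thesis unfolding c
    by (intro newton_span_sum newton_span_basis I) (auto simp: multi_indices_def)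
qed

text \<open>Multiplication by a variable raises the degree by one, because of
  \<open>t * (t gchoose k) = k * (t gchoose k) + (k + 1) * (t gchoose (k + 1))\<close>.\<close>

lemma newton_span_coordinate:
  assumes I: "finite I" and b: "b \<in> I" and f: "f \<in> newton_span I q"
  shows "(\<lambda>t. f t * t b) \<in> newton_span I (Suc q)"
proof -
  obtain c where c: "f = (\<lambda>t. \<Sum>\<alpha>\<in>multi_indices I q. c \<alpha> * newton_basis I \<alpha> t)"
    using f unfolding newton_span_def by blast
  have step: "newton_basis I \<alpha> t * t b =
      real (\<alpha> b) * newton_basis I \<alpha> t + real (Suc (\<alpha> b)) * newton_basis I (\<alpha>(b := Suc (\<alpha> b))) t" for \<alpha> t
  proof -
    let ?R = "\<Prod>b'\<in>I - {b}. t b' gchoose \<alpha> b'"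
    have 1: "newton_basis I \<alpha> t = (t b gchoose \<alpha> b) * ?R"
      unfolding newton_basis_def using I b by (rule prod.remove)
    have 2: "newton_basis I (\<alpha>(b := Suc (\<alpha> b))) t = (t b gchoose Suc (\<alpha> b)) * ?R"
      unfolding newton_basis_def using I b by (subst prod.remove[of _ b]) (auto intro!: prod.cong)
    have "newton_basis I \<alpha> t * t b = (t b * (t b gchoose \<alpha> b)) * ?R" unfolding 1 by simp
    also have "\<dots> = (real (\<alpha> b) * (t b gchoose \<alpha> b) + real (Suc (\<alpha> b)) * (t b gchoose Suc (\<alpha> b))) * ?R"
      by (simp only: gbinomial_mult_1)
    finally show ?thesis unfolding 1 2 by (simp only: distrib_right mult.assoc)
  qed
  have "(\<lambda>t. f t * t b) = (\<lambda>t. \<Sum>\<alpha>\<in>multi_indices I q. (c \<alpha> * real (\<alpha> b)) * newton_basis I \<alpha> t +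
      (c \<alpha> * real (Suc (\<alpha> b))) * newton_basis I (\<alpha>(b := Suc (\<alpha> b))) t)"
    unfolding c sum_distrib_right mult.assoc step distrib_left ..
  also have "\<dots> \<in> newton_span I (Suc q)"
  proof (intro newton_span_sum newton_span_add newton_span_basis I)
    fix \<alpha> assume \<alpha>: "\<alpha> \<in> multi_indices I q"
    then show "\<alpha> \<in> multi_indices I (Suc q)" by (auto simp: multi_indices_def)
    have "(\<Sum>b'\<in>I. (\<alpha>(b := Suc (\<alpha> b))) b') = Suc (\<Sum>b'\<in>I. \<alpha> b')"
      using I b by (subst (1 2) sum.remove[of _ b]) (auto intro!: sum.cong)
    then show "\<alpha>(b := Suc (\<alpha> b)) \<in> multi_indices I (Suc q)"
      using \<alpha> b by (auto simp: multi_indices_def)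
  qed
  finally show ?thesis .
qed

lemma polynomial_affine_newton_span:
  assumes I: "finite I" and P: "P \<in> polynomials q"
  shows "(\<lambda>t. P (z + (\<Sum>b\<in>I. t b *\<^sub>R v b))) \<in> newton_span I q"
  using P
proof (induction rule: polynomials_induct)
  case (const c) show ?case by (rule newton_span_const[OF I])
next
  case (add q f g) then show ?case by (rule newton_span_add)
next
  case (coordinate q f e)
  let ?x = "\<lambda>t. z + (\<Sum>b\<in>I. t b *\<^sub>R v b)"
  have "(\<lambda>t. f (?x t) * (?x t \<bullet> e)) =
      (\<lambda>t. (z \<bullet> e) * f (?x t) + (\<Sum>b\<in>I. (v b \<bullet> e) * (f (?x t) * t b)))"
    by (rule ext) (simp add: inner_add_left inner_sum_left distrib_left sum_distrib_left sum_distrib_right mult_ac)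
  also have "\<dots> \<in> newton_span I (Suc q)"
    by (intro newton_span_add newton_span_sum newton_span_cmult newton_span_raise[OF I coordinate(1)]
        newton_span_coordinate[OF I _ coordinate(1)])
  finally show ?case .
next
  case (raise q f) then show ?case by (intro newton_span_raise[OF I])
qed

text \<open>At integer points Newton's basis is triangular with unit diagonal.\<close>

lemma newton_basis_integer:
  assumes I: "finite I" and \<alpha>: "\<And>b. b \<notin> I \<Longrightarrow> \<alpha> b = 0" and \<beta>: "\<And>b. b \<notin> I \<Longrightarrow> \<beta> b = 0"
    and le: "(\<Sum>b\<in>I. \<beta> b) \<le> (\<Sum>b\<in>I. \<alpha> b)"
  shows "newton_basis I \<alpha> (\<lambda>b. real (\<beta> b)) = (if \<alpha> = \<beta> then 1 else 0)"
proof (cases "\<alpha> = \<beta>")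
  case True
  then show ?thesis by (simp add: newton_basis_def binomial_gbinomial[symmetric])
next
  case False
  have "\<exists>b\<in>I. \<beta> b < \<alpha> b"
  proof (rule ccontr)
    assume "\<not> ?thesis"
    then have ge: "\<And>b. b \<in> I \<Longrightarrow> \<alpha> b \<le> \<beta> b" by force
    then have "(\<Sum>b\<in>I. \<alpha> b) = (\<Sum>b\<in>I. \<beta> b)" using le sum_mono[of I \<alpha> \<beta>] by simp
    then have "\<alpha> b = \<beta> b" if "b \<in> I" for b
      using that sum_strict_mono_ex1[OF I, of \<alpha> \<beta>] ge by (metis le_neq_implies_less less_irrefl)
    then have "\<alpha> = \<beta>" using \<alpha> \<beta> by (metis ext)
    then show False using False by simp
  qed
  then obtain b where b: "b \<in> I" "\<beta> b < \<alpha> b" by blast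
  then have "(real (\<beta> b) gchoose \<alpha> b) = 0" by (simp add: binomial_gbinomial[symmetric])
  then show ?thesis using False I b(1) unfolding newton_basis_def by (auto intro!: prod_zero)
qed

lemma newton_span_eq_0:
  assumes I: "finite I" and g: "g \<in> newton_span I q"
    and zero: "\<And>\<beta>. \<beta> \<in> multi_indices I q \<Longrightarrow> g (\<lambda>b. real (\<beta> b)) = 0"
  shows "g t = 0"
proof -
  obtain c where c: "g = (\<lambda>t. \<Sum>\<alpha>\<in>multi_indices I q. c \<alpha> * newton_basis I \<alpha> t)"
    using g unfolding newton_span_def by blast
  have "c \<beta> = 0" if "\<beta> \<in> multi_indices I q" for \<beta>
    using that
  proof (induction "\<Sum>b\<in>I. \<beta> b" arbitrary: \<beta> rule: less_induct)
    case less
    have "c \<alpha> * newton_basis I \<alpha> (\<lambda>b. real (\<beta> b)) = (if \<alpha> = \<beta> then c \<beta> else 0)"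
      if \<alpha>: "\<alpha> \<in> multi_indices I q" for \<alpha>
    proof (cases "(\<Sum>b\<in>I. \<alpha> b) < (\<Sum>b\<in>I. \<beta> b)")
      case True
      then have "c \<alpha> = 0" by (rule less(1)[OF _ \<alpha>])
      then show ?thesis using True by auto
    next
      case False
      then show ?thesis
        using \<alpha> less(2) by (subst newton_basis_integer[OF I]) (auto simp: multi_indices_def)
    qed
    then have "g (\<lambda>b. real (\<beta> b)) = (\<Sum>\<alpha>\<in>multi_indices I q. if \<alpha> = \<beta> then c \<beta> else 0)"
      unfolding c by (intro sum.cong) auto
    also have "\<dots> = c \<beta>" using less(2) finite_multi_indices[OF I] by simp
    finally show ?case using zero[OF less(2)] by simp
  qed
  then show ?thesis unfolding c by simp
qed

definition simplex_nodes :: "nat \<Rightarrow> 'a::euclidean_space set \<Rightarrow> 'a set" where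
  "simplex_nodes p V = {\<Sum>b\<in>V. (real (k b) / real p) *\<^sub>R b | k. (\<Sum>b\<in>V. k b) = p}"

lemma lagrange_nodes_eq: "lagrange_nodes p K = simplex_nodes p (vertices K)"
  by (simp add: lagrange_nodes_def simplex_nodes_def)

lemma simplex_nodes_subset:
  assumes "finite V" "F \<subseteq> V"
  shows "simplex_nodes p F \<subseteq> simplex_nodes p V"
proof
  fix y assume "y \<in> simplex_nodes p F"
  then obtain k where k: "y = (\<Sum>b\<in>F. (real (k b) / real p) *\<^sub>R b)" "(\<Sum>b\<in>F. k b) = p"
    unfolding simplex_nodes_def by blast
  let ?k = "\<lambda>b. if b \<in> F then k b else 0"
  have "y = (\<Sum>b\<in>V. (real (?k b) / real p) *\<^sub>R b)" unfolding k(1)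
    using assms by (intro sum.mono_neutral_cong_left) auto
  moreover have "(\<Sum>b\<in>V. ?k b) = p" unfolding k(2)[symmetric]
    using assms by (intro sum.mono_neutral_cong_right) auto
  ultimately show "y \<in> simplex_nodes p V"
    unfolding simplex_nodes_def by (intro CollectI exI[of _ ?k] conjI)
qed

lemma simplex_nodes_subset_hull:
  assumes "finite V" "p \<ge> 1"
  shows "simplex_nodes p V \<subseteq> convex hull V"
proof
  fix y assume "y \<in> simplex_nodes p V"
  then obtain k where k: "y = (\<Sum>b\<in>V. (real (k b) / real p) *\<^sub>R b)" "(\<Sum>b\<in>V. k b) = p"
    unfolding simplex_nodes_def by blast
  have "(\<Sum>b\<in>V. real (k b) / real p) = 1"
    using assms(2) k(2) by (simp add: sum_divide_distrib[symmetric] of_nat_sum[symmetric] del: of_nat_sum)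
  then show "y \<in> convex hull V"
    unfolding convex_hull_finite[OF assms(1)] k(1)
    by (intro CollectI exI[of _ "\<lambda>b. real (k b) / real p"]) auto
qed

text \<open>In barycentric coordinates scaled by \<open>p\<close>, the nodes are the integer points at which the
  coefficients in Newton's basis can be read off. The vertices may be those of a face of a larger
  simplex, on which the polynomial is then determined by the nodes of this face.\<close>

lemma polynomial_eq_0_if_nodes:
  fixes P :: "'a::euclidean_space \<Rightarrow> real"
  assumes V: "finite V" and p: "p \<ge> 1" and P: "P \<in> polynomials p"
    and zero: "\<And>y. y \<in> simplex_nodes p V \<Longrightarrow> P y = 0" and x: "x \<in> convex hull V"
  shows "P x = 0"
proof -
  obtain u where u: "(\<Sum>b\<in>V. u b) = 1" "x = (\<Sum>b\<in>V. u b *\<^sub>R b)"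
    using x unfolding convex_hull_finite[OF V] by blast
  then obtain a where a: "a \<in> V" by (metis sum.empty zero_neq_one ex_in_conv)
  define I where "I = V - {a}"
  have I: "finite I" using V by (simp add: I_def)
  let ?x = "\<lambda>t. a + (\<Sum>b\<in>I. t b *\<^sub>R ((1 / real p) *\<^sub>R (b - a)))"
  have point: "?x t = (\<Sum>b\<in>V. (s b / real p) *\<^sub>R b)"
    if s: "\<And>b. b \<in> I \<Longrightarrow> s b = t b" "(\<Sum>b\<in>V. s b) = real p" for s t
  proof -
    have V_sum: "(\<Sum>b\<in>V. h b) = h a + (\<Sum>b\<in>I. h b)" for h :: "'a \<Rightarrow> 'b::comm_monoid_add"
      unfolding I_def by (rule sum.remove[OF V a])
    have "s a = real p - (\<Sum>b\<in>I. s b)" using s(2) unfolding V_sum by simp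
    then have "(s a / real p) *\<^sub>R a = a - (\<Sum>b\<in>I. (s b / real p) *\<^sub>R a)"
      using p by (simp add: diff_divide_distrib scaleR_left_diff_distrib sum_divide_distrib scaleR_left.sum)
    then have "(\<Sum>b\<in>V. (s b / real p) *\<^sub>R b) = a + (\<Sum>b\<in>I. (s b / real p) *\<^sub>R b - (s b / real p) *\<^sub>R a)"
      unfolding V_sum by (simp add: sum_subtractf)
    also have "(\<Sum>b\<in>I. (s b / real p) *\<^sub>R b - (s b / real p) *\<^sub>R a) = (\<Sum>b\<in>I. t b *\<^sub>R ((1 / real p) *\<^sub>R (b - a)))"
      by (intro sum.cong refl) (simp add: s scaleR_right_diff_distrib)
    finally show ?thesis by simp
  qed
  have "P (?x t) = 0" for t
  proof (rule newton_span_eq_0[OF I, of "\<lambda>t. P (?x t)" p])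
    show "(\<lambda>t. P (?x t)) \<in> newton_span I p" by (rule polynomial_affine_newton_span[OF I P])
    fix \<beta> assume \<beta>: "\<beta> \<in> multi_indices I p"
    \<comment> \<open>the weight of \<open>a\<close> fills up the total to \<open>p\<close>; it is nonnegative as \<open>\<beta>\<close> has degree at most \<open>p\<close>\<close>
    let ?k = "\<beta>(a := p - (\<Sum>b\<in>I. \<beta> b))"
    have "(\<Sum>b\<in>V. ?k b) = ?k a + (\<Sum>b\<in>I. ?k b)" unfolding I_def by (rule sum.remove[OF V a])
    also have "(\<Sum>b\<in>I. ?k b) = (\<Sum>b\<in>I. \<beta> b)" by (intro sum.cong) (auto simp: I_def)
    finally have k: "(\<Sum>b\<in>V. ?k b) = p" using \<beta> by (simp add: multi_indices_def)
    have "?x (\<lambda>b. real (\<beta> b)) = (\<Sum>b\<in>V. (real (?k b) / real p) *\<^sub>R b)"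
    proof (rule point)
      show "real (?k b) = real (\<beta> b)" if "b \<in> I" for b using that by (auto simp: I_def)
      show "(\<Sum>b\<in>V. real (?k b)) = real p" using k by (simp only: of_nat_sum[symmetric])
    qed
    then have "?x (\<lambda>b. real (\<beta> b)) \<in> simplex_nodes p V"
      unfolding simplex_nodes_def using k by blast
    then show "P (?x (\<lambda>b. real (\<beta> b))) = 0" by (rule zero)
  qed
  moreover have "?x (\<lambda>b. real p * u b) = x"
    unfolding u(2) using p u(1)
    by (subst point[of "\<lambda>b. real p * u b"]) (auto simp: sum_distrib_left[symmetric])
  ultimately show ?thesis by metis
qed

lemma polynomials_eq_if_nodes:
  fixes P Q :: "'a::euclidean_space \<Rightarrow> real"
  assumes "finite V" "p \<ge> 1" "P \<in> polynomials p" "Q \<in> polynomials p"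
    and "\<And>y. y \<in> simplex_nodes p V \<Longrightarrow> P y = Q y" "x \<in> convex hull V"
  shows "P x = Q x"
  using polynomial_eq_0_if_nodes[OF assms(1,2) polynomials_diff[OF assms(3,4)] _ assms(6)] assms(5) by simp

lemma affine_function_exists:
  fixes V :: "'a::euclidean_space set"
  assumes V: "\<not> affine_dependent V" and b: "b \<in> V"
  shows "\<exists>c w. \<forall>v\<in>V. c + v \<bullet> w = (if v = b then 1 else 0)"
proof -
  have ind: "independent ((\<lambda>x. - b + x) ` (V - {b}))"
    using V affine_dependent_iff_dependent2[OF b] by blast
  obtain g :: "'a \<Rightarrow> real" where g: "linear g" "\<forall>x\<in>(\<lambda>x. - b + x) ` (V - {b}). g x = -1"
    using linear_independent_extend[OF ind, of "\<lambda>_. -1"] by blast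
  define w where "w = (\<Sum>e\<in>Basis. g e *\<^sub>R e)"
  have gw: "g x = x \<bullet> w" for x
  proof -
    have "g x = g (\<Sum>e\<in>Basis. (x \<bullet> e) *\<^sub>R e)" by (simp add: euclidean_representation)
    also have "\<dots> = (\<Sum>e\<in>Basis. (x \<bullet> e) * g e)"
      by (simp add: linear_sum[OF g(1)] linear_scale[OF g(1)])
    finally show ?thesis by (simp add: w_def inner_sum_right mult.commute)
  qed
  have "(1 - b \<bullet> w) + v \<bullet> w = (if v = b then 1 else 0)" if "v \<in> V" for v
  proof (cases "v = b")
    case False
    then have "g (- b + v) = -1" using g(2) that by blast
    then show ?thesis using False by (simp add: gw inner_diff_left)
  qed simp
  then show ?thesis by blast
qed

definition barycentric :: "'a::euclidean_space set \<Rightarrow> 'a \<Rightarrow> 'a \<Rightarrow> real" where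
  "barycentric V b = (SOME f. (\<exists>c w. f = (\<lambda>x. c + x \<bullet> w)) \<and> (\<forall>v\<in>V. f v = (if v = b then 1 else 0)))"

lemma barycentric:
  assumes "\<not> affine_dependent V" "b \<in> V"
  obtains c w where "barycentric V b = (\<lambda>x. c + x \<bullet> w)" "\<And>v. v \<in> V \<Longrightarrow> barycentric V b v = (if v = b then 1 else 0)"
proof -
  have "\<exists>f. (\<exists>c w. f = (\<lambda>x. c + x \<bullet> w)) \<and> (\<forall>v\<in>V. f v = (if v = b then 1 else 0))"
    using affine_function_exists[OF assms] by blast
  then have "(\<exists>c w. barycentric V b = (\<lambda>x. c + x \<bullet> w)) \<and> (\<forall>v\<in>V. barycentric V b v = (if v = b then 1 else 0))"
    unfolding barycentric_def by (rule someI_ex)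
  then show ?thesis using that by blast
qed

lemma barycentric_polynomial: "\<not> affine_dependent V \<Longrightarrow> b \<in> V \<Longrightarrow> barycentric V b \<in> polynomials 1"
proof (erule barycentric, assumption)
  fix c w assume "barycentric V b = (\<lambda>x. c + x \<bullet> w)"
  then show "barycentric V b \<in> polynomials 1"
    by (simp only:) (intro polynomials_add polynomials_const polynomials_inner)
qed

lemma barycentric_combination:
  assumes "\<not> affine_dependent V" "b \<in> V" "finite V" "(\<Sum>v\<in>V. u v) = 1"
  shows "barycentric V b (\<Sum>v\<in>V. u v *\<^sub>R v) = u b"
proof -
  obtain c w where cw: "barycentric V b = (\<lambda>x. c + x \<bullet> w)" "\<And>v. v \<in> V \<Longrightarrow> barycentric V b v = (if v = b then 1 else 0)"
    by (rule barycentric[OF assms(1,2)]) blast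
  have "barycentric V b (\<Sum>v\<in>V. u v *\<^sub>R v) = c * (\<Sum>v\<in>V. u v) + (\<Sum>v\<in>V. u v * (v \<bullet> w))"
    unfolding cw(1) assms(4) by (simp add: inner_sum_left)
  also have "\<dots> = (\<Sum>v\<in>V. u v * barycentric V b v)"
    unfolding cw(1) by (simp add: sum_distrib_left sum.distrib distrib_left mult.commute)
  also have "\<dots> = (\<Sum>v\<in>V. if v = b then u v else 0)"
    by (intro sum.cong refl) (simp add: cw(2))
  also have "\<dots> = u b" using assms by simp
  finally show ?thesis .
qed

lemma gchoose_polynomial:
  assumes "f \<in> polynomials 1"
  shows "(\<lambda>x. f x gchoose k) \<in> polynomials k"
proof -
  have "(\<lambda>x. \<Prod>i<k. f x - real i) \<in> polynomials (\<Sum>i<k. 1)"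
    by (intro polynomials_prod polynomials_diff assms polynomials_const)
  then have "(\<lambda>x. inverse (fact k) * (\<Prod>i<k. f x - real i)) \<in> polynomials k"
    by (intro polynomials_cmult) simp
  moreover have "(f x gchoose k) = inverse (fact k) * (\<Prod>i<k. f x - real i)" for x
    by (simp add: gbinomial_prod_rev divide_inverse mult.commute atLeast0LessThan)
  ultimately show ?thesis by simp
qed

text \<open>The products of binomial coefficients of the scaled barycentric coordinates are the Lagrange
  basis.\<close>

lemma lagrange_interpolant_exists:
  fixes V :: "'a::euclidean_space set"
  assumes V: "\<not> affine_dependent V" "finite V" and p: "p \<ge> 1"
  shows "\<exists>P\<in>polynomials p. \<forall>y\<in>simplex_nodes p V. P y = f y"
proof -
  define node where "node k = (\<Sum>b\<in>V. (real (k b) / real p) *\<^sub>R b)" for k :: "'a \<Rightarrow> nat"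
  define M where "M = {k \<in> multi_indices V p. (\<Sum>b\<in>V. k b) = p}"
  have M: "finite M" unfolding M_def using finite_multi_indices[OF V(2)] by simp
  define P where "P x = (\<Sum>k\<in>M. f (node k) * newton_basis V k (\<lambda>b. real p * barycentric V b x))" for x
  have "P \<in> polynomials p"
    unfolding P_def[abs_def]
  proof (intro polynomials_sum polynomials_cmult)
    fix k assume "k \<in> M"
    then have k: "(\<Sum>b\<in>V. k b) = p" by (simp add: M_def)
    have "(\<lambda>x. \<Prod>b\<in>V. real p * barycentric V b x gchoose k b) \<in> polynomials (\<Sum>b\<in>V. k b)"
      by (intro polynomials_prod gchoose_polynomial polynomials_cmult barycentric_polynomial V)
    then show "(\<lambda>x. newton_basis V k (\<lambda>b. real p * barycentric V b x)) \<in> polynomials p"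
      unfolding newton_basis_def k .
  qed
  moreover have "P y = f y" if y: "y \<in> simplex_nodes p V" for y
  proof -
    obtain k0 where k0: "y = node k0" "(\<Sum>b\<in>V. k0 b) = p"
      using y unfolding simplex_nodes_def node_def by blast
    define m where "m b = (if b \<in> V then k0 b else 0)" for b
    have m: "m \<in> M" "y = node m"
      using k0 unfolding M_def multi_indices_def m_def node_def by (auto intro: sum.cong)
    have bc: "real p * barycentric V b y = real (m b)" if "b \<in> V" for b
    proof -
      have "(\<Sum>b\<in>V. real (m b) / real p) = 1"
        using m(1) p by (simp add: M_def sum_divide_distrib[symmetric] of_nat_sum[symmetric] del: of_nat_sum)
      then have "barycentric V b y = real (m b) / real p"
        unfolding m(2) node_def by (intro barycentric_combination V that)
      then show ?thesis using p by simp
    qed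
    have "newton_basis V k (\<lambda>b. real p * barycentric V b y) = (if k = m then 1 else 0)" if "k \<in> M" for k
    proof -
      have "newton_basis V k (\<lambda>b. real p * barycentric V b y) = newton_basis V k (\<lambda>b. real (m b))"
        unfolding newton_basis_def by (intro prod.cong refl) (simp add: bc)
      also have "\<dots> = (if k = m then 1 else 0)"
        using that m(1) by (intro newton_basis_integer V) (auto simp: M_def multi_indices_def)
      finally show ?thesis .
    qed
    then have "P y = (\<Sum>k\<in>M. if k = m then f (node m) else 0)"
      unfolding P_def by (intro sum.cong refl) auto
    also have "\<dots> = f y" using M m by simp
    finally show ?thesis .
  qed
  ultimately show ?thesis by blast
qed

section \<open>Matching simplicial meshes\<close>

lemma open_simplex_vertices:
  fixes K :: "'a::euclidean_space set"
  assumes "open_simplex K"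
  shows "\<not> affine_dependent (vertices K)" "finite (vertices K)" "closure K = convex hull vertices K"
    "open K" "K \<noteq> {}" "convex K" "bounded K" "compact (closure K)"
proof -
  obtain S where S: "int DIM('a) simplex S" "K = interior S"
    using assms unfolding open_simplex_def by blast
  obtain C where C: "\<not> affine_dependent C" "S = convex hull C" "finite C"
    using S(1) unfolding simplex by blast
  have conv: "convex S" and comp: "compact S" unfolding C(2) using C(3) by (auto intro: finite_imp_compact_convex_hull)
  have "affine hull S = UNIV"
    using aff_dim_simplex[OF S(1)] by (simp add: aff_dim_eq_full)
  then have "rel_interior S = interior S" by (rule rel_interior_interior)
  moreover have "S \<noteq> {}" using \<open>affine hull S = UNIV\<close> by (metis affine_hull_empty UNIV_not_empty)
  ultimately have ne: "interior S \<noteq> {}" using rel_interior_eq_empty[OF conv] by metis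
  have cl: "closure K = S"
    using convex_closure_interior[OF conv ne] compact_imp_closed[OF comp] S(2) by simp
  have V: "vertices K = C"
    unfolding vertices_def cl C(2) using extreme_point_of_convex_hull_affine_independent[OF C(1)] by blast
  show "\<not> affine_dependent (vertices K)" "finite (vertices K)" "closure K = convex hull vertices K"
    "open K" "K \<noteq> {}" "convex K" "compact (closure K)"
    using C S(2) ne conv comp cl V by (auto intro: convex_interior)
  then show "bounded K" by (meson bounded_subset closure_subset compact_imp_bounded)
qed

locale mesh =
  fixes \<Omega> :: "'a::euclidean_space set" and \<T> :: "'a set set"
  assumes matching: "matching_mesh \<Omega> \<T>"
begin

lemma finite_elements: "finite \<T>"
  using matching by (simp add: matching_mesh_def)

lemma element:
  assumes "K \<in> \<T>"
  shows "\<not> affine_dependent (vertices K)" "finite (vertices K)" "closure K = convex hull vertices K"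
    "open K" "K \<noteq> {}" "convex K" "bounded K" "compact (closure K)"
  using open_simplex_vertices[of K] assms matching by (auto simp: matching_mesh_def)

lemma element_subset: "K \<in> \<T> \<Longrightarrow> K \<subseteq> \<Omega>"
  using matching by (simp add: matching_mesh_def)

lemma closure_domain: "closure \<Omega> = (\<Union>K\<in>\<T>. closure K)"
  using matching by (simp add: matching_mesh_def)

lemma elements_disjoint: "K \<in> \<T> \<Longrightarrow> K' \<in> \<T> \<Longrightarrow> x \<in> K \<Longrightarrow> x \<in> closure K' \<Longrightarrow> K = K'"
proof (rule ccontr)
  assume K: "K \<in> \<T>" "K' \<in> \<T>" "x \<in> K" "x \<in> closure K'" "K \<noteq> K'"
  then have "K \<inter> K' = {}"
    using matching by (auto simp: matching_mesh_def pairwise_def disjnt_def)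
  then have "K \<inter> closure K' = {}" using element(4)[OF K(1)] by (simp add: open_Int_closure_eq_empty)
  then show False using K by blast
qed

lemma common_face:
  assumes "K \<in> \<T>" "K' \<in> \<T>" "x \<in> closure K" "x \<in> closure K'"
  shows "closure K \<inter> closure K' face_of closure K" "closure K \<inter> closure K' face_of closure K'"
proof -
  have "closure K \<inter> closure K' face_of closure K \<and> closure K \<inter> closure K' face_of closure K'"
  proof (cases "K = K'")
    case True
    then show ?thesis using element(6)[OF assms(1)] by (simp add: face_of_refl convex_closure)
  next
    case False
    then show ?thesis using matching assms unfolding matching_mesh_def by blast
  qed
  then show "closure K \<inter> closure K' face_of closure K" "closure K \<inter> closure K' face_of closure K'" by auto
qed

lemma common_face_hull:
  assumes "K \<in> \<T>" "K' \<in> \<T>" "x \<in> closure K" "x \<in> closure K'"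
  obtains c where "c \<subseteq> vertices K" "c \<subseteq> vertices K'" "x \<in> convex hull c"
proof -
  let ?F = "closure K \<inter> closure K'"
  let ?c = "{z. z extreme_point_of ?F}"
  note faces = common_face[OF assms]
  have "compact ?F" using element(8)[OF assms(1)] by (intro compact_Int_closed) auto
  moreover have "convex ?F" using assms element(6) by (auto intro: convex_Int convex_closure)
  ultimately have "?F = convex hull ?c" by (rule Krein_Milman_Minkowski)
  then have "x \<in> convex hull ?c" using assms by blast
  moreover have "?c \<subseteq> vertices K"
    unfolding vertices_def by (rule Collect_mono) (simp add: extreme_point_of_face[OF faces(1)])
  moreover have "?c \<subseteq> vertices K'"
    unfolding vertices_def by (rule Collect_mono) (simp add: extreme_point_of_face[OF faces(2)])
  ultimately show ?thesis by (intro that)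
qed

lemma common_vertex:
  assumes "K \<in> \<T>" "K' \<in> \<T>" "a \<in> vertices K" "a \<in> closure K'"
  shows "a \<in> vertices K'"
proof -
  have a: "a extreme_point_of closure K" using assms(3) by (simp add: vertices_def)
  then have "a \<in> closure K" by (simp add: extreme_point_of_def)
  note faces = common_face[OF assms(1,2) this assms(4)]
  have "a extreme_point_of closure K \<inter> closure K'"
    using extreme_point_of_face[OF faces(1)] a \<open>a \<in> closure K\<close> assms(4) by blast
  then show ?thesis using extreme_point_of_face[OF faces(2)] by (simp add: vertices_def)
qed

text \<open>The common face is spanned by common vertices, so that its nodes are nodes of both elements. This is what makes nodewise operations preserve continuity.\<close>

lemma agree_on_common_face:
  assumes "K \<in> \<T>" "K' \<in> \<T>" "x \<in> closure K" "x \<in> closure K'" and "p \<ge> 1"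
    and "P \<in> polynomials p" "Q \<in> polynomials p"
    and eq: "\<And>y. y \<in> simplex_nodes p (vertices K) \<Longrightarrow> y \<in> simplex_nodes p (vertices K') \<Longrightarrow> P y = Q y"
  shows "P x = Q x"
proof -
  obtain c where c: "c \<subseteq> vertices K" "c \<subseteq> vertices K'" "x \<in> convex hull c"
    by (rule common_face_hull[OF assms(1-4)])
  have "finite c" using c(1) element(2)[OF assms(1)] by (rule finite_subset)
  then show ?thesis
    using simplex_nodes_subset[OF element(2)[OF assms(1)] c(1)] simplex_nodes_subset[OF element(2)[OF assms(2)] c(2)]
    by (intro polynomials_eq_if_nodes[OF _ assms(5-7) _ c(3)] eq) auto
qed

lemma polynomials_eq_if_element_nodes:
  assumes K: "K \<in> \<T>" and "p \<ge> 1" and P: "P \<in> polynomials p" and Q: "Q \<in> polynomials p"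
    and eq: "\<And>y. y \<in> simplex_nodes p (vertices K) \<Longrightarrow> P y = Q y"
  shows "P = Q"
proof
  fix x
  obtain z where z: "z \<in> K" using element(5)[OF K] by blast
  have "P y - Q y = 0" if "y \<in> K" for y
    using polynomials_eq_if_nodes[OF element(2)[OF K] assms(2) P Q eq, of y] that
      element(3)[OF K] closure_subset[of K] by auto
  then have "P x - Q x = 0"
    by (rule polynomial_eq_0_if_open[OF polynomials_diff[OF P Q] element(4)[OF K] z])
  then show "P x = Q x" by simp
qed

lemma simplex_nodes_1_vertices:
  assumes "finite V" "y \<in> simplex_nodes 1 V" shows "y \<in> V"
proof -
  obtain k where k: "y = (\<Sum>b\<in>V. (real (k b) / real 1) *\<^sub>R b)" "(\<Sum>b\<in>V. k b) = 1"
    using assms(2) unfolding simplex_nodes_def by blast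
  obtain b where b: "b \<in> V" "k b = 1" "\<And>c. c \<in> V \<Longrightarrow> c \<noteq> b \<Longrightarrow> k c = 0"
    using k(2) sum_eq_1_iff[OF assms(1), of k] by auto
  have "y = (\<Sum>c\<in>V. if c = b then b else 0)"
    unfolding k(1) using b by (intro sum.cong) auto
  then show ?thesis using b(1) assms(1) by simp
qed

text \<open>On common faces the choice of the element will not matter; the value zero elsewhere is that of the
  extension by zero.\<close>

definition glue :: "'a set set \<Rightarrow> ('a set \<Rightarrow> 'a \<Rightarrow> real) \<Rightarrow> 'a \<Rightarrow> real" where
  "glue A W x = (if \<exists>K\<in>A. x \<in> closure K then W (SOME K. K \<in> A \<and> x \<in> closure K) x else 0)"

lemma glue_eq:
  assumes "\<And>K K' x. K \<in> A \<Longrightarrow> K' \<in> A \<Longrightarrow> x \<in> closure K \<Longrightarrow> x \<in> closure K' \<Longrightarrow> W K x = W K' x"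
    and "K \<in> A" "x \<in> closure K"
  shows "glue A W x = W K x"
proof -
  let ?K = "SOME K. K \<in> A \<and> x \<in> closure K"
  have "?K \<in> A \<and> x \<in> closure ?K" by (rule someI[of _ K]) (simp add: assms(2,3))
  then have "W ?K x = W K x" using assms(1)[of ?K K x] assms(2,3) by simp
  moreover have "glue A W x = W ?K x"
    unfolding glue_def by (rule if_P) (use assms(2,3) in blast)
  ultimately show ?thesis by simp
qed

lemma glue_outside: "(\<And>K. K \<in> A \<Longrightarrow> x \<notin> closure K) \<Longrightarrow> glue A W x = 0"
  by (auto simp: glue_def)

lemma continuous_on_elements:
  assumes "A \<subseteq> \<T>" "\<And>K. K \<in> A \<Longrightarrow> continuous_on (closure K) (W K)"
    and "\<And>K x. K \<in> A \<Longrightarrow> x \<in> closure K \<Longrightarrow> f x = W K x"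
  shows "continuous_on (\<Union>K\<in>A. closure K) f"
proof (rule continuous_on_closed_Union)
  show "finite A" using assms(1) finite_elements finite_subset by blast
  show "continuous_on (closure K) f" if "K \<in> A" for K
    using assms(2)[OF that] assms(3)[OF that] by (metis continuous_on_cong)
qed auto

subsection \<open>Hat functions\<close>

definition hat_poly :: "'a \<Rightarrow> 'a set \<Rightarrow> 'a \<Rightarrow> real" where
  "hat_poly a K = (if a \<in> vertices K then barycentric (vertices K) a else (\<lambda>_. 0))"

lemma hat_poly_polynomial: "K \<in> \<T> \<Longrightarrow> hat_poly a K \<in> polynomials 1"
  unfolding hat_poly_def using barycentric_polynomial[OF element(1)] polynomials_const by auto

lemma hat_poly_vertex: "K \<in> \<T> \<Longrightarrow> b \<in> vertices K \<Longrightarrow> hat_poly a K b = (if b = a then 1 else 0)"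
  by (auto simp: hat_poly_def intro: barycentric[OF element(1), of K a])

lemma hat_poly_agree:
  assumes "K \<in> \<T>" "K' \<in> \<T>" "x \<in> closure K" "x \<in> closure K'"
  shows "hat_poly a K x = hat_poly a K' x"
proof (rule agree_on_common_face[OF assms, of 1])
  fix y assume "y \<in> simplex_nodes 1 (vertices K)" "y \<in> simplex_nodes 1 (vertices K')"
  then show "hat_poly a K y = hat_poly a K' y"
    using hat_poly_vertex assms(1,2) simplex_nodes_1_vertices element(2) by metis
qed (rule order_refl hat_poly_polynomial[OF assms(1)] hat_poly_polynomial[OF assms(2)])+

text \<open>Barycentric coordinates agree on common faces, since they do at the vertices, and glue to a
  continuous function. Conversely, an affine function on an element is determined by its values at
  the vertices.\<close>

lemma hat_function_eq:
  assumes K: "K \<in> \<T>" "x \<in> closure K"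
  shows "hat_function \<T> a x = hat_poly a K x"
proof -
  let ?\<psi> = "glue \<T> (hat_poly a)"
  have eq: "?\<psi> y = hat_poly a K y" if "K \<in> \<T>" "y \<in> closure K" for K y
    by (rule glue_eq[OF hat_poly_agree that])
  have vert: "b \<in> closure K" if "b \<in> vertices K" for b K
    using that by (simp add: vertices_def extreme_point_of_def)
  have "hat_function \<T> a = ?\<psi>"
    unfolding hat_function_def
  proof (rule the_equality, intro conjI allI ballI impI)
    show "continuous_on (\<Union>K\<in>\<T>. closure K) ?\<psi>"
      by (rule continuous_on_elements[OF subset_refl _ eq])
        (auto intro: smooth_fun_continuous smooth_fun_polynomial hat_poly_polynomial)
    show "?\<psi> \<in> broken_polynomials 1 \<T>"
      unfolding broken_polynomials_def using eq hat_poly_polynomial closure_subset by blast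
    show "?\<psi> b = (if b = a then 1 else 0)" if "b \<in> mesh_vertices \<T>" for b
    proof -
      from that obtain K where K: "K \<in> \<T>" "b \<in> vertices K" unfolding mesh_vertices_def by blast
      then show ?thesis using eq[OF K(1) vert[OF K(2)]] hat_poly_vertex[OF K] by simp
    qed
    show "?\<psi> y = 0" if "y \<notin> (\<Union>K\<in>\<T>. closure K)" for y
      using that by (intro glue_outside) auto
  next
    fix \<psi> assume \<psi>: "continuous_on (\<Union>K\<in>\<T>. closure K) \<psi> \<and> \<psi> \<in> broken_polynomials 1 \<T> \<and>
      (\<forall>b\<in>mesh_vertices \<T>. \<psi> b = (if b = a then 1 else 0)) \<and> (\<forall>x. x \<notin> (\<Union>K\<in>\<T>. closure K) \<longrightarrow> \<psi> x = 0)"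
    have "\<psi> y = hat_poly a K y" if K: "K \<in> \<T>" and y: "y \<in> closure K" for K y
    proof -
      obtain P where P: "P \<in> polynomials 1" "\<And>x. x \<in> K \<Longrightarrow> \<psi> x = P x"
        using \<psi> K unfolding broken_polynomials_def by blast
      have cont: "continuous_on (closure K) (\<lambda>x. \<psi> x - P x)"
      proof (rule continuous_on_diff)
        show "continuous_on (closure K) \<psi>" using \<psi> K by (meson UN_upper continuous_on_subset)
      qed (rule smooth_fun_continuous[OF smooth_fun_polynomial[OF P(1)]])
      have ext: "\<psi> z = P z" if "z \<in> closure K" for z
        using continuous_constant_on_closure[OF cont _ that, of 0] P(2) by simp
      have "P = hat_poly a K"
      proof (rule polynomials_eq_if_element_nodes[OF K le_refl P(1) hat_poly_polynomial[OF K]])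
        fix z assume "z \<in> simplex_nodes 1 (vertices K)"
        then have z: "z \<in> vertices K" by (rule simplex_nodes_1_vertices[OF element(2)[OF K]])
        then have "\<psi> z = (if z = a then 1 else 0)" using \<psi> K unfolding mesh_vertices_def by blast
        then show "P z = hat_poly a K z" using ext[OF vert[OF z]] hat_poly_vertex[OF K z] by simp
      qed
      then show ?thesis using ext[OF y] by simp
    qed
    then show "\<psi> = ?\<psi>"
      using \<psi> eq glue_outside[of \<T> _ "hat_poly a"] by (metis (no_types, lifting) UN_E ext)
  qed
  then show ?thesis using eq[OF K] by simp
qed

lemma hat_poly_sum:
  assumes K: "K \<in> \<T>" and y: "y \<in> closure K"
  shows "(\<Sum>a\<in>vertices K. hat_poly a K y) = 1"
proof -
  obtain u where u: "(\<Sum>b\<in>vertices K. u b) = 1" "y = (\<Sum>b\<in>vertices K. u b *\<^sub>R b)"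
    using y unfolding element(3)[OF K] convex_hull_finite[OF element(2)[OF K]] by blast
  have "hat_poly a K y = u a" if "a \<in> vertices K" for a
    using barycentric_combination[OF element(1)[OF K] that element(2)[OF K] u(1)] that
    by (simp add: hat_poly_def u(2))
  then show ?thesis using u(1) by simp
qed

subsection \<open>Elementwise interpolation and projection\<close>

lemma sum_indicator_elements:
  fixes f :: "'a set \<Rightarrow> real" and g :: "'a set \<Rightarrow> 'b::real_vector"
  assumes "A \<subseteq> \<T>" "K \<in> A" "x \<in> K"
  shows "(\<Sum>K'\<in>A. indicator K' x * f K') = f K" "(\<Sum>K'\<in>A. indicator K' x *\<^sub>R g K') = g K"
proof -
  have fin: "finite A" using assms(1) finite_elements by (rule finite_subset)
  have ind: "indicator K' x = (if K' = K then 1 else 0 :: real)" if "K' \<in> A" for K'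
  proof (cases "K' = K")
    case True
    then show ?thesis using assms(3) by simp
  next
    case False
    have "x \<notin> K'"
      using elements_disjoint[of K K' x] assms(1-3) that closure_subset[of K'] False by blast
    then show ?thesis using False by simp
  qed
  have "(\<Sum>K'\<in>A. indicator K' x * f K') = (\<Sum>K'\<in>A. if K' = K then f K else 0)"
    by (rule sum.cong) (simp_all add: ind)
  then show "(\<Sum>K'\<in>A. indicator K' x * f K') = f K" using assms(2) fin by simp
  have "(\<Sum>K'\<in>A. indicator K' x *\<^sub>R g K') = (\<Sum>K'\<in>A. if K' = K then g K else 0)"
    by (rule sum.cong) (simp_all add: ind)
  then show "(\<Sum>K'\<in>A. indicator K' x *\<^sub>R g K') = g K" using assms(2) fin by simp
qed

lemma at_within_element_nontrivial:
  assumes K: "K \<in> \<T>" and y: "y \<in> closure K"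
  shows "at y within K \<noteq> bot"
proof (cases "y \<in> K")
  case True
  show ?thesis unfolding at_within_open[OF True element(4)[OF K]] by (rule at_neq_bot)
next
  case False
  then show ?thesis using y by (simp add: trivial_limit_within closure_def)
qed

text \<open>By unisolvence, the interpolant on an element is any polynomial with the right nodal values. These
  are limits from inside the element and may thus be read off from a continuous function that agrees
  with the given one there.\<close>

lemma lagrange_interpolation_eq:
  assumes A: "A \<subseteq> \<T>" and p: "p \<ge> 1" and K: "K \<in> A" "x \<in> K" and W: "W \<in> polynomials p"
    and cont: "continuous_on UNIV f" and vf: "\<And>z. z \<in> K \<Longrightarrow> v z = f z"
    and nodes: "\<And>y. y \<in> simplex_nodes p (vertices K) \<Longrightarrow> W y = f y"
  shows "lagrange_interpolation p A v x = W x"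
proof -
  have KT: "K \<in> \<T>" using A K by blast
  have lim: "Lim (at y within K) v = f y" if "y \<in> simplex_nodes p (vertices K)" for y
  proof (rule tendsto_Lim)
    have "y \<in> closure K"
      using simplex_nodes_subset_hull[OF element(2)[OF KT] p] that element(3)[OF KT] by blast
    then show "at y within K \<noteq> bot" by (rule at_within_element_nontrivial[OF KT])
    have "(f \<longlongrightarrow> f y) (at y within K)"
      using cont by (meson UNIV_I continuous_on_def continuous_on_subset subset_UNIV tendsto_within_subset)
    then show "(v \<longlongrightarrow> f y) (at y within K)"
      by (rule Lim_transform_eventually) (auto simp: eventually_at_filter vf intro!: always_eventually)
  qed
  have "(THE P. P \<in> polynomials p \<and> (\<forall>y\<in>lagrange_nodes p K. P y = Lim (at y within K) v)) = W"
    unfolding lagrange_nodes_eq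
  proof (rule the_equality)
    show "W \<in> polynomials p \<and> (\<forall>y\<in>simplex_nodes p (vertices K). W y = Lim (at y within K) v)"
      using W nodes lim by simp
    fix P assume "P \<in> polynomials p \<and> (\<forall>y\<in>simplex_nodes p (vertices K). P y = Lim (at y within K) v)"
    then show "P = W" using W nodes lim by (intro polynomials_eq_if_element_nodes[OF KT p]) auto
  qed
  then show ?thesis
    unfolding lagrange_interpolation_def by (subst sum_indicator_elements(1)[OF A K]) simp
qed

text \<open>The difference of two candidates has zero gradient, by testing with itself, and zero mean.\<close>

lemma local_best_eq:
  assumes K: "K \<in> \<T>" "x \<in> K" and P: "P \<in> polynomials p" and u: "\<And>z. z \<in> K \<Longrightarrow> u z = P z"
  shows "local_best p \<T> u x = P x"
proof -
  note smooth = smooth_fun_polynomial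
  note K' = element[OF K(1)]
  have wg: "has_weak_gradient K Q (grad Q)" "AE x in lebesgue_on K. weak_gradient K Q x = grad Q x"
    if "Q \<in> polynomials p" for Q
    using has_weak_gradient_smooth[OF K'(4,7) smooth[OF that]] weak_gradient_AE_eq[OF K'(4)] by auto
  have meas: "weak_gradient K Q \<in> borel_measurable (lebesgue_on K)" "grad Q \<in> borel_measurable (lebesgue_on K)"
    if "Q \<in> polynomials p" for Q
  proof -
    have "Q \<in> H1 K" using wg(1)[OF that] by (auto simp: H1_def)
    then show "weak_gradient K Q \<in> borel_measurable (lebesgue_on K)"
      by (rule L2D(1)[OF weak_gradientD(2)[OF has_weak_gradient_weak_gradient]])
    show "grad Q \<in> borel_measurable (lebesgue_on K)"
      by (rule L2D(1)[OF weak_gradientD(2)[OF wg(1)[OF that]]])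
  qed
  have int: "(LINT y|lebesgue_on K. weak_gradient K Q y \<bullet> weak_gradient K R y) =
      (LINT y|lebesgue_on K. grad Q y \<bullet> grad R y)" if Q: "Q \<in> polynomials p" and R: "R \<in> polynomials p" for Q R
  proof (rule integral_cong_AE)
    show "AE y in lebesgue_on K. weak_gradient K Q y \<bullet> weak_gradient K R y = grad Q y \<bullet> grad R y"
      using wg(2)[OF Q] wg(2)[OF R] by eventually_elim simp
  qed (intro borel_measurable_inner meas Q R)+
  have uP: "weak_gradient K u = weak_gradient K P" by (rule weak_gradient_cong) (rule u)
  have iP: "(LINT y|lebesgue_on K. u y) = (LINT y|lebesgue_on K. P y)"
    by (rule Bochner_Integration.integral_cong) (auto simp: u)
  have "(THE Q. Q \<in> polynomials p \<and> (LINT y|lebesgue_on K. Q y) = (LINT y|lebesgue_on K. u y) \<and>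
      (\<forall>q\<in>polynomials p. (LINT y|lebesgue_on K. weak_gradient K Q y \<bullet> weak_gradient K q y) =
         (LINT y|lebesgue_on K. weak_gradient K u y \<bullet> weak_gradient K q y))) = P"
    unfolding uP iP
  proof (rule the_equality)
    fix Q assume Q: "Q \<in> polynomials p \<and> (LINT y|lebesgue_on K. Q y) = (LINT y|lebesgue_on K. P y) \<and>
      (\<forall>q\<in>polynomials p. (LINT y|lebesgue_on K. weak_gradient K Q y \<bullet> weak_gradient K q y) =
         (LINT y|lebesgue_on K. weak_gradient K P y \<bullet> weak_gradient K q y))"
    define D where "D x = Q x - P x" for x
    have Qp: "Q \<in> polynomials p" using Q by blast
    have D: "D \<in> polynomials p" unfolding D_def[abs_def] by (rule polynomials_diff[OF Qp P])
    have gD: "grad D y = grad Q y - grad P y" for y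
      unfolding D_def[abs_def] by (rule grad_diff[OF smooth[OF Qp] smooth[OF P]])
    have L: "grad R \<in> L2 K" "R \<in> L2 K" if "R \<in> polynomials p" for R
      using weak_gradientD(1,2)[OF wg(1)[OF that]] by auto
    have "(LINT y|lebesgue_on K. grad Q y \<bullet> grad D y) = (LINT y|lebesgue_on K. grad P y \<bullet> grad D y)"
      using Q D int[OF Qp D] int[OF P D] by simp
    then have "(LINT y|lebesgue_on K. grad Q y \<bullet> grad D y - grad P y \<bullet> grad D y) = 0"
      using L2_inner_integrable[OF L(1)[OF Qp] L(1)[OF D]] L2_inner_integrable[OF L(1)[OF P] L(1)[OF D]]
      by simp
    moreover have "grad Q y \<bullet> grad D y - grad P y \<bullet> grad D y = (norm (grad D y))\<^sup>2" for y
      by (simp add: gD power2_norm_eq_inner inner_diff_left)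
    ultimately have "(LINT y|lebesgue_on K. (norm (grad D y))\<^sup>2) = 0" by simp
    then have "AE y in lebesgue_on K. (norm (grad D y))\<^sup>2 = 0"
      using L2D(2)[OF L(1)[OF D]] by (subst (asm) integral_nonneg_eq_0_iff_AE) auto
    then have ae: "AE y in lebesgue. y \<in> K \<longrightarrow> y \<in> {y. grad D y = 0}"
      using K'(4) by (simp add: AE_lebesgue_on_iff)
    have "closed {y. grad D y = 0}"
      using continuous_on_grad[OF smooth[OF D], of UNIV] by (intro closed_Collect_eq) auto
    then have g0: "grad D y = 0" if "y \<in> K" for y
      using mem_closed_if_AE_lebesgue_open[OF K'(4) _ ae that] by simp
    have "\<exists>c. \<forall>y\<in>K. D y = c"
    proof (rule has_derivative_zero_constant[OF K'(6)])
      fix y assume "y \<in> K"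
      then have "(D has_derivative (\<lambda>h. 0 \<bullet> h)) (at y)"
        using has_derivative_grad[OF smooth_fun_differentiable[OF smooth[OF D]], of y] g0 by simp
      then show "(D has_derivative (\<lambda>_. 0)) (at y within K)" by (simp add: has_derivative_at_withinI)
    qed
    then obtain c where c: "\<And>y. y \<in> K \<Longrightarrow> D y = c" by blast
    interpret finite_measure "lebesgue_on K" by (rule finite_measure_bounded[OF K'(7,4)])
    have intg: "integrable (lebesgue_on K) R" if "R \<in> polynomials p" for R
      using L2_mult_integrable[OF L(2)[OF that] L2_continuous[OF K'(7,4) continuous_on_const, of 1]] by simp
    have "0 = (LINT y|lebesgue_on K. D y)"
      unfolding D_def using Q intg[OF Qp] intg[OF P] by simp
    also have "\<dots> = (LINT y|lebesgue_on K. c)"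
      using c by (intro Bochner_Integration.integral_cong) auto
    also have "\<dots> = measure lebesgue K * c" using K'(4) by (simp add: measure_restrict_space)
    finally have "measure lebesgue K * c = 0" by simp
    moreover have "measure lebesgue K \<noteq> 0"
    proof
      assume "measure lebesgue K = 0"
      then have "negligible K"
        using lmeasurable_open[OF K'(7,4)] by (simp add: negligible_iff_measure)
      then show False using open_not_negligible[OF K'(4,5)] by blast
    qed
    ultimately have "D y = 0" if "y \<in> K" for y using c[OF that] by simp
    then have "D y = 0" for y
      using polynomial_eq_0_if_open[OF D K'(4) K(2)] by blast
    then show "Q = P" unfolding D_def by auto
  qed (use P in auto)
  then show ?thesis
    unfolding local_best_def by (subst sum_indicator_elements(1)[OF subset_refl K]) simp
qed

end

lemma smooth_lipschitz_compact:
  fixes f :: "'a::euclidean_space \<Rightarrow> real"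
  assumes "smooth_fun f" "compact C" "convex C"
  obtains L where "L-lipschitz_on C f" "\<And>x. x \<in> C \<Longrightarrow> norm (grad f x) \<le> L"
proof -
  have "compact (grad f ` C)"
    by (intro compact_continuous_image continuous_on_grad assms)
  then have "bounded (grad f ` C)" by (rule compact_imp_bounded)
  then obtain B where B: "\<And>x. x \<in> C \<Longrightarrow> norm (grad f x) \<le> B"
    by (auto simp: bounded_iff)
  have "(max B 0)-lipschitz_on C f"
  proof (rule bounded_derivative_imp_lipschitz[OF _ assms(3)])
    show "(f has_derivative (\<lambda>h. grad f x \<bullet> h)) (at x within C)" for x
      by (rule has_derivative_at_withinI[OF has_derivative_grad[OF smooth_fun_differentiable[OF assms(1)]]])
    show "onorm (\<lambda>h. grad f x \<bullet> h) \<le> max B 0" if "x \<in> C" for x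
    proof (rule onorm_le)
      fix h
      have "norm (grad f x \<bullet> h) \<le> norm (grad f x) * norm h"
        using Cauchy_Schwarz_ineq2 by simp
      also have "\<dots> \<le> max B 0 * norm h"
        using B[OF that] by (intro mult_right_mono) auto
      finally show "norm (grad f x \<bullet> h) \<le> max B 0 * norm h" .
    qed
  qed simp
  then show ?thesis using B by (intro that[of "max B 0"]) (auto simp: le_max_iff_disj)
qed

lemma smooth_strict_gradient:
  fixes f :: "'a::euclidean_space \<Rightarrow> real"
  assumes f: "smooth_fun f"
  shows "strict_gradient f x (grad f x)"
  unfolding strict_gradient_def
proof (intro allI impI)
  fix \<epsilon> :: real assume "\<epsilon> > 0"
  have "isCont (grad f) x"
    using continuous_on_grad[OF f, of UNIV] by (simp add: continuous_on_eq_continuous_at)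
  then obtain r where r: "r > 0" "\<And>y. dist y x < r \<Longrightarrow> dist (grad f y) (grad f x) < \<epsilon>"
    using \<open>\<epsilon> > 0\<close> unfolding continuous_at_eps_delta by blast
  have "\<epsilon>-lipschitz_on (ball x r) (\<lambda>y. f y - grad f x \<bullet> y)"
  proof (rule bounded_derivative_imp_lipschitz[OF _ convex_ball])
    show "((\<lambda>y. f y - grad f x \<bullet> y) has_derivative (\<lambda>h. grad f y \<bullet> h - grad f x \<bullet> h)) (at y within ball x r)" for y
      by (intro has_derivative_diff has_derivative_at_withinI[OF has_derivative_grad] smooth_fun_differentiable f
          has_derivative_inner_right has_derivative_ident)
    show "onorm (\<lambda>h. grad f y \<bullet> h - grad f x \<bullet> h) \<le> \<epsilon>" if "y \<in> ball x r" for y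
    proof (rule onorm_le)
      fix h
      have "norm (grad f y \<bullet> h - grad f x \<bullet> h) \<le> norm (grad f y - grad f x) * norm h"
        unfolding inner_diff_left[symmetric] using Cauchy_Schwarz_ineq2 by simp
      also have "\<dots> \<le> \<epsilon> * norm h"
        using r(2)[of y] that by (intro mult_right_mono) (auto simp: dist_norm norm_minus_commute)
      finally show "norm (grad f y \<bullet> h - grad f x \<bullet> h) \<le> \<epsilon> * norm h" .
    qed
  qed (use \<open>\<epsilon> > 0\<close> in simp)
  then show "\<exists>r>0. \<epsilon>-lipschitz_on (ball x r) (\<lambda>y. f y - grad f x \<bullet> y)" using r(1) by blast
qed

lemma strict_gradient_cong_open:
  assumes "strict_gradient f x g" "open S" "x \<in> S" "\<And>y. y \<in> S \<Longrightarrow> h y = f y"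
  shows "strict_gradient h x g"
  unfolding strict_gradient_def
proof (intro allI impI)
  fix \<epsilon> :: real assume "\<epsilon> > 0"
  then obtain r where r: "r > 0" "\<epsilon>-lipschitz_on (ball x r) (\<lambda>y. f y - g \<bullet> y)"
    using assms(1) unfolding strict_gradient_def by blast
  obtain s where s: "s > 0" "ball x s \<subseteq> S" using assms(2,3) open_contains_ball by blast
  have "\<epsilon>-lipschitz_on (ball x (min r s)) (\<lambda>y. f y - g \<bullet> y)"
    by (rule lipschitz_on_subset[OF r(2)]) auto
  then have "\<epsilon>-lipschitz_on (ball x (min r s)) (\<lambda>y. h y - g \<bullet> y)"
  proof (rule lipschitz_on_transform)
    fix y assume "y \<in> ball x (min r s)"
    then have "y \<in> S" using s(2) by auto
    then show "h y - g \<bullet> y = f y - g \<bullet> y" using assms(4) by simp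
  qed
  then show "\<exists>r>0. \<epsilon>-lipschitz_on (ball x r) (\<lambda>y. h y - g \<bullet> y)"
    using r(1) s(1) by (intro exI[of _ "min r s"]) simp
qed

text \<open>Moving from a boundary point to below the local graph leads to exterior points.\<close>

lemma frontier_in_closure_exterior:
  fixes \<Omega> :: "'a::euclidean_space set"
  assumes "lipschitz_boundary \<Omega>" "open \<Omega>" "x \<in> frontier \<Omega>"
  shows "x \<in> closure (- closure \<Omega>)"
proof -
  have "\<exists>U e L (g :: 'a \<Rightarrow> real). open U \<and> x \<in> U \<and> norm e = 1 \<and> L-lipschitz_on {z. z \<bullet> e = 0} g \<and>
      \<Omega> \<inter> U = {y \<in> U. g (y - (y \<bullet> e) *\<^sub>R e) < y \<bullet> e}"
    by (rule assms(1)[unfolded lipschitz_boundary_def, THEN bspec, OF assms(3)])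
  then obtain U e L and g :: "'a \<Rightarrow> real" where U: "open U" "x \<in> U" and e: "norm e = 1"
    and g: "L-lipschitz_on {z. z \<bullet> e = 0} g"
    and graph: "\<Omega> \<inter> U = {y \<in> U. g (y - (y \<bullet> e) *\<^sub>R e) < y \<bullet> e}"
    by (elim exE conjE) (rule that)
  let ?\<pi> = "\<lambda>y. y - (y \<bullet> e) *\<^sub>R e"
  have ee: "e \<bullet> e = 1" using e by (simp add: dot_square_norm)
  have \<pi>: "?\<pi> y \<bullet> e = 0" for y by (simp add: inner_diff_left ee)
  have cont: "continuous_on UNIV (\<lambda>y. g (?\<pi> y))"
    by (rule continuous_on_compose2[OF lipschitz_on_continuous_on[OF g]])
      (auto intro!: continuous_intros simp: \<pi>)
  define E where "E = U \<inter> {y. y \<bullet> e < g (?\<pi> y)}"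
  have "open E" unfolding E_def
    by (intro open_Int U(1) open_Collect_less cont continuous_intros)
  moreover have "E \<inter> \<Omega> = {}"
  proof -
    have False if "y \<in> E" "y \<in> \<Omega>" for y
    proof -
      have "y \<in> \<Omega> \<inter> U" using that by (simp add: E_def)
      then show False using that(1) unfolding graph E_def by simp
    qed
    then show ?thesis by blast
  qed
  ultimately have E: "E \<subseteq> - closure \<Omega>"
    using open_Int_closure_eq_empty[of E \<Omega>] by blast
  have "x \<notin> \<Omega>" using assms(2,3) by (simp add: frontier_def interior_open)
  then have "x \<bullet> e \<le> g (?\<pi> x)" using graph U(2) by (metis (mono_tags, lifting) IntD1 mem_Collect_eq not_le)
  have below: "x - t *\<^sub>R e \<in> E" if "t > 0" "x - t *\<^sub>R e \<in> U" for t
  proof -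
    have "?\<pi> (x - t *\<^sub>R e) = ?\<pi> x" by (simp add: inner_diff_left ee algebra_simps)
    moreover have "(x - t *\<^sub>R e) \<bullet> e < x \<bullet> e" using that(1) by (simp add: inner_diff_left ee)
    ultimately have "(x - t *\<^sub>R e) \<bullet> e < g (?\<pi> (x - t *\<^sub>R e))"
      using \<open>x \<bullet> e \<le> g (?\<pi> x)\<close> by (simp only: order_less_le_trans)
    then show ?thesis using that(2) unfolding E_def by blast
  qed
  show ?thesis
    unfolding closure_approachable
  proof (intro allI impI)
    fix \<epsilon> :: real assume "\<epsilon> > 0"
    obtain r where r: "r > 0" "ball x r \<subseteq> U" using U open_contains_ball by blast
    define t where "t = min r \<epsilon> / 2"
    have t: "t > 0" "t < r" "t < \<epsilon>" using r(1) \<open>\<epsilon> > 0\<close> by (auto simp: t_def)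
    have "x - t *\<^sub>R e \<in> U" using t e by (intro subsetD[OF r(2)]) (simp add: dist_norm)
    then have "x - t *\<^sub>R e \<in> - closure \<Omega>" using below t(1) E by blast
    moreover have "dist (x - t *\<^sub>R e) x < \<epsilon>" using t e by (simp add: dist_norm)
    ultimately show "\<exists>y\<in>- closure \<Omega>. dist y x < \<epsilon>" by blast
  qed
qed

text \<open>The inequality extends to the closures of both sets, where \<open>z\<close> may take both places.\<close>

lemma lipschitz_limit:
  fixes f g :: "'a::euclidean_space \<Rightarrow> real"
  assumes fg: "continuous_on UNIV f" "continuous_on UNIV g"
    and ineq: "\<And>x y. x \<in> A \<Longrightarrow> y \<in> B \<Longrightarrow> \<bar>f x - g y\<bar> \<le> M * norm (x - y)"
    and z: "z \<in> closure A" "z \<in> closure B"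
  shows "f z = g z"
proof -
  let ?C = "{w. \<bar>f (fst w) - g (snd w)\<bar> \<le> M * norm (fst w - snd w)}"
  have "continuous_on UNIV (\<lambda>w::'a \<times> 'a. f (fst w))" "continuous_on UNIV (\<lambda>w::'a \<times> 'a. g (snd w))"
    by (rule continuous_on_compose2[OF fg(1)] continuous_on_compose2[OF fg(2)], auto intro!: continuous_intros)+
  then have "closed ?C"
    by (intro closed_Collect_le continuous_intros) 
  moreover have "A \<times> B \<subseteq> ?C" using ineq by auto
  ultimately have "closure (A \<times> B) \<subseteq> ?C" by (rule closure_minimal[rotated])
  then have "(z, z) \<in> ?C" using z by (auto simp: closure_Times)
  then show ?thesis by simp
qed

context mesh
begin

lemma bounded_elements: "A \<subseteq> \<T> \<Longrightarrow> bounded (\<Union>K\<in>A. closure K)"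
  using finite_subset[OF _ finite_elements, of A] element(8) by (intro bounded_UN) (auto intro: compact_imp_bounded)

lemma finite_mesh_vertices: "finite (mesh_vertices \<T>)"
  unfolding mesh_vertices_def using finite_elements element(2) by blast

text \<open>The mesh skeleton is a finite union of frontiers of convex sets, which are null sets.\<close>

lemma AE_in_element:
  assumes A: "A \<subseteq> \<T>" and S: "S \<in> sets lebesgue" "S \<subseteq> (\<Union>K\<in>A. closure K)"
  shows "AE x in lebesgue_on S. \<exists>K\<in>A. x \<in> K"
proof -
  have "negligible (\<Union>K\<in>A. frontier K)"
    using finite_subset[OF A finite_elements] A element(6)
    by (intro negligible_Union) (auto intro: negligible_convex_frontier)
  then have "AE x in lebesgue. x \<notin> (\<Union>K\<in>A. frontier K)"
    by (intro AE_not_in) (simp add: negligible_iff_null_sets)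
  then have "AE x in lebesgue. x \<in> S \<longrightarrow> (\<exists>K\<in>A. x \<in> K)"
  proof (rule eventually_mono, intro impI)
    fix x assume x: "x \<notin> (\<Union>K\<in>A. frontier K)" "x \<in> S"
    then obtain K where "K \<in> A" "x \<in> closure K" "x \<notin> frontier K" using S(2) by blast
    then have "x \<in> K" using A element(4)[of K] by (auto simp: frontier_def interior_open)
    then show "\<exists>K\<in>A. x \<in> K" using \<open>K \<in> A\<close> by blast
  qed
  then show ?thesis using S(1) by (simp add: AE_lebesgue_on_iff)
qed

lemma open_patch_domain: "open (patch_domain \<T> a)"
  by (simp add: patch_domain_def)

lemma patch_subset: "patch \<T> a \<subseteq> \<T>"
  by (auto simp: patch_def)

lemma patch_domain_subset: "patch_domain \<T> a \<subseteq> (\<Union>K\<in>patch \<T> a. closure K)"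
  by (simp add: patch_domain_def interior_subset)

lemma bounded_patch_domain: "bounded (patch_domain \<T> a)"
  by (rule bounded_subset[OF bounded_elements[OF patch_subset] patch_domain_subset])

lemma element_in_patch_domain: "K \<in> patch \<T> a \<Longrightarrow> K \<subseteq> patch_domain \<T> a"
  unfolding patch_domain_def
  using element(4)[of K] closure_subset[of K] by (intro interior_maximal) (auto simp: patch_def)

lemma in_patch_domain_iff:
  assumes "K \<in> \<T>" "x \<in> K"
  shows "x \<in> patch_domain \<T> a \<longleftrightarrow> a \<in> vertices K"
proof
  assume "x \<in> patch_domain \<T> a"
  then obtain K' where "K' \<in> patch \<T> a" "x \<in> closure K'" using patch_domain_subset by blast
  then show "a \<in> vertices K" using elements_disjoint[OF assms(1) _ assms(2)] by (auto simp: patch_def)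
next
  assume "a \<in> vertices K"
  then show "x \<in> patch_domain \<T> a" using element_in_patch_domain[of K a] assms by (auto simp: patch_def)
qed

lemma common_lipschitz_constant:
  assumes A: "A \<subseteq> \<T>" and Q: "\<And>K. K \<in> A \<Longrightarrow> smooth_fun (Q K)"
  obtains M where "M \<ge> 0" "\<And>K. K \<in> A \<Longrightarrow> M-lipschitz_on (closure K) (Q K)"
    "\<And>K x. K \<in> A \<Longrightarrow> x \<in> K \<Longrightarrow> norm (grad (Q K) x) \<le> M"
proof -
  have "\<exists>L. L-lipschitz_on (closure K) (Q K) \<and> (\<forall>x\<in>closure K. norm (grad (Q K) x) \<le> L)" if K: "K \<in> A" for K
  proof -
    have "K \<in> \<T>" using K A by blast
    note K' = element(8)[OF this] convex_closure[OF element(6)[OF this]]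
    obtain L where "L-lipschitz_on (closure K) (Q K)" "\<And>x. x \<in> closure K \<Longrightarrow> norm (grad (Q K) x) \<le> L"
      using smooth_lipschitz_compact[OF Q[OF K] K'] by blast
    then show ?thesis by blast
  qed
  then obtain L where L: "\<And>K. K \<in> A \<Longrightarrow> (L K)-lipschitz_on (closure K) (Q K)"
    "\<And>K x. K \<in> A \<Longrightarrow> x \<in> closure K \<Longrightarrow> norm (grad (Q K) x) \<le> L K" by metis
  have le: "L K \<le> (\<Sum>K\<in>A. \<bar>L K\<bar>)" if "K \<in> A" for K
    using member_le_sum[OF that _ finite_subset[OF A finite_elements], of "\<lambda>K. \<bar>L K\<bar>"] by simp
  show ?thesis
  proof (rule that)
    show "0 \<le> (\<Sum>K\<in>A. \<bar>L K\<bar>)" by (rule sum_nonneg) simp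
    show "(\<Sum>K\<in>A. \<bar>L K\<bar>)-lipschitz_on (closure K) (Q K)" if "K \<in> A" for K
      by (rule lipschitz_on_mono[OF L(1)[OF that] subset_refl le[OF that]])
    show "norm (grad (Q K) x) \<le> (\<Sum>K\<in>A. \<bar>L K\<bar>)" if "K \<in> A" "x \<in> K" for K x
      using L(2)[OF that(1), of x] le[OF that(1)] that(2) closure_subset[of K] by auto
  qed
qed

lemma element_weak_gradient:
  assumes K: "K \<in> \<T>" and Q: "smooth_fun Q" and v: "\<And>x. x \<in> K \<Longrightarrow> v x = Q x"
  shows "has_weak_gradient K v (grad Q)"
  using has_weak_gradient_smooth[OF element(4,7)[OF K] Q] has_weak_gradient_cong[of K v Q] v by simp

lemma weak_gradient_on_elements:
  assumes A: "A \<subseteq> \<T>" and Q: "\<And>K. K \<in> A \<Longrightarrow> smooth_fun (Q K)"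
    and v: "\<And>K x. K \<in> A \<Longrightarrow> x \<in> K \<Longrightarrow> v x = Q K x"
    and S: "open S" "\<And>K. K \<in> A \<Longrightarrow> K \<subseteq> S" and g: "has_weak_gradient S v g"
  shows "AE x in lebesgue. \<forall>K\<in>A. x \<in> K \<longrightarrow> g x = grad (Q K) x"
proof (rule AE_finite_allI[OF finite_subset[OF A finite_elements]])
  fix K assume K: "K \<in> A"
  then have KT: "K \<in> \<T>" using A by blast
  have "AE x in lebesgue_on K. g x = grad (Q K) x"
    by (rule weak_gradient_unique[OF element(4)[OF KT] has_weak_gradient_subset[OF element(4)[OF KT] S(1) S(2)[OF K] g]
          element_weak_gradient[OF KT Q[OF K] v[OF K]]])
  then show "AE x in lebesgue. x \<in> K \<longrightarrow> g x = grad (Q K) x"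
    using open_in_lebesgue[OF element(4)[OF KT]] by (simp add: AE_lebesgue_on_iff)
qed

lemma broken_gradient_AE:
  assumes A: "A \<subseteq> \<T>" and Q: "\<And>K. K \<in> A \<Longrightarrow> smooth_fun (Q K)"
    and v: "\<And>K x. K \<in> A \<Longrightarrow> x \<in> K \<Longrightarrow> v x = Q K x"
  shows "AE x in lebesgue. \<forall>K\<in>A. x \<in> K \<longrightarrow> broken_gradient A v x = grad (Q K) x"
    and "broken_gradient A v \<in> borel_measurable lebesgue"
proof -
  have KT: "K \<in> \<T>" if "K \<in> A" for K using that A by blast
  have wg: "has_weak_gradient K v (weak_gradient K v)" if "K \<in> A" for K
    using element_weak_gradient[OF KT Q v, OF that that that]
    by (intro has_weak_gradient_weak_gradient) (auto simp: H1_def)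
  have "AE x in lebesgue. \<forall>K'\<in>{K}. x \<in> K' \<longrightarrow> weak_gradient K v x = grad (Q K') x" if "K \<in> A" for K
    using that A by (intro weak_gradient_on_elements[OF _ _ _ element(4)[OF KT[OF that]] _ wg[OF that]] Q v) auto
  then have "AE x in lebesgue. \<forall>K\<in>A. x \<in> K \<longrightarrow> weak_gradient K v x = grad (Q K) x"
    by (intro AE_finite_allI[OF finite_subset[OF A finite_elements]]) simp
  then show "AE x in lebesgue. \<forall>K\<in>A. x \<in> K \<longrightarrow> broken_gradient A v x = grad (Q K) x"
  proof (rule eventually_mono, intro ballI impI)
    fix x K assume x: "\<forall>K\<in>A. x \<in> K \<longrightarrow> weak_gradient K v x = grad (Q K) x" and K: "K \<in> A" "x \<in> K"
    have "broken_gradient A v x = weak_gradient K v x"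
      unfolding broken_gradient_def by (rule sum_indicator_elements(2)[OF A K])
    then show "broken_gradient A v x = grad (Q K) x" using x K by simp
  qed
  have "(\<lambda>x. indicator K x *\<^sub>R weak_gradient K v x) \<in> borel_measurable lebesgue" if "K \<in> A" for K
    using L2D(1)[OF weak_gradientD(2)[OF wg[OF that]]] open_in_lebesgue[OF element(4)[OF KT[OF that]]]
    by (subst (asm) borel_measurable_restrict_space_iff) auto
  then show "broken_gradient A v \<in> borel_measurable lebesgue"
    unfolding broken_gradient_def[abs_def] by (intro borel_measurable_sum)
qed

text \<open>Boundedness guarantees integrability here, without which the integral would be zero by convention.\<close>

lemma broken_gradient_norm_eq_0_iff:
  assumes A: "A \<subseteq> \<T>" and Q: "\<And>K. K \<in> A \<Longrightarrow> smooth_fun (Q K)"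
    and v: "\<And>K x. K \<in> A \<Longrightarrow> x \<in> K \<Longrightarrow> v x = Q K x"
    and S: "open S" "bounded S" "S \<subseteq> (\<Union>K\<in>A. closure K)"
  shows "L2_norm_on S (broken_gradient A v) = 0 \<longleftrightarrow> (AE x in lebesgue_on S. broken_gradient A v x = 0)"
proof -
  obtain M where M: "M \<ge> 0" "\<And>K. K \<in> A \<Longrightarrow> M-lipschitz_on (closure K) (Q K)"
    "\<And>K x. K \<in> A \<Longrightarrow> x \<in> K \<Longrightarrow> norm (grad (Q K) x) \<le> M"
    using common_lipschitz_constant[where A = A and Q = Q] A Q by auto
  note Sm = open_in_lebesgue[OF S(1)]
  have ae: "AE x in lebesgue. \<forall>K\<in>A. x \<in> K \<longrightarrow> broken_gradient A v x = grad (Q K) x"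
    and meas: "broken_gradient A v \<in> borel_measurable lebesgue"
    by (rule broken_gradient_AE[OF A Q v]; assumption)+
  have "AE x in lebesgue_on S. norm (broken_gradient A v x) \<le> M"
    using AE_lebesgue_onI[OF ae Sm] AE_in_element[OF A Sm S(3)] by eventually_elim (use M(3) in force)
  then have "broken_gradient A v \<in> L2 S"
    by (rule L2_bounded[OF S(2,1) measurable_restrict_space1[OF meas]])
  then have "integrable (lebesgue_on S) (\<lambda>x. (norm (broken_gradient A v x))\<^sup>2)" by (rule L2D(2))
  then show ?thesis
    unfolding L2_norm_on_def by (simp add: integral_nonneg_eq_0_iff_AE)
qed

end

section \<open>Traces of piecewise polynomials with weak derivatives\<close>

locale conforming_polynomial = mesh \<Omega> \<T>
  for \<Omega> :: "'a::euclidean_space set" and \<T> :: "'a set set" +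
  fixes p :: nat and u :: "'a \<Rightarrow> real" and P :: "'a set \<Rightarrow> 'a \<Rightarrow> real"
  assumes domain: "lipschitz_polyhedral_domain \<Omega>"
    and p: "p \<ge> 1"
    and H10: "u \<in> H10 \<Omega>"
    and P: "\<And>K. K \<in> \<T> \<Longrightarrow> P K \<in> polynomials p"
    and uP: "\<And>K x. K \<in> \<T> \<Longrightarrow> x \<in> K \<Longrightarrow> u x = P K x"
begin

lemma open_domain: "open \<Omega>" and boundary: "lipschitz_boundary \<Omega>"
  using domain by (auto simp: lipschitz_polyhedral_domain_def)

lemma P_smooth: "K \<in> \<T> \<Longrightarrow> smooth_fun (P K)"
  using P by (rule smooth_fun_polynomial)

lemma P_continuous: "K \<in> \<T> \<Longrightarrow> continuous_on A (P K)"
  by (rule smooth_fun_continuous[OF P_smooth])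

lemma interior_closure_domain: "interior (closure \<Omega>) = \<Omega>"
proof
  show "interior (closure \<Omega>) \<subseteq> \<Omega>"
  proof
    fix x assume x: "x \<in> interior (closure \<Omega>)"
    show "x \<in> \<Omega>"
    proof (rule ccontr)
      assume "x \<notin> \<Omega>"
      then have "x \<in> frontier \<Omega>"
        using x interior_subset[of "closure \<Omega>"] open_domain by (auto simp: frontier_def interior_open)
      then have "x \<in> closure (- closure \<Omega>)" by (rule frontier_in_closure_exterior[OF boundary open_domain])
      then show False using x by (simp add: closure_complement)
    qed
  qed
  show "\<Omega> \<subseteq> interior (closure \<Omega>)" by (rule interior_maximal[OF closure_subset open_domain])
qed

lemma AE_domain_in_element: "AE x in lebesgue_on \<Omega>. \<exists>K\<in>\<T>. x \<in> K"
  using closure_domain closure_subset[of \<Omega>]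
  by (intro AE_in_element[OF subset_refl open_in_lebesgue[OF open_domain]]) simp

lemma weak_gradient_bounded:
  obtains M where "M \<ge> 0" "AE x in lebesgue_on \<Omega>. norm (weak_gradient \<Omega> u x) \<le> M"
proof -
  obtain M where M: "M \<ge> 0" "\<And>K. K \<in> \<T> \<Longrightarrow> M-lipschitz_on (closure K) (P K)"
    "\<And>K x. K \<in> \<T> \<Longrightarrow> x \<in> K \<Longrightarrow> norm (grad (P K) x) \<le> M"
    using common_lipschitz_constant[where A = \<T> and Q = P] P_smooth by auto
  have "AE x in lebesgue. \<forall>K\<in>\<T>. x \<in> K \<longrightarrow> weak_gradient \<Omega> u x = grad (P K) x"
    by (rule weak_gradient_on_elements[OF subset_refl P_smooth uP open_domain element_subset H10_weak_gradient[OF H10]])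
  from AE_lebesgue_onI[OF this open_in_lebesgue[OF open_domain]] AE_domain_in_element
  have "AE x in lebesgue_on \<Omega>. norm (weak_gradient \<Omega> u x) \<le> M"
    by eventually_elim (use M(3) in force)
  with M(1) show ?thesis by (rule that)
qed

text \<open>The gradient of \<open>u\<close> is bounded, so the extension of \<open>u\<close> by zero is Lipschitz continuous. Hence
  the polynomials match wherever two closed elements meet, faces of low dimension included, and
  vanish on the boundary of the domain.\<close>

lemma trace_agree:
  assumes K: "K \<in> \<T>" "K' \<in> \<T>" and z: "z \<in> closure K" "z \<in> closure K'"
  shows "P K z = P K' z"
    and trace_zero: "z \<in> frontier \<Omega> \<Longrightarrow> P K z = 0"
proof -
  obtain M where M: "M \<ge> 0" "AE x in lebesgue_on \<Omega>. norm (weak_gradient \<Omega> u x) \<le> M"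
    by (rule weak_gradient_bounded)
  let ?w = "\<lambda>x. if x \<in> \<Omega> then u x else 0"
  have w: "?w x = P K x" if "K \<in> \<T>" "x \<in> K" for K x
    using that element_subset uP by auto
  have contK: "isCont ?w x" if "K \<in> \<T>" "x \<in> K" for K x
  proof -
    have "continuous_on K ?w"
      using P_continuous[OF that(1), of K] continuous_on_cong[OF refl w[OF that(1)], of K] by simp
    then show ?thesis using that element(4)[OF that(1)] by (simp add: continuous_on_eq_continuous_at)
  qed
  have contE: "isCont ?w x" "?w x = 0" if "x \<in> - closure \<Omega>" for x
  proof -
    have 0: "?w y = 0" if "y \<in> - closure \<Omega>" for y using that closure_subset[of \<Omega>] by auto
    have "continuous_on (- closure \<Omega>) ?w \<longleftrightarrow> continuous_on (- closure \<Omega>) (\<lambda>_. 0 :: real)"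
      by (rule continuous_on_cong[OF refl 0])
    then have "continuous_on (- closure \<Omega>) ?w" by simp
    then show "isCont ?w x" using that by (simp add: continuous_on_eq_continuous_at open_Compl)
    show "?w x = 0" using 0[OF that] .
  qed
  note lip = H10_lipschitz[OF open_domain H10 H10_weak_gradient[OF H10] M(2,1)]
  show "P K z = P K' z"
  proof (rule lipschitz_limit[OF P_continuous[OF K(1)] P_continuous[OF K(2)] _ z])
    fix x y assume "x \<in> K" "y \<in> K'"
    then show "\<bar>P K x - P K' y\<bar> \<le> M * norm (x - y)"
      using lip[OF contK[OF K(2)] contK[OF K(1)], of y x] w[OF K(1), of x] w[OF K(2), of y] by simp
  qed
  show "P K z = 0" if "z \<in> frontier \<Omega>"
  proof (rule lipschitz_limit[OF P_continuous[OF K(1)] continuous_on_const[of _ 0] _ z(1)])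
    show "z \<in> closure (- closure \<Omega>)"
      by (rule frontier_in_closure_exterior[OF boundary open_domain that])
    fix x y assume "x \<in> K" "y \<in> - closure \<Omega>"
    then show "\<bar>P K x - 0\<bar> \<le> M * norm (x - y)"
      using lip[OF contE(1) contK[OF K(1)], of y x] w[OF K(1), of x] contE(2)[of y] by simp
  qed
qed

section \<open>The localised function\<close>

text \<open>On one element, the interpolant of the product of the hat function and \<open>u\<close>.\<close>

definition nodal_product :: "'a \<Rightarrow> 'a set \<Rightarrow> 'a \<Rightarrow> real" where
  "nodal_product a K = (SOME Q. Q \<in> polynomials p \<and>
     (\<forall>y\<in>simplex_nodes p (vertices K). Q y = hat_poly a K y * P K y))"

lemma nodal_product:
  assumes "K \<in> \<T>"
  shows "nodal_product a K \<in> polynomials p"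
    and "y \<in> simplex_nodes p (vertices K) \<Longrightarrow> nodal_product a K y = hat_poly a K y * P K y"
proof -
  have "\<exists>Q. Q \<in> polynomials p \<and> (\<forall>y\<in>simplex_nodes p (vertices K). Q y = hat_poly a K y * P K y)"
    using lagrange_interpolant_exists[OF element(1,2)[OF assms] p, of "\<lambda>y. hat_poly a K y * P K y"] by blast
  then have "nodal_product a K \<in> polynomials p \<and>
      (\<forall>y\<in>simplex_nodes p (vertices K). nodal_product a K y = hat_poly a K y * P K y)"
    unfolding nodal_product_def by (rule someI_ex)
  then show "nodal_product a K \<in> polynomials p"
    "y \<in> simplex_nodes p (vertices K) \<Longrightarrow> nodal_product a K y = hat_poly a K y * P K y" by blast+
qed

lemma nodes_in_closure: "K \<in> \<T> \<Longrightarrow> y \<in> simplex_nodes p (vertices K) \<Longrightarrow> y \<in> closure K"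
  using simplex_nodes_subset_hull[OF element(2) p, of K] element(3)[of K] by blast

lemma nodal_product_smooth: "K \<in> \<T> \<Longrightarrow> smooth_fun (nodal_product a K)"
  using nodal_product(1) by (rule smooth_fun_polynomial)

lemma nodal_product_agree:
  assumes K: "K \<in> \<T>" "K' \<in> \<T>" and x: "x \<in> closure K" "x \<in> closure K'"
  shows "nodal_product a K x = nodal_product a K' x"
proof (rule agree_on_common_face[OF K x p nodal_product(1)[OF K(1)] nodal_product(1)[OF K(2)]])
  fix y assume y: "y \<in> simplex_nodes p (vertices K)" "y \<in> simplex_nodes p (vertices K')"
  have c: "y \<in> closure K" "y \<in> closure K'" by (rule nodes_in_closure[OF K(1) y(1)] nodes_in_closure[OF K(2) y(2)])+
  show "nodal_product a K y = nodal_product a K' y"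
    using nodal_product(2)[OF K(1) y(1)] nodal_product(2)[OF K(2) y(2)] hat_poly_agree[OF K c] trace_agree[OF K c]
    by simp
qed

lemma support_face:
  assumes K: "K \<in> \<T>" and x: "x \<in> closure K"
  obtains c where "c \<subseteq> vertices K" "x \<in> rel_interior (convex hull c)" "convex hull c \<subseteq> closure K"
proof -
  obtain t where t: "\<And>b. b \<in> vertices K \<Longrightarrow> 0 \<le> t b" "(\<Sum>b\<in>vertices K. t b) = 1" "x = (\<Sum>b\<in>vertices K. t b *\<^sub>R b)"
    using x unfolding element(3)[OF K] convex_hull_finite[OF element(2)[OF K]] by blast
  define c where "c = {b \<in> vertices K. t b > 0}"
  have cV: "c \<subseteq> vertices K" by (auto simp: c_def)
  have z: "t b = 0" if "b \<in> vertices K - c" for b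
    using that t(1)[of b] by (auto simp: c_def)
  have "(\<Sum>b\<in>c. t b) = 1" "x = (\<Sum>b\<in>c. t b *\<^sub>R b)"
  proof -
    have "(\<Sum>b\<in>c. t b) = (\<Sum>b\<in>vertices K. t b)"
      by (rule sum.mono_neutral_left[OF element(2)[OF K] cV]) (simp add: z)
    then show "(\<Sum>b\<in>c. t b) = 1" using t(2) by simp
    have "(\<Sum>b\<in>c. t b *\<^sub>R b) = (\<Sum>b\<in>vertices K. t b *\<^sub>R b)"
      by (rule sum.mono_neutral_left[OF element(2)[OF K] cV]) (simp add: z)
    then show "x = (\<Sum>b\<in>c. t b *\<^sub>R b)" using t(3) by simp
  qed
  moreover have "finite c" using cV element(2)[OF K] by (rule finite_subset)
  ultimately have "x \<in> rel_interior (convex hull c)"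
    using explicit_subset_rel_interior_convex_hull_minimal[of c] by (auto simp: c_def)
  moreover have "convex hull c \<subseteq> closure K" unfolding element(3)[OF K] by (rule hull_mono[OF cV])
  ultimately show ?thesis using cV by (intro that)
qed

lemma face_subset_element:
  assumes K: "K \<in> \<T>" "K' \<in> \<T>" and c: "convex hull c \<subseteq> closure K"
    and x: "x \<in> rel_interior (convex hull c)" "x \<in> closure K'"
  shows "convex hull c \<subseteq> closure K'"
proof -
  have xK: "x \<in> closure K" using x(1) c rel_interior_subset by blast
  have "convex hull c \<subseteq> closure K \<inter> closure K'"
    by (rule subset_of_face_of[OF common_face(1)[OF K xK x(2)] c]) (use x xK in blast)
  then show ?thesis by blast
qed

lemma near_point:
  "\<exists>r>0. \<forall>y\<in>ball x r \<inter> closure \<Omega>. \<exists>K\<in>\<T>. x \<in> closure K \<and> y \<in> closure K"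
proof -
  let ?C = "\<Union>K\<in>{K \<in> \<T>. x \<notin> closure K}. closure K"
  have "closed ?C" using finite_elements by (intro closed_UN) auto
  then have "open (- ?C)" by (rule open_Compl)
  moreover have "x \<in> - ?C" by blast
  ultimately obtain r where r: "r > 0" "ball x r \<subseteq> - ?C"
    by (rule openE)
  have "\<exists>K\<in>\<T>. x \<in> closure K \<and> y \<in> closure K" if "y \<in> ball x r" "y \<in> closure \<Omega>" for y
    using that r(2) unfolding closure_domain by blast
  with r(1) show ?thesis by blast
qed

text \<open>If the domain contained another point of the relative interior of the face, the elements around
  that point would fill a neighbourhood of it. They all contain the face, so by convexity a homothety
  with centre on the face maps this neighbourhood into them and to a neighbourhood of \<open>x\<close>.\<close>

lemma face_in_frontier:
  assumes K: "K \<in> \<T>" and c: "convex hull c \<subseteq> closure K"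
    and x: "x \<in> rel_interior (convex hull c)" "x \<notin> \<Omega>" and y: "y \<in> convex hull c"
  shows "y \<in> frontier \<Omega>"
proof -
  have sub: "rel_interior (convex hull c) \<subseteq> frontier \<Omega>"
  proof
    fix z assume z: "z \<in> rel_interior (convex hull c)"
    have zc: "z \<in> closure \<Omega>"
      using z c K rel_interior_subset unfolding closure_domain by blast
    have "z \<notin> \<Omega>"
    proof
      assume "z \<in> \<Omega>"
      obtain r0 where r0: "r0 > 0" "\<forall>y\<in>ball z r0 \<inter> closure \<Omega>. \<exists>K\<in>\<T>. z \<in> closure K \<and> y \<in> closure K"
        using near_point[of z] by blast
      obtain r1 where r1: "r1 > 0" "ball z r1 \<subseteq> \<Omega>" using \<open>z \<in> \<Omega>\<close> open_domain open_contains_ball by blast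
      define r where "r = min r0 r1"
      have r: "r > 0" using r0 r1 by (simp add: r_def)
      have "z \<in> affine hull (convex hull c)" using z rel_interior_subset hull_subset[of "convex hull c" affine] by blast
      then obtain e where e: "e > 1" "(1 - e) *\<^sub>R z + e *\<^sub>R x \<in> convex hull c"
        using convex_rel_interior_if2[OF convex_convex_hull x(1)] by blast
      \<comment> \<open>the homothety with centre \<open>w\<close> and ratio \<open>1 - s\<close> maps \<open>z\<close> to \<open>x\<close>\<close>
      define w where "w = (1 - e) *\<^sub>R z + e *\<^sub>R x"
      define s where "s = 1 / e"
      have s: "0 < s" "s < 1" using e(1) by (auto simp: s_def)
      have xw: "x = (1 - s) *\<^sub>R z + s *\<^sub>R w"
      proof -
        have "s * e = 1" using e(1) by (simp add: s_def)
        then have "s *\<^sub>R w = (s - 1) *\<^sub>R z + x"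
          by (simp add: w_def scaleR_add_right right_diff_distrib)
        then show ?thesis by (simp add: algebra_simps)
      qed
      have "ball x ((1 - s) * r) \<subseteq> closure \<Omega>"
      proof
        fix y assume y: "y \<in> ball x ((1 - s) * r)"
        define q where "q = z + (1 / (1 - s)) *\<^sub>R (y - x)"
        have "norm (y - x) < (1 - s) * r" using y by (simp add: dist_norm norm_minus_commute)
        then have "norm (y - x) / (1 - s) < r" using s by (simp add: divide_less_eq mult.commute)
        then have "norm ((1 / (1 - s)) *\<^sub>R (y - x)) < r" using s by (simp add: divide_inverse mult.commute)
        then have "q \<in> ball z r" by (simp add: q_def dist_norm)
        then have "q \<in> ball z r0" "q \<in> closure \<Omega>"
          using r1(2) closure_subset[of \<Omega>] by (auto simp: r_def)
        then obtain K' where K': "K' \<in> \<T>" "z \<in> closure K'" "q \<in> closure K'" using r0(2) by blast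
        have "convex hull c \<subseteq> closure K'" by (rule face_subset_element[OF K K'(1) c z K'(2)])
        then have "w \<in> closure K'" using e(2) by (auto simp: w_def)
        then have "(1 - s) *\<^sub>R q + s *\<^sub>R w \<in> closure K'"
          using s K'(3) convex_closure[OF element(6)[OF K'(1)]] by (intro convexD) auto
        moreover have "(1 - s) *\<^sub>R q + s *\<^sub>R w = y"
        proof -
          have "(1 - s) *\<^sub>R q = (1 - s) *\<^sub>R z + (y - x)" using s by (simp add: q_def scaleR_add_right)
          then show ?thesis using xw by simp
        qed
        ultimately show "y \<in> closure \<Omega>" using K'(1) unfolding closure_domain by blast
      qed
      moreover have "(1 - s) * r > 0" using s r by simp
      ultimately have "x \<in> interior (closure \<Omega>)" by (meson centre_in_ball interiorI open_ball)
      then show False using x(2) interior_closure_domain by simp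
    qed
    then show "z \<in> frontier \<Omega>" using zc open_domain by (simp add: frontier_def interior_open)
  qed
  have "y \<in> closure (rel_interior (convex hull c))"
    using y closure_subset convex_closure_rel_interior[OF convex_convex_hull, of c] by blast
  then show ?thesis using closure_minimal[OF sub frontier_closed] by blast
qed

text \<open>The smallest face containing a point \<open>x\<close> off the patch domain either misses the vertex \<open>a\<close>, so
  that the hat function vanishes on it, or it lies in the boundary of the domain, so that the
  polynomial does. In both cases the nodal values on this face are zero.\<close>

lemma nodal_product_zero:
  assumes K: "K \<in> patch \<T> a" and x: "x \<in> closure K" "x \<notin> patch_domain \<T> a"
  shows "nodal_product a K x = 0"
proof -
  have KT: "K \<in> \<T>" and aK: "a \<in> vertices K" using K by (auto simp: patch_def)
  obtain c where c: "c \<subseteq> vertices K" "x \<in> rel_interior (convex hull c)" "convex hull c \<subseteq> closure K"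
    by (rule support_face[OF KT x(1)])
  have fin: "finite c" using c(1) element(2)[OF KT] by (rule finite_subset)
  have xc: "x \<in> convex hull c" using c(2) rel_interior_subset by blast
  have "hat_poly a K y * P K y = 0" if y: "y \<in> convex hull c" for y
  proof (cases "a \<in> c")
    case False
    have "hat_poly a K y = 0"
    proof (rule polynomial_eq_0_if_nodes[OF fin order_refl hat_poly_polynomial[OF KT] _ y])
      fix b assume "b \<in> simplex_nodes 1 c"
      then have "b \<in> c" by (rule simplex_nodes_1_vertices[OF fin])
      then show "hat_poly a K b = 0" using hat_poly_vertex[OF KT, of b a] c(1) False by auto
    qed
    then show ?thesis by simp
  next
    case True
    have in_patch: "K' \<in> patch \<T> a" if K': "K' \<in> \<T>" "x \<in> closure K'" for K'
    proof -
      have "a \<in> closure K'"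
        using face_subset_element[OF KT K'(1) c(3) c(2) K'(2)] True hull_subset[of c convex] by blast
      then have "a \<in> vertices K'" by (rule common_vertex[OF KT K'(1) aK])
      then show ?thesis using K'(1) by (simp add: patch_def)
    qed
    have "x \<notin> \<Omega>"
    proof
      assume "x \<in> \<Omega>"
      obtain r0 where r0: "r0 > 0" "\<forall>y\<in>ball x r0 \<inter> closure \<Omega>. \<exists>K\<in>\<T>. x \<in> closure K \<and> y \<in> closure K"
        using near_point[of x] by blast
      have "ball x r0 \<inter> \<Omega> \<subseteq> (\<Union>K\<in>patch \<T> a. closure K)"
        using r0(2) closure_subset[of \<Omega>] in_patch by blast
      then have "ball x r0 \<inter> \<Omega> \<subseteq> patch_domain \<T> a"
        unfolding patch_domain_def by (intro interior_maximal open_Int open_ball open_domain)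
      moreover have "x \<in> ball x r0 \<inter> \<Omega>" using \<open>x \<in> \<Omega>\<close> r0(1) by simp
      ultimately show False using x(2) by blast
    qed
    then have "y \<in> frontier \<Omega>" by (rule face_in_frontier[OF KT c(3) c(2) _ y])
    then show ?thesis using trace_zero[OF KT KT] y c(3) by auto
  qed
  then show ?thesis
    using simplex_nodes_subset[OF element(2)[OF KT] c(1), of p] simplex_nodes_subset_hull[OF fin p]
      nodal_product(2)[OF KT, of _ a]
    by (intro polynomial_eq_0_if_nodes[OF fin p nodal_product(1)[OF KT] _ xc]) (metis subsetD)
qed

end

lemma broken_polynomials_choice:
  assumes "v \<in> broken_polynomials q A"
  shows "\<exists>R. \<forall>K\<in>A. R K \<in> polynomials q \<and> (\<forall>x\<in>K. v x = R K x)"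
  by (rule bchoice) (use assms in \<open>auto simp: broken_polynomials_def\<close>)

context conforming_polynomial
begin

definition localised :: "'a \<Rightarrow> 'a \<Rightarrow> real" where
  "localised a = glue (patch \<T> a) (nodal_product a)"

lemma localised_eq:
  assumes "K \<in> patch \<T> a" "x \<in> closure K"
  shows "localised a x = nodal_product a K x"
proof -
  have "nodal_product a K x = nodal_product a K' x"
    if "K \<in> patch \<T> a" "K' \<in> patch \<T> a" "x \<in> closure K" "x \<in> closure K'" for K K' x
    using nodal_product_agree[of K K' x a] that patch_subset by blast
  then show ?thesis unfolding localised_def by (rule glue_eq[OF _ assms])
qed

lemma localised_zero:
  assumes x: "x \<notin> patch_domain \<T> a"
  shows "localised a x = 0"
proof (cases "\<exists>K\<in>patch \<T> a. x \<in> closure K")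
  case True
  then obtain K where K: "K \<in> patch \<T> a" "x \<in> closure K" by blast
  show ?thesis unfolding localised_eq[OF K] by (rule nodal_product_zero[OF K x])
next
  case False
  then show ?thesis unfolding localised_def by (intro glue_outside) auto
qed

text \<open>Along a segment, the function is continuous and piecewise Lipschitz with a common constant on
  finitely many closed pieces.\<close>

lemma localised_lipschitz: obtains L where "L-lipschitz_on UNIV (localised a)"
proof -
  have fin: "finite (patch \<T> a)" by (rule finite_subset[OF patch_subset finite_elements])
  have smooth: "smooth_fun (nodal_product a K)" if "K \<in> patch \<T> a" for K
    by (rule nodal_product_smooth[OF subsetD[OF patch_subset that]])
  obtain M where M: "M \<ge> 0" "\<And>K. K \<in> patch \<T> a \<Longrightarrow> M-lipschitz_on (closure K) (nodal_product a K)"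
    "\<And>K x. K \<in> patch \<T> a \<Longrightarrow> x \<in> K \<Longrightarrow> norm (grad (nodal_product a K) x) \<le> M"
    using common_lipschitz_constant[where A = "patch \<T> a" and Q = "nodal_product a"] smooth patch_subset[of a] by auto
  have LM: "M-lipschitz_on (closure K) (localised a)" if K: "K \<in> patch \<T> a" for K
    by (rule lipschitz_on_transform[OF M(2)[OF K]]) (rule localised_eq[OF K])
  have "M-lipschitz_on UNIV (localised a)"
  proof (rule lipschitz_onI[OF _ M(1)])
    fix x y :: 'a
    define \<gamma> where "\<gamma> t = x + t *\<^sub>R (y - x)" for t
    have \<gamma>c: "continuous_on UNIV \<gamma>" unfolding \<gamma>_def by (intro continuous_intros)
    have dist\<gamma>: "dist (\<gamma> s) (\<gamma> t) = dist x y * dist s t" for s t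
    proof -
      have "\<gamma> s - \<gamma> t = (s - t) *\<^sub>R (y - x)" by (simp add: \<gamma>_def algebra_simps)
      then show ?thesis by (simp add: dist_norm norm_minus_commute mult.commute)
    qed
    \<comment> \<open>the segment from \<open>x\<close> to \<open>y\<close> is cut into its parts in the elements and a part where the function vanishes\<close>
    define U where "U i = (case i of None \<Rightarrow> \<gamma> -` (- patch_domain \<T> a) | Some K \<Rightarrow> \<gamma> -` closure K)" for i
    define I where "I = insert None (Some ` patch \<T> a)"
    have "(M * dist x y)-lipschitz_on {0..1} (\<lambda>t. localised a (\<gamma> t))"
    proof (rule lipschitz_on_closed_Union[of I _ U])
      show "finite I" using fin by (simp add: I_def)
      show "0 \<le> M * dist x y" using M(1) by simp
      show "closed (U i)" for i
        using \<gamma>c open_patch_domain[of a] unfolding U_def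
        by (auto split: option.splits intro!: closed_vimage simp: closed_Compl)
      show "{0..1} \<subseteq> (\<Union>i\<in>I. U i)"
        using patch_domain_subset[of a] unfolding U_def I_def by auto
      fix i assume "i \<in> I"
      show "(M * dist x y)-lipschitz_on (U i) (\<lambda>t. localised a (\<gamma> t))"
      proof (cases i)
        case None
        then have "0 = localised a (\<gamma> t)" if "t \<in> U i" for t
          using localised_zero that by (simp add: U_def)
        then show ?thesis
          using M(1) by (intro lipschitz_onI) (auto simp: mult_nonneg_nonneg)
      next
        case (Some K)
        then have K: "K \<in> patch \<T> a" using \<open>i \<in> I\<close> by (auto simp: I_def)
        show ?thesis
        proof (rule lipschitz_onI)
          fix s t assume "s \<in> U i" "t \<in> U i"
          then have "dist (localised a (\<gamma> s)) (localised a (\<gamma> t)) \<le> M * dist (\<gamma> s) (\<gamma> t)"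
            by (intro lipschitz_onD[OF LM[OF K]]) (auto simp: U_def Some)
          then show "dist (localised a (\<gamma> s)) (localised a (\<gamma> t)) \<le> M * dist x y * dist s t"
            by (simp add: dist\<gamma> mult.assoc)
        qed (use M(1) in simp)
      qed
    qed
    then have "dist (localised a (\<gamma> 0)) (localised a (\<gamma> 1)) \<le> M * dist x y * dist (0::real) 1"
      by (rule lipschitz_onD) auto
    then show "dist (localised a x) (localised a y) \<le> M * dist x y" by (simp add: \<gamma>_def)
  qed
  then show ?thesis by (rule that)
qed

text \<open>At a point of an element the localised function is a polynomial, hence strictly differentiable.
  Where it vanishes, its gradient does so too, up to a null set.\<close>

lemma localised_H10: "localised a \<in> H10 (patch_domain \<T> a)"
proof -
  let ?A = "patch \<T> a" and ?S = "patch_domain \<T> a"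
  note A = patch_subset[of a] and S = open_patch_domain[of a] and Sm = open_in_lebesgue[OF open_patch_domain[of a]]
  have KT: "K \<in> \<T>" if "K \<in> ?A" for K using that A by blast
  define G where "G x = (\<Sum>K\<in>?A. indicator K x *\<^sub>R grad (nodal_product a K) x)" for x
  have G: "G x = grad (nodal_product a K) x" if "K \<in> ?A" "x \<in> K" for K x
    unfolding G_def by (rule sum_indicator_elements(2)[OF A that])
  obtain L where L: "L-lipschitz_on UNIV (localised a)" by (rule localised_lipschitz)
  show ?thesis
  proof (rule H10_if_lipschitz[OF S bounded_patch_domain L localised_zero])
    have "G \<in> borel_measurable borel"
      unfolding G_def[abs_def]
      by (intro borel_measurable_sum borel_measurable_scaleR borel_measurable_indicator
          borel_measurable_continuous_onI continuous_on_grad nodal_product_smooth KT borel_open element(4))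
    then show "G \<in> borel_measurable (lebesgue_on ?S)"
      by (intro measurable_restrict_space1 measurable_completion) simp
    have "AE x in lebesgue. \<forall>K\<in>?A. \<forall>b\<in>Basis. nodal_product a K x = 0 \<longrightarrow> dir_deriv (nodal_product a K) b x = 0"
      by (intro AE_finite_allI[OF finite_subset[OF A finite_elements]] AE_finite_allI[OF finite_Basis]
          AE_polynomial_zero_critical[OF nodal_product(1)[OF KT]])
    then have "AE x in lebesgue_on ?S. \<forall>K\<in>?A. \<forall>b\<in>Basis. nodal_product a K x = 0 \<longrightarrow> dir_deriv (nodal_product a K) b x = 0"
      using Sm by (auto simp: AE_lebesgue_on_iff elim: eventually_mono)
    then show "AE x in lebesgue_on ?S. strict_gradient (localised a) x (G x) \<and> (localised a x = 0 \<longrightarrow> G x = 0)"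
      using AE_in_element[OF A Sm patch_domain_subset]
    proof eventually_elim
      case (elim x)
      then obtain K where K: "K \<in> ?A" "x \<in> K" by blast
      have loc: "localised a y = nodal_product a K y" if "y \<in> K" for y
        using that closure_subset by (intro localised_eq[OF K(1)]) blast
      have "strict_gradient (localised a) x (G x)"
        unfolding G[OF K]
        by (rule strict_gradient_cong_open[OF smooth_strict_gradient[OF nodal_product_smooth[OF KT[OF K(1)]]]
              element(4)[OF KT[OF K(1)]] K(2) loc])
      moreover have "G x = 0" if "localised a x = 0"
        using elim(1) K that unfolding G[OF K] grad_def by (simp add: loc)
      ultimately show ?case by blast
    qed
  qed
qed

lemma local_best_reproduces: "K \<in> \<T> \<Longrightarrow> x \<in> K \<Longrightarrow> local_best p \<T> u x = P K x"
  by (rule local_best_eq[OF _ _ P uP])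

abbreviation interpolant :: "'a \<Rightarrow> 'a \<Rightarrow> real" where
  "interpolant a \<equiv> lagrange_interpolation p (patch \<T> a) (\<lambda>z. hat_function \<T> a z * local_best p \<T> u z)"

lemma interpolant_eq:
  assumes K: "K \<in> patch \<T> a" "x \<in> K"
  shows "interpolant a x = nodal_product a K x"
proof -
  have KT: "K \<in> \<T>" using K(1) patch_subset by blast
  show ?thesis
  proof (rule lagrange_interpolation_eq[OF patch_subset p K nodal_product(1)[OF KT]])
    show "continuous_on UNIV (\<lambda>y. hat_poly a K y * P K y)"
      by (intro continuous_on_mult smooth_fun_continuous smooth_fun_polynomial[OF hat_poly_polynomial[OF KT]] P_smooth[OF KT])
    show "hat_function \<T> a z * local_best p \<T> u z = hat_poly a K z * P K z" if "z \<in> K" for z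
      using hat_function_eq[OF KT, of z a] local_best_reproduces[OF KT that] closure_subset[of K] that by auto
  qed (rule nodal_product(2)[OF KT])
qed

lemma interpolant_in_patch_space: "interpolant a \<in> patch_space p \<T> a"
  unfolding patch_space_def
proof
  show "interpolant a \<in> broken_polynomials p (patch \<T> a)"
    unfolding broken_polynomials_def using interpolant_eq nodal_product(1) patch_subset by blast
  have Sm: "patch_domain \<T> a \<in> sets lebesgue" by (rule open_in_lebesgue[OF open_patch_domain])
  have fin: "finite (patch \<T> a)" by (rule finite_subset[OF patch_subset finite_elements])
  have sum: "interpolant a x = (\<Sum>K\<in>patch \<T> a. indicator K x * nodal_product a K x)" for x
  proof (cases "\<exists>K\<in>patch \<T> a. x \<in> K")
    case True
    then obtain K where K: "K \<in> patch \<T> a" "x \<in> K" by blast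
    show ?thesis unfolding interpolant_eq[OF K] by (rule sum_indicator_elements(1)[OF patch_subset K, symmetric])
  next
    case False
    then show ?thesis unfolding lagrange_interpolation_def by (intro sum.cong) auto
  qed
  have "interpolant a \<in> borel_measurable borel"
    unfolding sum[abs_def]
    by (intro borel_measurable_sum borel_measurable_times borel_measurable_indicator borel_open element(4)
        borel_measurable_continuous_onI smooth_fun_continuous nodal_product_smooth subsetD[OF patch_subset])
  then have m: "interpolant a \<in> borel_measurable (lebesgue_on (patch_domain \<T> a))"
    by (intro measurable_restrict_space1 measurable_completion) simp
  have "AE x in lebesgue_on (patch_domain \<T> a). localised a x = interpolant a x"
    using AE_in_element[OF patch_subset Sm patch_domain_subset]
  proof eventually_elim
    case (elim x)
    then obtain K where K: "K \<in> patch \<T> a" "x \<in> K" by blast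
    show ?case using localised_eq[OF K(1)] interpolant_eq[OF K] K(2) closure_subset[of K] by auto
  qed
  then show "interpolant a \<in> H10 (patch_domain \<T> a)"
    by (rule H10_cong_AE[OF open_patch_domain localised_H10 m])
qed

section \<open>The projection property\<close>

text \<open>The interpolant itself is admissible and makes the functional vanish. Any other minimiser then
  differs from it by a function of \<open>H\<^sup>1\<^sub>0\<close> with zero gradient.\<close>

lemma potential_reconstruction_AE:
  "AE x in lebesgue_on (patch_domain \<T> a). potential_reconstruction p \<T> a (local_best p \<T> u) x = interpolant a x"
proof -
  let ?S = "patch_domain \<T> a" and ?A = "patch \<T> a"
  note S = open_patch_domain[of a] bounded_patch_domain[of a] and Sm = open_in_lebesgue[OF open_patch_domain[of a]]
  let ?F = "\<lambda>v. L2_norm_on ?S (broken_gradient ?A (\<lambda>y. interpolant a y - v y))"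
  let ?V = "\<lambda>v. v \<in> patch_space p \<T> a"
  have nonneg: "?F v \<ge> 0" for v
    unfolding L2_norm_on_def by (simp add: Bochner_Integration.integral_nonneg)
  have pieces: "\<exists>Q. \<forall>K\<in>?A. smooth_fun (Q K) \<and> (\<forall>x\<in>K. interpolant a x - v x = Q K x)" if v: "?V v" for v
  proof -
    have "\<exists>R. \<forall>K\<in>?A. R K \<in> polynomials p \<and> (\<forall>x\<in>K. v x = R K x)"
      using v by (intro broken_polynomials_choice) (simp add: patch_space_def)
    then obtain R where R: "\<And>K. K \<in> ?A \<Longrightarrow> R K \<in> polynomials p" "\<And>K x. K \<in> ?A \<Longrightarrow> x \<in> K \<Longrightarrow> v x = R K x" by blast
    have "smooth_fun (\<lambda>x. nodal_product a K x - R K x)" if "K \<in> ?A" for K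
      using that patch_subset by (intro smooth_fun_diff nodal_product_smooth smooth_fun_polynomial[OF R(1)]) auto
    then show ?thesis
      using R(2) interpolant_eq by (intro exI[of _ "\<lambda>K x. nodal_product a K x - R K x"]) auto
  qed
  have zero_iff: "?F v = 0 \<longleftrightarrow> (AE x in lebesgue_on ?S. broken_gradient ?A (\<lambda>y. interpolant a y - v y) x = 0)"
    if v: "?V v" for v
  proof -
    obtain Q where "\<And>K. K \<in> ?A \<Longrightarrow> smooth_fun (Q K)" "\<And>K x. K \<in> ?A \<Longrightarrow> x \<in> K \<Longrightarrow> interpolant a x - v x = Q K x"
      using pieces[OF v] by blast
    then show ?thesis
      by (intro broken_gradient_norm_eq_0_iff[OF patch_subset _ _ S patch_domain_subset])
  qed
  have "?F (interpolant a) = 0"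
  proof -
    have g0: "grad (\<lambda>_. 0) x = 0" for x :: 'a by (rule grad_unique) simp
    have "AE x in lebesgue. \<forall>K\<in>?A. x \<in> K \<longrightarrow> broken_gradient ?A (\<lambda>y. interpolant a y - interpolant a y) x = grad (\<lambda>_. 0) x"
      by (rule broken_gradient_AE(1)[OF patch_subset]) (simp_all add: smooth_fun_const)
    then have "AE x in lebesgue_on ?S. \<forall>K\<in>?A. x \<in> K \<longrightarrow> broken_gradient ?A (\<lambda>y. interpolant a y - interpolant a y) x = 0"
      using Sm by (auto simp: AE_lebesgue_on_iff g0 elim: eventually_mono)
    then have "AE x in lebesgue_on ?S. broken_gradient ?A (\<lambda>y. interpolant a y - interpolant a y) x = 0"
      using AE_in_element[OF patch_subset Sm patch_domain_subset] by eventually_elim blast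
    then show ?thesis using zero_iff[OF interpolant_in_patch_space] by blast
  qed
  then have "is_arg_min ?F ?V (interpolant a)"
    using nonneg interpolant_in_patch_space by (auto simp: is_arg_min_def not_less)
  then have "is_arg_min ?F ?V (arg_min ?F ?V)"
    unfolding arg_min_def by (rule someI[of "is_arg_min ?F ?V"])
  then have v: "?V (arg_min ?F ?V)" "\<not> ?F (interpolant a) < ?F (arg_min ?F ?V)"
    using interpolant_in_patch_space[of a] unfolding is_arg_min_def by blast+
  define v where "v = arg_min ?F ?V"
  note v = v_def v[folded v_def]
  then have "?F v = 0" using nonneg[of v] \<open>?F (interpolant a) = 0\<close> by simp
  then have bg: "AE x in lebesgue_on ?S. broken_gradient ?A (\<lambda>y. interpolant a y - v y) x = 0"
    using zero_iff[OF v(2)] by blast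
  let ?e = "\<lambda>y. interpolant a y - v y"
  have e: "?e \<in> H10 ?S"
    using interpolant_in_patch_space[of a] v(2) unfolding patch_space_def by (intro H10_diff S) auto
  obtain Q where Q: "\<And>K. K \<in> ?A \<Longrightarrow> smooth_fun (Q K)" "\<And>K x. K \<in> ?A \<Longrightarrow> x \<in> K \<Longrightarrow> ?e x = Q K x"
    using pieces[OF v(2)] by blast
  have "AE x in lebesgue. \<forall>K\<in>?A. x \<in> K \<longrightarrow> broken_gradient ?A ?e x = grad (Q K) x"
    by (rule broken_gradient_AE(1)[OF patch_subset Q])
  moreover have "AE x in lebesgue. \<forall>K\<in>?A. x \<in> K \<longrightarrow> weak_gradient ?S ?e x = grad (Q K) x"
    by (rule weak_gradient_on_elements[OF patch_subset Q S(1) element_in_patch_domain H10_weak_gradient[OF e]])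
  ultimately have "AE x in lebesgue. \<forall>K\<in>?A. x \<in> K \<longrightarrow> weak_gradient ?S ?e x = broken_gradient ?A ?e x"
    by eventually_elim simp
  then have "AE x in lebesgue_on ?S. \<forall>K\<in>?A. x \<in> K \<longrightarrow> weak_gradient ?S ?e x = broken_gradient ?A ?e x"
    using Sm by (auto simp: AE_lebesgue_on_iff elim: eventually_mono)
  then have "AE x in lebesgue_on ?S. weak_gradient ?S ?e x = 0"
    using bg AE_in_element[OF patch_subset Sm patch_domain_subset] by eventually_elim auto
  then have "AE x in lebesgue_on ?S. ?e x = 0"
    by (rule H10_zero_gradient[OF S e H10_weak_gradient[OF e]])
  then have "AE x in lebesgue. x \<in> ?S \<longrightarrow> ?e x = 0" using Sm by (simp add: AE_lebesgue_on_iff)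
  then have "AE x in lebesgue. x \<in> ?S \<longrightarrow> potential_reconstruction p \<T> a (local_best p \<T> u) x = interpolant a x"
    by (rule eventually_mono) (simp add: potential_reconstruction_def v(1)[symmetric])
  then show ?thesis using Sm by (simp add: AE_lebesgue_on_iff)
qed

text \<open>The hat functions of the vertices of an element form a partition of unity on it.\<close>

lemma nodal_product_sum:
  assumes K: "K \<in> \<T>"
  shows "(\<Sum>a\<in>vertices K. nodal_product a K x) = P K x"
proof -
  have "(\<lambda>x. \<Sum>a\<in>vertices K. nodal_product a K x) = P K"
  proof (rule polynomials_eq_if_element_nodes[OF K p _ P[OF K]])
    show "(\<lambda>x. \<Sum>a\<in>vertices K. nodal_product a K x) \<in> polynomials p"
      by (intro polynomials_sum nodal_product(1)[OF K])
    fix y assume y: "y \<in> simplex_nodes p (vertices K)"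
    have "(\<Sum>a\<in>vertices K. nodal_product a K y) = (\<Sum>a\<in>vertices K. hat_poly a K y) * P K y"
      unfolding sum_distrib_right using nodal_product(2)[OF K y] by simp
    then show "(\<Sum>a\<in>vertices K. nodal_product a K y) = P K y"
      using hat_poly_sum[OF K nodes_in_closure[OF K y]] by simp
  qed
  then show ?thesis by (rule fun_cong)
qed

lemma quasi_interpolation_reproduces: "AE x in lebesgue_on \<Omega>. quasi_interpolation p \<T> u x = u x"
proof -
  let ?s = "\<lambda>a. potential_reconstruction p \<T> a (local_best p \<T> u)"
  have "AE x in lebesgue. x \<in> patch_domain \<T> a \<longrightarrow> ?s a x = interpolant a x" for a
    using potential_reconstruction_AE[of a] open_in_lebesgue[OF open_patch_domain, of a]
    by (simp add: AE_lebesgue_on_iff)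
  then have "AE x in lebesgue. \<forall>a\<in>mesh_vertices \<T>. x \<in> patch_domain \<T> a \<longrightarrow> ?s a x = interpolant a x"
    using finite_mesh_vertices by (simp add: AE_ball_countable countable_finite)
  then have "AE x in lebesgue_on \<Omega>. \<forall>a\<in>mesh_vertices \<T>. x \<in> patch_domain \<T> a \<longrightarrow> ?s a x = interpolant a x"
    using open_in_lebesgue[OF open_domain] by (auto simp: AE_lebesgue_on_iff elim: eventually_mono)
  moreover note AE_domain_in_element
  ultimately show ?thesis
  proof eventually_elim
    case (elim x)
    then obtain K where K: "K \<in> \<T>" "x \<in> K" by blast
    have V: "vertices K \<subseteq> mesh_vertices \<T>" using K(1) by (auto simp: mesh_vertices_def)
    have "quasi_interpolation p \<T> u x = (\<Sum>a\<in>mesh_vertices \<T>. ?s a x)"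
      by (simp add: quasi_interpolation_def)
    also have "\<dots> = (\<Sum>a\<in>vertices K. ?s a x)"
    proof (rule sum.mono_neutral_right[OF finite_mesh_vertices V], rule ballI)
      fix a assume "a \<in> mesh_vertices \<T> - vertices K"
      then have "x \<notin> patch_domain \<T> a" using in_patch_domain_iff[OF K] by blast
      then show "?s a x = 0" by (simp add: potential_reconstruction_def)
    qed
    also have "\<dots> = (\<Sum>a\<in>vertices K. nodal_product a K x)"
    proof (rule sum.cong[OF refl])
      fix a assume a: "a \<in> vertices K"
      then have "?s a x = interpolant a x" using elim(1) V in_patch_domain_iff[OF K] by blast
      also have "\<dots> = nodal_product a K x"
        using a K by (intro interpolant_eq) (auto simp: patch_def)
      finally show "?s a x = nodal_product a K x" .
    qed
    also have "\<dots> = u x" using nodal_product_sum[OF K(1)] uP[OF K] by simp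
    finally show ?case .
  qed
qed

end

theorem theorem4p4:
  fixes \<Omega> :: "'a::euclidean_space set"
    and \<T> :: "'a set set"
    and p :: nat
  assumes "lipschitz_polyhedral_domain \<Omega>"
    and "matching_mesh \<Omega> \<T>"
    and "p \<ge> 1"
  shows "\<forall>u \<in> broken_polynomials p \<T> \<inter> H10 \<Omega>.
           AE x in lebesgue_on \<Omega>. quasi_interpolation p \<T> u x = u x"
proof
  fix u assume u: "u \<in> broken_polynomials p \<T> \<inter> H10 \<Omega>"
  then obtain P where P: "\<forall>K\<in>\<T>. P K \<in> polynomials p \<and> (\<forall>x\<in>K. u x = P K x)"
    using broken_polynomials_choice[of u p \<T>] by blast
  interpret conforming_polynomial \<Omega> \<T> p u P
    by unfold_locales (use assms u P in auto)
  show "AE x in lebesgue_on \<Omega>. quasi_interpolation p \<T> u x = u x"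
    by (rule quasi_interpolation_reproduces)
qed

end
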